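(* Let $U$ be a completely simple semigroup and let $H$ be a maximal subgroup of $U$. Then $U$ is of type left-$\mathrm{FP}_n$ and right-$\mathrm{FP}_n$ if and only if $U$ has finitely many left and right ideals and the group $H$ is of type $\mathrm{FP}_n$.
   Context: For a monoid $S$, $\mathbb{Z}S$ denotes the integral monoid ring, and $\mathbb{Z}$ is regarded as the trivial left (respectively right) $\mathbb{Z}S$-module via the augmentation $\epsilon_S:\mathbb{Z}S\to\mathbb{Z}$, $s\mapsto 1$ ($s\in S$). For $n\geq 0$ the monoid $S$ is of type left-$\mathrm{FP}_n$ (respectively right-$\mathrm{FP}_n$) if there is an exact sequence $A_n\to A_{n-1}\to\cdots\to A_0\to\mathbb{Z}\to 0$ of left (respectively right) $\mathbb{Z}S$-modules with $A_0,\ldots,A_n$ finitely generated and free. A semigroup $S$ without a two-sided identity is of type left-$\mathrm{FP}_n$ (right-$\mathrm{FP}_n$) if the monoid $S^1=S\cup\{1\}$, obtained by adjoining an identity element, is. For a group, left-$\mathrm{FP}_n$ and right-$\mathrm{FP}_n$ are equivalent and one says "type $\mathrm{FP}_n$". A semigroup is simple if it has no proper two-sided ideals, and completely simple if it is simple and has minimal left and minimal right ideals. For an idempotent $e\in U$, the maximal subgroup of $U$ containing $e$ is the group of units of $eUe$.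
   Formalization: The claim is stated for n ≥ 1 only; for n = 0 it fails, since every monoid is of type FP_0 while an infinite left zero semigroup is completely simple with infinitely many right ideals. *)

theory Defs
  imports
    "HOL-Algebra.Module"
    "HOL-Algebra.AbelCoset"
    "HOL-Library.Poly_Mapping"
begin

section \<open>Modules over a not necessarily commutative ring\<close>

text \<open>
  The locale \<open>module\<close> of HOL-Algebra requires a commutative ring of scalars; only its record type
  is reused. As there, the fields \<open>mult\<close> and \<open>one\<close> of the record \<open>M\<close> play no role.
\<close>

locale left_module = R?: ring R + M?: abelian_group M for R (structure) and M (structure) +
  assumes lsmult_closed:
      "\<lbrakk>a \<in> carrier R; x \<in> carrier M\<rbrakk> \<Longrightarrow> a \<odot>\<^bsub>M\<^esub> x \<in> carrier M"
    and lsmult_l_distr: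
      "\<lbrakk>a \<in> carrier R; b \<in> carrier R; x \<in> carrier M\<rbrakk>
        \<Longrightarrow> (a \<oplus>\<^bsub>R\<^esub> b) \<odot>\<^bsub>M\<^esub> x = a \<odot>\<^bsub>M\<^esub> x \<oplus>\<^bsub>M\<^esub> b \<odot>\<^bsub>M\<^esub> x"
    and lsmult_r_distr:
      "\<lbrakk>a \<in> carrier R; x \<in> carrier M; y \<in> carrier M\<rbrakk>
        \<Longrightarrow> a \<odot>\<^bsub>M\<^esub> (x \<oplus>\<^bsub>M\<^esub> y) = a \<odot>\<^bsub>M\<^esub> x \<oplus>\<^bsub>M\<^esub> a \<odot>\<^bsub>M\<^esub> y"
    and lsmult_assoc:
      "\<lbrakk>a \<in> carrier R; b \<in> carrier R; x \<in> carrier M\<rbrakk>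
        \<Longrightarrow> (a \<otimes>\<^bsub>R\<^esub> b) \<odot>\<^bsub>M\<^esub> x = a \<odot>\<^bsub>M\<^esub> (b \<odot>\<^bsub>M\<^esub> x)"
    and lsmult_one:
      "x \<in> carrier M \<Longrightarrow> \<one>\<^bsub>R\<^esub> \<odot>\<^bsub>M\<^esub> x = x"

text \<open>
  A right \<open>R\<close>-module is a left module over the opposite ring: \<open>a \<odot>\<^bsub>M\<^esub> x\<close> is then read as \<open>x a\<close>.
\<close>

definition opposite_ring :: "('r, 'x) ring_scheme \<Rightarrow> ('r, 'x) ring_scheme" where
  "opposite_ring R = R\<lparr>mult := (\<lambda>a b. b \<otimes>\<^bsub>R\<^esub> a)\<rparr>"

definition linear_maps ::
    "('r, 'x) ring_scheme \<Rightarrow> ('r, 'a, 'y) module_scheme \<Rightarrow> ('r, 'b, 'z) module_scheme \<Rightarrow> ('a \<Rightarrow> 'b) set"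
  where
  "linear_maps R M N = {f \<in> carrier M \<rightarrow> carrier N.
     (\<forall>x\<in>carrier M. \<forall>y\<in>carrier M. f (x \<oplus>\<^bsub>M\<^esub> y) = f x \<oplus>\<^bsub>N\<^esub> f y) \<and>
     (\<forall>a\<in>carrier R. \<forall>x\<in>carrier M. f (a \<odot>\<^bsub>M\<^esub> x) = a \<odot>\<^bsub>N\<^esub> f x)}"

definition generates :: "('r, 'x) ring_scheme \<Rightarrow> ('r, 'm, 'y) module_scheme \<Rightarrow> 'm set \<Rightarrow> bool" where
  "generates R M X \<longleftrightarrow> X \<subseteq> carrier M \<and>
     (\<forall>m\<in>carrier M. \<exists>F c. finite F \<and> F \<subseteq> X \<and> c \<in> F \<rightarrow> carrier R \<and>
        m = (\<Oplus>\<^bsub>M\<^esub>x\<in>F. c x \<odot>\<^bsub>M\<^esub> x))"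

definition independent :: "('r, 'x) ring_scheme \<Rightarrow> ('r, 'm, 'y) module_scheme \<Rightarrow> 'm set \<Rightarrow> bool" where
  "independent R M X \<longleftrightarrow> X \<subseteq> carrier M \<and>
     (\<forall>F c. finite F \<and> F \<subseteq> X \<and> c \<in> F \<rightarrow> carrier R \<and> (\<Oplus>\<^bsub>M\<^esub>x\<in>F. c x \<odot>\<^bsub>M\<^esub> x) = \<zero>\<^bsub>M\<^esub>
        \<longrightarrow> (\<forall>x\<in>F. c x = \<zero>\<^bsub>R\<^esub>))"

definition finitely_generated :: "('r, 'x) ring_scheme \<Rightarrow> ('r, 'm, 'y) module_scheme \<Rightarrow> bool" where
  "finitely_generated R M \<longleftrightarrow> (\<exists>X. finite X \<and> generates R M X)"

definition free :: "('r, 'x) ring_scheme \<Rightarrow> ('r, 'm, 'y) module_scheme \<Rightarrow> bool" where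
  "free R M \<longleftrightarrow> (\<exists>X. generates R M X \<and> independent R M X)"

text \<open>
  The sequence \<open>A n \<rightarrow> \<dots> \<rightarrow> A 1 \<rightarrow> A 0 \<rightarrow> M \<rightarrow> 0\<close>, with \<open>d i : A (i + 1) \<rightarrow> A i\<close> for \<open>i < n\<close> and
  \<open>\<epsilon> : A 0 \<rightarrow> M\<close>, is exact at \<open>M\<close> and at \<open>A 0, \<dots>, A (n - 1)\<close>; nothing is demanded at \<open>A n\<close>,
  and modules and maps of higher index are ignored.
\<close>

definition partial_free_resolution ::
    "('r, 'x) ring_scheme \<Rightarrow> ('r, 'm, 'y) module_scheme \<Rightarrow> nat \<Rightarrow>
     (nat \<Rightarrow> ('r, 'a) module) \<Rightarrow> ('a \<Rightarrow> 'm) \<Rightarrow> (nat \<Rightarrow> 'a \<Rightarrow> 'a) \<Rightarrow> bool"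
  where
  "partial_free_resolution R M n A \<epsilon> d \<longleftrightarrow>
     (\<forall>i\<le>n. left_module R (A i) \<and> finitely_generated R (A i) \<and> free R (A i)) \<and>
     \<epsilon> \<in> linear_maps R (A 0) M \<and>
     (\<forall>i<n. d i \<in> linear_maps R (A (Suc i)) (A i)) \<and>
     \<epsilon> ` carrier (A 0) = carrier M \<and>
     (0 < n \<longrightarrow> d 0 ` carrier (A 1) = a_kernel (A 0) M \<epsilon>) \<and>
     (\<forall>i. Suc i < n \<longrightarrow>
        d (Suc i) ` carrier (A (Suc (Suc i))) = a_kernel (A (Suc i)) (A i) (d i))"

text \<open>
  Quantification over all modules has to be restricted to a type of module elements. Since every
  finitely generated module over \<open>R\<close> is isomorphic to one whose elements have type \<open>nat \<Rightarrow> 'r\<close>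
  (send an element to a choice of coefficients with respect to a finite list of generators),
  no generality is lost by using this type.
\<close>

definition module_FP :: "nat \<Rightarrow> ('r, 'x) ring_scheme \<Rightarrow> ('r, 'm, 'y) module_scheme \<Rightarrow> bool" where
  "module_FP n R M \<longleftrightarrow>
     (\<exists>(A :: nat \<Rightarrow> ('r, nat \<Rightarrow> 'r) module) \<epsilon> d. partial_free_resolution R M n A \<epsilon> d)"


section \<open>Integral monoid rings and monoids of type FP\<close>

text \<open>
  \<open>frag_extend\<close> is \<open>\<int>\<close>-linear extension, so the product below is the bilinear extension of the
  product of \<open>S\<close>.
\<close>

definition monoid_ring :: "('a, 'x) monoid_scheme \<Rightarrow> ('a \<Rightarrow>\<^sub>0 int) ring" where
  "monoid_ring S =
     \<lparr>carrier = {a. Poly_Mapping.keys a \<subseteq> carrier S},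
      mult = (\<lambda>a b. frag_extend (\<lambda>s. frag_extend (\<lambda>t. frag_of (s \<otimes>\<^bsub>S\<^esub> t)) b) a),
      one = frag_of \<one>\<^bsub>S\<^esub>,
      zero = 0,
      add = (+)\<rparr>"

definition augmentation :: "('a \<Rightarrow>\<^sub>0 int) \<Rightarrow> int" where
  "augmentation a = (\<Sum>s\<in>Poly_Mapping.keys a. Poly_Mapping.lookup a s)"

text \<open>
  The same record is the trivial left and the trivial right module, i.e. it is a left module over
  \<open>monoid_ring S\<close> and over \<open>opposite_ring (monoid_ring S)\<close>.
\<close>

definition trivial_module :: "('a \<Rightarrow>\<^sub>0 int, int) module" where
  "trivial_module =
     \<lparr>carrier = UNIV, mult = (*), one = 1, zero = 0, add = (+), smult = (\<lambda>a k. augmentation a * k)\<rparr>"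

definition left_FP :: "nat \<Rightarrow> ('a, 'x) monoid_scheme \<Rightarrow> bool" where
  "left_FP n S \<longleftrightarrow> module_FP n (monoid_ring S) trivial_module"

definition right_FP :: "nat \<Rightarrow> ('a, 'x) monoid_scheme \<Rightarrow> bool" where
  "right_FP n S \<longleftrightarrow> module_FP n (opposite_ring (monoid_ring S)) trivial_module"

text \<open>
  For a group \<open>left_FP\<close> and \<open>right_FP\<close> agree, because inversion identifies the group ring with its
  opposite.
\<close>

definition group_FP :: "nat \<Rightarrow> ('a, 'x) monoid_scheme \<Rightarrow> bool" where
  "group_FP n G \<longleftrightarrow> left_FP n G"


section \<open>Semigroups\<close>

record 'a sgrp = "'a partial_object" +
  sgmult :: "'a \<Rightarrow> 'a \<Rightarrow> 'a" (infixl \<open>\<cdot>\<index>\<close> 70)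

locale sgroup = fixes U :: "('a, 'x) sgrp_scheme" (structure)
  assumes sg_closed: "\<lbrakk>x \<in> carrier U; y \<in> carrier U\<rbrakk> \<Longrightarrow> x \<cdot> y \<in> carrier U"
    and sg_assoc: "\<lbrakk>x \<in> carrier U; y \<in> carrier U; z \<in> carrier U\<rbrakk> \<Longrightarrow> (x \<cdot> y) \<cdot> z = x \<cdot> (y \<cdot> z)"

definition left_ideal :: "('a, 'x) sgrp_scheme \<Rightarrow> 'a set \<Rightarrow> bool" where
  "left_ideal U L \<longleftrightarrow> L \<subseteq> carrier U \<and> L \<noteq> {} \<and> (\<forall>u\<in>carrier U. \<forall>x\<in>L. u \<cdot>\<^bsub>U\<^esub> x \<in> L)"

definition right_ideal :: "('a, 'x) sgrp_scheme \<Rightarrow> 'a set \<Rightarrow> bool" where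
  "right_ideal U K \<longleftrightarrow> K \<subseteq> carrier U \<and> K \<noteq> {} \<and> (\<forall>u\<in>carrier U. \<forall>x\<in>K. x \<cdot>\<^bsub>U\<^esub> u \<in> K)"

definition two_sided_ideal :: "('a, 'x) sgrp_scheme \<Rightarrow> 'a set \<Rightarrow> bool" where
  "two_sided_ideal U I \<longleftrightarrow> left_ideal U I \<and> right_ideal U I"

definition minimal_left_ideal :: "('a, 'x) sgrp_scheme \<Rightarrow> 'a set \<Rightarrow> bool" where
  "minimal_left_ideal U L \<longleftrightarrow> left_ideal U L \<and> (\<forall>L'. left_ideal U L' \<and> L' \<subseteq> L \<longrightarrow> L' = L)"

definition minimal_right_ideal :: "('a, 'x) sgrp_scheme \<Rightarrow> 'a set \<Rightarrow> bool" where
  "minimal_right_ideal U K \<longleftrightarrow> right_ideal U K \<and> (\<forall>K'. right_ideal U K' \<and> K' \<subseteq> K \<longrightarrow> K' = K)"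

definition simple_semigroup :: "('a, 'x) sgrp_scheme \<Rightarrow> bool" where
  "simple_semigroup U \<longleftrightarrow> sgroup U \<and> (\<forall>I. two_sided_ideal U I \<longrightarrow> I = carrier U)"

definition completely_simple :: "('a, 'x) sgrp_scheme \<Rightarrow> bool" where
  "completely_simple U \<longleftrightarrow> simple_semigroup U \<and>
     (\<exists>L. minimal_left_ideal U L) \<and> (\<exists>K. minimal_right_ideal U K)"

definition local_monoid :: "('a, 'x) sgrp_scheme \<Rightarrow> 'a \<Rightarrow> 'a monoid" where
  "local_monoid U e =
     \<lparr>carrier = {e \<cdot>\<^bsub>U\<^esub> u \<cdot>\<^bsub>U\<^esub> e | u. u \<in> carrier U}, mult = sgmult U, one = e\<rparr>"

definition maximal_subgroup :: "('a, 'x) sgrp_scheme \<Rightarrow> 'a monoid \<Rightarrow> bool" where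
  "maximal_subgroup U H \<longleftrightarrow>
     (\<exists>e\<in>carrier U. e \<cdot>\<^bsub>U\<^esub> e = e \<and> H = units_of (local_monoid U e))"

definition is_identity :: "('a, 'x) sgrp_scheme \<Rightarrow> 'a \<Rightarrow> bool" where
  "is_identity U e \<longleftrightarrow> e \<in> carrier U \<and> (\<forall>x\<in>carrier U. e \<cdot>\<^bsub>U\<^esub> x = x \<and> x \<cdot>\<^bsub>U\<^esub> e = x)"

definition as_monoid :: "('a, 'x) sgrp_scheme \<Rightarrow> 'a monoid" where
  "as_monoid U = \<lparr>carrier = carrier U, mult = sgmult U, one = (THE e. is_identity U e)\<rparr>"

definition adjoin_one :: "('a, 'x) sgrp_scheme \<Rightarrow> 'a option monoid" where
  "adjoin_one U =
     \<lparr>carrier = insert None (Some ` carrier U),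
      mult = (\<lambda>x y. case x of None \<Rightarrow> y | Some u \<Rightarrow>
                (case y of None \<Rightarrow> Some u | Some v \<Rightarrow> Some (u \<cdot>\<^bsub>U\<^esub> v))),
      one = None\<rparr>"

text \<open>An identity is adjoined only if there is none already.\<close>

definition semigroup_left_FP :: "nat \<Rightarrow> ('a, 'x) sgrp_scheme \<Rightarrow> bool" where
  "semigroup_left_FP n U \<longleftrightarrow>
     (if \<exists>e. is_identity U e then left_FP n (as_monoid U) else left_FP n (adjoin_one U))"

definition semigroup_right_FP :: "nat \<Rightarrow> ('a, 'x) sgrp_scheme \<Rightarrow> bool" where
  "semigroup_right_FP n U \<longleftrightarrow>
     (if \<exists>e. is_identity U e then right_FP n (as_monoid U) else right_FP n (adjoin_one U))"

end

theory Submission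
  imports Defs HOL.Modules
begin

text \<open>
  Let \<open>e\<close> be the identity of \<open>H\<close>, so that \<open>H = eUe\<close>, and suppose that \<open>U\<close> has no identity; put
  \<open>S = U\<^sup>1\<close>. Let \<open>E\<close> be the set of idempotents of the minimal left ideal \<open>L = Ue\<close> and \<open>F\<close> the set of
  idempotents of the minimal right ideal \<open>eU\<close>. As \<open>E\<close> meets each minimal right ideal once and \<open>F\<close>
  each minimal left ideal once, \<open>U\<close> has finitely many right (left) ideals iff \<open>E\<close> (iff \<open>F\<close>) is finite.

  Finiteness of \<open>E\<close>. Suppose \<open>A\<^sub>1 \<rightarrow> A\<^sub>0 \<rightarrow> \<int> \<rightarrow> 0\<close> is exact with finitely generated free modules. Left
  multiplication by \<open>u \<in> U\<close> moves everything into the minimal right ideal of \<open>u\<close>. Hence, for a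
  minimal right ideal that is missed by the finitely many elements of \<open>S\<close> occurring in generators of
  the kernel of \<open>A\<^sub>0 \<rightarrow> \<int>\<close>, the part of the kernel in that right ideal has augmentation zero. But if \<open>a\<close>
  lifts \<open>1\<close> and \<open>u\<close> lies in the right ideal, then \<open>u a - a\<close> is in the kernel, and its part there has
  augmentation one unless the right ideal meets the support of \<open>a\<close> (\<open>finite_left_band\<close>). The
  opposite semigroup gives finiteness of \<open>F\<close> from right-FP.

  From \<open>S\<close> to \<open>H\<close>. The functor \<open>M \<mapsto> eM\<close> is exact, fixes \<open>\<int>\<close>, and sends \<open>\<int>S\<close> to \<open>\<int>(eU)\<close>, which is free
  over \<open>\<int>H\<close> with basis \<open>F\<close>. So it carries resolutions to resolutions
  (\<open>FPZ_grp_of_adjoin_one\<close>).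

  From \<open>H\<close> to \<open>S\<close>. The functor \<open>M \<mapsto> \<int>L \<otimes> M\<close> is exact because \<open>L\<close> is a free right \<open>H\<close>-set on \<open>E\<close>, and it
  sends \<open>\<int>H\<close> to \<open>\<int>L = \<int>Se\<close>, which is projective. Hence \<open>\<int>L \<otimes> \<int> = \<int>[E]\<close> is of type FP. Its
  augmentation onto \<open>\<int>\<close> has a kernel that \<open>U\<close> annihilates, so this kernel is built from finitely many
  copies of \<open>\<int>S/\<int>U\<close>; and \<open>\<int>U\<close> is the direct sum of the projective modules \<open>\<int>Sf\<close> with \<open>f \<in> F\<close>.
  Dimension shifting (\<open>FP_quotient\<close>) then yields type FP for \<open>\<int>\<close> (\<open>FPZ_adjoin_one_of_grp\<close>). For
  the right-handed version one also needs that a group and its opposite have the same type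
  (\<open>FPZ_op\<close>).

  All three passages between monoids are instances of one construction, the locale
  \<open>monomial_rep\<close>. Every module that occurs is a subgroup of a free abelian group on which
  the monoid acts by additive maps, so the homological algebra is done for such subgroups, with the
  type \<open>'b \<Rightarrow>\<^sub>0 int\<close> as the ambient free abelian group; \<open>left_FP_iff_FPZ\<close> compares this with
  modules over the monoid ring. If \<open>U\<close> does have an identity, it is \<open>e\<close>, and \<open>U = H\<close> is a group.
\<close>

section \<open>Subgroups of free abelian groups with a monoid action\<close>

type_synonym 'b frag = "'b \<Rightarrow>\<^sub>0 int"

definition frags :: "'b set \<Rightarrow> 'b frag set" where
  "frags X = {x. Poly_Mapping.keys x \<subseteq> X}"

text \<open>
  Closure under subtraction, with \<open>0\<close> as a member, is closure under the abelian group
  operations; it is the form that induction over free abelian groups asks for.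
\<close>
definition diff_closed :: "'m::ab_group_add set \<Rightarrow> bool" where
  "diff_closed M \<longleftrightarrow> 0 \<in> M \<and> (\<forall>x\<in>M. \<forall>y\<in>M. x - y \<in> M)"

lemma diff_closed_add: "diff_closed M \<Longrightarrow> x \<in> M \<Longrightarrow> y \<in> M \<Longrightarrow> x + y \<in> M"
  unfolding diff_closed_def by (metis diff_0 diff_minus_eq_add)

lemma diff_closed_sum:
  assumes "diff_closed M" "\<And>i. i \<in> I \<Longrightarrow> g i \<in> M"
  shows "sum g I \<in> M"
  using assms(2)
proof (induction I rule: infinite_finite_induct)
  case (insert x F)
  then show ?case using diff_closed_add[OF assms(1)] by simp
qed (use assms(1) in \<open>auto simp: diff_closed_def\<close>)

lemma diff_closed_frags: "diff_closed (frags X)"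
  unfolding diff_closed_def frags_def using keys_diff by fastforce

lemma zero_frags [simp]: "0 \<in> frags X"
  by (simp add: frags_def)

lemma diff_frags: "x \<in> frags X \<Longrightarrow> y \<in> frags X \<Longrightarrow> x - y \<in> frags X"
  using diff_closed_frags by (auto simp: diff_closed_def)

lemma frag_of_in_frags [simp]: "frag_of b \<in> frags X \<longleftrightarrow> b \<in> X"
  by (auto simp: frags_def)

lemma additive_frag_extend: "additive (frag_extend f)"
  by (simp add: additive_def frag_extend_add)

lemma additive_id: "additive (\<lambda>x. x)"
  by (simp add: additive_def)

lemma additive_comp: "additive f \<Longrightarrow> additive g \<Longrightarrow> additive (\<lambda>x. f (g x))"
  by (simp add: additive_def)

lemma additive_eq_on_frags:
  assumes "additive f" "additive g" "x \<in> frags X"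
    and "\<And>b. b \<in> X \<Longrightarrow> f (frag_of b) = g (frag_of b)"
  shows "f x = g x"
proof -
  have "Poly_Mapping.keys x \<subseteq> X" using assms(3) by (simp add: frags_def)
  then show ?thesis
    by (induction x rule: frag_induction)
      (use assms in \<open>auto simp: additive.zero additive.diff\<close>)
qed

lemma additive_into:
  assumes "additive f" "diff_closed M" "x \<in> frags X"
    and "\<And>b. b \<in> X \<Longrightarrow> f (frag_of b) \<in> M"
  shows "f x \<in> M"
proof -
  have "Poly_Mapping.keys x \<subseteq> X" using assms(3) by (simp add: frags_def)
  then show ?thesis
    by (induction x rule: frag_induction)
      (use assms in \<open>auto simp: additive.zero additive.diff diff_closed_def\<close>)
qed

text \<open>
  A left module over the monoid ring of \<open>S\<close>, given by the action of \<open>S\<close> alone. Each \<open>act s\<close> is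
  additive on the whole ambient group and not only on \<open>M\<close>, so that additivity can be used
  without membership conditions; all actions that occur come from the ambient group.
\<close>
definition smodule ::
    "('a, 'x) monoid_scheme \<Rightarrow> ('a \<Rightarrow> 'b frag \<Rightarrow> 'b frag) \<Rightarrow> 'b frag set \<Rightarrow> bool"
  where
  "smodule S act M \<longleftrightarrow> diff_closed M \<and>
     (\<forall>s\<in>carrier S. additive (act s) \<and> (\<forall>x\<in>M. act s x \<in> M)) \<and>
     (\<forall>x\<in>M. act \<one>\<^bsub>S\<^esub> x = x) \<and>
     (\<forall>s\<in>carrier S. \<forall>t\<in>carrier S. \<forall>x\<in>M. act (s \<otimes>\<^bsub>S\<^esub> t) x = act s (act t x))"

definition equivariant ::
    "('a, 'x) monoid_scheme \<Rightarrow>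
     ('a \<Rightarrow> 'b frag \<Rightarrow> 'b frag) \<Rightarrow> 'b frag set \<Rightarrow>
     ('a \<Rightarrow> 'c frag \<Rightarrow> 'c frag) \<Rightarrow> 'c frag set \<Rightarrow>
     ('b frag \<Rightarrow> 'c frag) \<Rightarrow> bool"
  where
  "equivariant S actN N actM M p \<longleftrightarrow> additive p \<and> (\<forall>x\<in>N. p x \<in> M) \<and>
     (\<forall>s\<in>carrier S. \<forall>x\<in>N. p (actN s x) = actM s (p x))"

definition ker :: "'b frag set \<Rightarrow> ('b frag \<Rightarrow> 'c frag) \<Rightarrow> 'b frag set" where
  "ker N p = {x \<in> N. p x = 0}"

lemma smodule_ker:
  assumes N: "smodule S actN N" and M: "smodule S actM M" and p: "equivariant S actN N actM M p"
  shows "smodule S actN (ker N p)"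
proof -
  have "additive p" using p by (simp add: equivariant_def)
  moreover have "additive (actM s)" if "s \<in> carrier S" for s using M that by (simp add: smodule_def)
  ultimately show ?thesis
    using N p unfolding smodule_def equivariant_def ker_def diff_closed_def
    by (auto simp: additive.zero additive.diff)
qed

lemma equivariant_comp:
  "equivariant S a1 M1 a2 M2 p \<Longrightarrow> equivariant S a2 M2 a3 M3 q \<Longrightarrow>
    equivariant S a1 M1 a3 M3 (\<lambda>x. q (p x))"
  unfolding equivariant_def by (auto simp: additive_def)

lemma equivariant_subset:
  "equivariant S a1 M1 a2 M2 p \<Longrightarrow> M1' \<subseteq> M1 \<Longrightarrow> p ` M1' \<subseteq> M2' \<Longrightarrow> equivariant S a1 M1' a2 M2' p"
  unfolding equivariant_def by auto

definition perm_act :: "('a \<Rightarrow> 'b \<Rightarrow> 'b) \<Rightarrow> 'a \<Rightarrow> 'b frag \<Rightarrow> 'b frag" where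
  "perm_act \<sigma> s = frag_extend (\<lambda>b. frag_of (\<sigma> s b))"

definition set_action :: "('a, 'x) monoid_scheme \<Rightarrow> ('a \<Rightarrow> 'b \<Rightarrow> 'b) \<Rightarrow> 'b set \<Rightarrow> bool" where
  "set_action S \<sigma> X \<longleftrightarrow>
     (\<forall>s\<in>carrier S. \<forall>x\<in>X. \<sigma> s x \<in> X) \<and> (\<forall>x\<in>X. \<sigma> \<one>\<^bsub>S\<^esub> x = x) \<and>
     (\<forall>s\<in>carrier S. \<forall>t\<in>carrier S. \<forall>x\<in>X. \<sigma> (s \<otimes>\<^bsub>S\<^esub> t) x = \<sigma> s (\<sigma> t x))"

lemma perm_act_of [simp]: "perm_act \<sigma> s (frag_of b) = frag_of (\<sigma> s b)"
  by (simp add: perm_act_def)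

lemma additive_perm_act [simp]: "additive (perm_act \<sigma> s)"
  by (simp add: perm_act_def additive_frag_extend)

lemma smodule_frags:
  assumes "set_action S \<sigma> X"
  shows "smodule S (perm_act \<sigma>) (frags X)"
  unfolding smodule_def
proof (intro conjI ballI)
  fix x assume x: "x \<in> frags X"
  show "perm_act \<sigma> \<one>\<^bsub>S\<^esub> x = x"
    by (rule additive_eq_on_frags[OF _ additive_id x])
      (use assms in \<open>auto simp: set_action_def\<close>)
  fix s assume s: "s \<in> carrier S"
  show "perm_act \<sigma> s x \<in> frags X"
    by (rule additive_into[OF _ diff_closed_frags x])
      (use assms s in \<open>auto simp: set_action_def\<close>)
  fix t assume t: "t \<in> carrier S"
  show "perm_act \<sigma> (s \<otimes>\<^bsub>S\<^esub> t) x = perm_act \<sigma> s (perm_act \<sigma> t x)"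
    by (rule additive_eq_on_frags[OF _ additive_comp x])
      (use assms s t in \<open>auto simp: set_action_def\<close>)
qed (auto simp: diff_closed_frags)

text \<open>
  Additive maps are determined by the basis, so equivariance need only be checked there.
\<close>
lemma equivariant_on_basis:
  assumes "additive p" "diff_closed M"
    and "\<And>s. s \<in> carrier S \<Longrightarrow> additive (actM s)"
    and "\<And>b. b \<in> X \<Longrightarrow> p (frag_of b) \<in> M"
    and "\<And>s b. s \<in> carrier S \<Longrightarrow> b \<in> X \<Longrightarrow> p (frag_of (\<sigma> s b)) = actM s (p (frag_of b))"
  shows "equivariant S (perm_act \<sigma>) (frags X) actM M p"
  unfolding equivariant_def
proof (intro conjI ballI)
  fix x assume x: "x \<in> frags X"
  show "p x \<in> M" by (rule additive_into[OF assms(1,2) x assms(4)])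
  fix s assume s: "s \<in> carrier S"
  show "p (perm_act \<sigma> s x) = actM s (p x)"
    by (rule additive_eq_on_frags[OF additive_comp[OF assms(1)] additive_comp[OF assms(3)[OF s] assms(1)] x])
      (use assms(5) s in auto)
qed (rule assms(1))

definition free_act :: "('a, 'x) monoid_scheme \<Rightarrow> 'a \<Rightarrow> nat \<times> 'a \<Rightarrow> nat \<times> 'a" where
  "free_act S s = (\<lambda>(j, t). (j, s \<otimes>\<^bsub>S\<^esub> t))"

abbreviation Fr_act :: "('a, 'x) monoid_scheme \<Rightarrow> 'a \<Rightarrow> (nat \<times> 'a) frag \<Rightarrow> (nat \<times> 'a) frag" where
  "Fr_act S \<equiv> perm_act (free_act S)"

text \<open>
  The free module of rank \<open>k\<close>: the basis element \<open>(j, s)\<close> stands for \<open>s\<close> times the \<open>j\<close>-th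
  generator, which itself is \<open>(j, \<one>)\<close>.
\<close>
abbreviation Fr :: "('a, 'x) monoid_scheme \<Rightarrow> nat \<Rightarrow> (nat \<times> 'a) frag set" where
  "Fr S k \<equiv> frags ({..<k} \<times> carrier S)"

abbreviation free_map :: "('a, 'x) monoid_scheme \<Rightarrow> nat \<Rightarrow> ('a \<Rightarrow> 'b frag \<Rightarrow> 'b frag) \<Rightarrow> 'b frag set \<Rightarrow>
    ((nat \<times> 'a) frag \<Rightarrow> 'b frag) \<Rightarrow> bool" where
  "free_map S k \<equiv> equivariant S (Fr_act S) (Fr S k)"

lemma free_act_simp [simp]: "free_act S s (j, t) = (j, s \<otimes>\<^bsub>S\<^esub> t)"
  by (simp add: free_act_def)

lemma (in monoid) smodule_Fr: "smodule G (Fr_act G) (Fr G k)"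
  by (rule smodule_frags) (auto simp: set_action_def m_assoc)

definition free_ext :: "('a \<Rightarrow> 'b frag \<Rightarrow> 'b frag) \<Rightarrow> (nat \<Rightarrow> 'b frag) \<Rightarrow>
    (nat \<times> 'a) frag \<Rightarrow> 'b frag" where
  "free_ext act v = frag_extend (\<lambda>(j, s). act s (v j))"

lemma free_ext_of [simp]: "free_ext act v (frag_of (j, s)) = act s (v j)"
  by (simp add: free_ext_def)

lemma additive_free_ext: "additive (free_ext act v)"
  by (simp add: free_ext_def additive_frag_extend)

lemma (in monoid) equivariant_free_ext:
  assumes "smodule G act M" "\<And>j. j < k \<Longrightarrow> v j \<in> M"
  shows "free_map G k act M (free_ext act v)"
  by (rule equivariant_on_basis) (use assms in \<open>auto simp: smodule_def additive_free_ext\<close>)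

lemma (in monoid) equivariant_eq_Fr:
  assumes "free_map G k act M p" "free_map G k act M q"
    and "\<And>j. j < k \<Longrightarrow> p (frag_of (j, \<one>)) = q (frag_of (j, \<one>))" "x \<in> Fr G k"
  shows "p x = q x"
proof (rule additive_eq_on_frags[OF _ _ assms(4)])
  fix b assume "b \<in> {..<k} \<times> carrier G"
  then obtain j s where b: "b = (j, s)" "j < k" "s \<in> carrier G" by auto
  then have *: "frag_of b = Fr_act G s (frag_of (j, \<one>))" "frag_of (j, \<one>) \<in> Fr G k" by auto
  have "p (frag_of b) = act s (p (frag_of (j, \<one>)))" "q (frag_of b) = act s (q (frag_of (j, \<one>)))"
    using assms(1,2) b(3) *(2) unfolding *(1) equivariant_def by blast+
  then show "p (frag_of b) = q (frag_of b)" by (simp add: assms(3) b(2))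
qed (use assms in \<open>auto simp: equivariant_def\<close>)


section \<open>Modules of type FP\<close>

text \<open>
  A partial resolution as in the definition of type FP, with \<open>k i\<close> the rank of the \<open>i\<close>-th free
  module.
\<close>
definition free_res :: "nat \<Rightarrow> ('a, 'x) monoid_scheme \<Rightarrow>
    ('a \<Rightarrow> 'b frag \<Rightarrow> 'b frag) \<Rightarrow> 'b frag set \<Rightarrow> (nat \<Rightarrow> nat) \<Rightarrow>
    ((nat \<times> 'a) frag \<Rightarrow> 'b frag) \<Rightarrow> (nat \<Rightarrow> (nat \<times> 'a) frag \<Rightarrow> (nat \<times> 'a) frag) \<Rightarrow> bool" where
  "free_res n S act M k \<phi> d \<longleftrightarrow>
     free_map S (k 0) act M \<phi> \<and>
     (\<forall>i<n. free_map S (k (Suc i)) (Fr_act S) (Fr S (k i)) (d i)) \<and>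
     \<phi> ` Fr S (k 0) = M \<and>
     (0 < n \<longrightarrow> d 0 ` Fr S (k 1) = ker (Fr S (k 0)) \<phi>) \<and>
     (\<forall>i. Suc i < n \<longrightarrow> d (Suc i) ` Fr S (k (Suc (Suc i))) = ker (Fr S (k (Suc i))) (d i))"

lemma free_resD:
  assumes "free_res n S act M k \<phi> d"
  shows "free_map S (k 0) act M \<phi>"
    and "\<And>i. i < n \<Longrightarrow> free_map S (k (Suc i)) (Fr_act S) (Fr S (k i)) (d i)"
    and "\<phi> ` Fr S (k 0) = M"
    and "0 < n \<Longrightarrow> d 0 ` Fr S (k 1) = ker (Fr S (k 0)) \<phi>"
    and "\<And>i. Suc i < n \<Longrightarrow> d (Suc i) ` Fr S (k (Suc (Suc i))) = ker (Fr S (k (Suc i))) (d i)"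
  using assms unfolding free_res_def by simp_all

definition FP :: "nat \<Rightarrow> ('a, 'x) monoid_scheme \<Rightarrow>
    ('a \<Rightarrow> 'b frag \<Rightarrow> 'b frag) \<Rightarrow> 'b frag set \<Rightarrow> bool" where
  "FP n S act M \<longleftrightarrow> (\<exists>k \<phi> d. free_res n S act M k \<phi> d)"

lemma FP_elim:
  assumes "FP n S act M"
  obtains k \<phi> d where "free_res n S act M k \<phi> d"
  using assms unfolding FP_def by (elim exE)

lemma FP_intro: "free_res n S act M k \<phi> d \<Longrightarrow> FP n S act M"
  unfolding FP_def by (intro exI)

lemma FP_0:
  "FP 0 S act M \<longleftrightarrow> (\<exists>k \<phi>. free_map S k act M \<phi> \<and> \<phi> ` Fr S k = M)"
  unfolding FP_def free_res_def by auto

text \<open>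
  Cutting a resolution at its first syzygy and splicing one in there makes type FP recursive
  in \<open>n\<close>. A syzygy lives in a fixed type, that of the free modules, whatever the type of the
  module that it resolves.
\<close>
lemma FP_Suc:
  "FP (Suc n) S act M \<longleftrightarrow> (\<exists>k \<phi>. free_map S k act M \<phi> \<and> \<phi> ` Fr S k = M \<and>
     FP n S (Fr_act S) (ker (Fr S k) \<phi>))" (is "?L \<longleftrightarrow> ?R")
proof
  assume ?L
  then obtain k \<phi> d where r: "free_res (Suc n) S act M k \<phi> d" by (rule FP_elim)
  note d = free_resD(2)[OF r] and d0 = free_resD(4)[OF r zero_less_Suc] and dS = free_resD(5)[OF r]
  have "free_res n S (Fr_act S) (ker (Fr S (k 0)) \<phi>) (k \<circ> Suc) (d 0) (d \<circ> Suc)"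
    unfolding free_res_def
  proof (intro conjI allI impI)
    show "free_map S ((k \<circ> Suc) 0) (Fr_act S) (ker (Fr S (k 0)) \<phi>) (d 0)"
      by (rule equivariant_subset[OF d[of 0, simplified]]) (use d0 in auto)
    show "d 0 ` Fr S ((k \<circ> Suc) 0) = ker (Fr S (k 0)) \<phi>" using d0 by simp
    show "free_map S ((k \<circ> Suc) (Suc i)) (Fr_act S) (Fr S ((k \<circ> Suc) i)) ((d \<circ> Suc) i)"
      if "i < n" for i using d[of "Suc i"] that by simp
    show "(d \<circ> Suc) 0 ` Fr S ((k \<circ> Suc) 1) = ker (Fr S ((k \<circ> Suc) 0)) (d 0)" if "0 < n"
      using dS[of 0] that by simp
    show "(d \<circ> Suc) (Suc i) ` Fr S ((k \<circ> Suc) (Suc (Suc i))) = ker (Fr S ((k \<circ> Suc) (Suc i))) ((d \<circ> Suc) i)"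
      if "Suc i < n" for i using dS[of "Suc i"] that by simp
  qed
  then have "FP n S (Fr_act S) (ker (Fr S (k 0)) \<phi>)" by (rule FP_intro)
  with free_resD(1,3)[OF r] show ?R by (intro exI[of _ "k 0"] exI[of _ \<phi>]) simp
next
  assume ?R
  then obtain l \<psi> where
    psi: "free_map S l act M \<psi>" "\<psi> ` Fr S l = M"
    and F: "FP n S (Fr_act S) (ker (Fr S l) \<psi>)"
    by (elim exE conjE)
  from F obtain k \<phi> d where r: "free_res n S (Fr_act S) (ker (Fr S l) \<psi>) k \<phi> d" by (rule FP_elim)
  note phi = free_resD(1,3)[OF r] and d = free_resD(2)[OF r] and d0 = free_resD(4)[OF r]
    and dS = free_resD(5)[OF r]
  define k' where "k' = case_nat l k"
  define d' where "d' = case_nat \<phi> d"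
  have k': "k' 0 = l" "\<And>i. k' (Suc i) = k i" by (simp_all add: k'_def)
  have d': "d' 0 = \<phi>" "\<And>i. d' (Suc i) = d i" by (simp_all add: d'_def)
  have phi': "free_map S (k 0) (Fr_act S) (Fr S l) \<phi>"
    by (rule equivariant_subset[OF phi(1)]) (use phi(2) in \<open>auto simp: ker_def\<close>)
  have "free_res (Suc n) S act M k' \<psi> d'"
    unfolding free_res_def
  proof (intro conjI allI impI)
    show "free_map S (k' 0) act M \<psi>" "\<psi> ` Fr S (k' 0) = M"
      using psi by (simp_all add: k')
    show "free_map S (k' (Suc i)) (Fr_act S) (Fr S (k' i)) (d' i)" if "i < Suc n" for i
      using that phi' d by (cases i) (auto simp: k' d')
    show "d' 0 ` Fr S (k' 1) = ker (Fr S (k' 0)) \<psi>" using phi by (simp add: k' d')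
    show "d' (Suc i) ` Fr S (k' (Suc (Suc i))) = ker (Fr S (k' (Suc i))) (d' i)" if "Suc i < Suc n" for i
      using that d0 dS by (cases i) (auto simp: k' d')
  qed
  then show ?L by (rule FP_intro)
qed

lemma FP_0_intro:
  "free_map S k act M \<phi> \<Longrightarrow> \<phi> ` Fr S k = M \<Longrightarrow> FP 0 S act M"
  unfolding FP_0 by (rule exI[of _ k], rule exI[of _ \<phi>]) simp

lemma FP_Suc_intro:
  "free_map S k act M \<phi> \<Longrightarrow> \<phi> ` Fr S k = M \<Longrightarrow>
    FP n S (Fr_act S) (ker (Fr S k) \<phi>) \<Longrightarrow> FP (Suc n) S act M"
  unfolding FP_Suc by (rule exI[of _ k], rule exI[of _ \<phi>]) simp

lemma FP_0_elim:
  assumes "FP 0 S act M"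
  obtains k \<phi> where "free_map S k act M \<phi>" "\<phi> ` Fr S k = M"
  using assms unfolding FP_0 by (elim exE conjE)

lemma FP_Suc_elim:
  assumes "FP (Suc n) S act M"
  obtains k \<phi> where "free_map S k act M \<phi>" "\<phi> ` Fr S k = M"
    "FP n S (Fr_act S) (ker (Fr S k) \<phi>)"
  using assms unfolding FP_Suc by (elim exE conjE)

lemma FP_Suc_imp_FP:
  assumes "FP (Suc n) S act M"
  shows "FP n S act M"
proof -
  obtain k \<phi> d where "free_res (Suc n) S act M k \<phi> d" using assms by (rule FP_elim)
  then have "free_res n S act M k \<phi> d" unfolding free_res_def by simp
  then show ?thesis by (rule FP_intro)
qed

text \<open>
  The free module of rank \<open>k + l\<close> is a direct sum; these are the inclusion of the last \<open>l\<close>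
  coordinates and the projection to them.
\<close>
definition shift_up :: "nat \<Rightarrow> (nat \<times> 'a) frag \<Rightarrow> (nat \<times> 'a) frag" where
  "shift_up k = frag_extend (\<lambda>(j, s). frag_of (j + k, s))"

definition shift_down :: "nat \<Rightarrow> (nat \<times> 'a) frag \<Rightarrow> (nat \<times> 'a) frag" where
  "shift_down k = frag_extend (\<lambda>(j, s). if j < k then 0 else frag_of (j - k, s))"

lemma shift_of [simp]:
  "shift_up k (frag_of (j, s)) = frag_of (j + k, s)"
  "shift_down k (frag_of (j, s)) = (if j < k then 0 else frag_of (j - k, s))"
  by (simp_all add: shift_up_def shift_down_def)

lemma additive_shift: "additive (shift_up k)" "additive (shift_down k)"
  by (simp_all add: shift_up_def shift_down_def additive_frag_extend)

lemma lookup_shift_down: "Poly_Mapping.lookup (shift_down k x) (j, s) = Poly_Mapping.lookup x (j + k, s)"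
proof -
  have "Poly_Mapping.keys x \<subseteq> UNIV" by simp
  then show ?thesis
    by (induction x rule: frag_induction)
      (auto simp: additive.zero[OF additive_shift(2)] additive.diff[OF additive_shift(2)] lookup_minus
        split: if_splits)
qed

context monoid
begin

lemma FP_0_image:
  assumes "FP 0 G actN N" "equivariant G actN N actM M p" "p ` N = M"
  shows "FP 0 G actM M"
proof -
  obtain k \<phi> where "free_map G k actN N \<phi>" "\<phi> ` Fr G k = N"
    using assms(1) by (rule FP_0_elim)
  then have "free_map G k actM M (\<lambda>x. p (\<phi> x))" "(\<lambda>x. p (\<phi> x)) ` Fr G k = M"
    using equivariant_comp[of G "Fr_act G" "Fr G k" actN N \<phi>, OF _ assms(2)] assms(3)
    by (simp_all add: image_image[symmetric])
  then show ?thesis by (rule FP_0_intro)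
qed

lemma shift_up_in: "x \<in> Fr G l \<Longrightarrow> shift_up k x \<in> Fr G (k + l)"
  by (rule additive_into[OF additive_shift(1) diff_closed_frags]) auto

lemma shift_down_up: "x \<in> Fr G l \<Longrightarrow> shift_down k (shift_up k x) = x"
  by (rule additive_eq_on_frags[OF additive_comp[OF additive_shift(2,1)] additive_id, rotated])
    auto

lemma shift_down_low: "x \<in> Fr G k \<Longrightarrow> shift_down k x = 0"
proof (rule additive_eq_on_frags[OF additive_shift(2), of "\<lambda>_. 0"])
  show "additive (\<lambda>_. 0)" by (simp add: additive_def)
qed auto

lemma equivariant_shift_down: "free_map G (k + l) (Fr_act G) (Fr G l) (shift_down k)"
  by (rule equivariant_on_basis[OF additive_shift(2) diff_closed_frags])
    (auto simp: diff_closed_frags[unfolded diff_closed_def] additive.zero[OF additive_perm_act])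

lemma shift_down_eq_0:
  assumes "x \<in> Fr G (k + l)" "shift_down k x = 0"
  shows "x \<in> Fr G k"
proof -
  have "j < k \<and> s \<in> carrier G" if "(j, s) \<in> Poly_Mapping.keys x" for j s
  proof -
    have "s \<in> carrier G" using assms(1) that by (auto simp: frags_def)
    moreover have "Poly_Mapping.lookup x (j, s) \<noteq> 0" using that by (simp add: in_keys_iff)
    then have "j < k" using lookup_shift_down[of k x "j - k" s] assms(2) by (cases "j < k") auto
    ultimately show ?thesis by simp
  qed
  then show ?thesis by (auto simp: frags_def)
qed

text \<open>
  The horseshoe lemma: covers of the two ends of \<open>0 \<rightarrow> ker p \<rightarrow> N \<rightarrow> M \<rightarrow> 0\<close> combine to a cover of
  \<open>N\<close>, because the generators of the cover of \<open>M\<close> can be lifted along \<open>p\<close>. The kernels of the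
  three covers form again a short exact sequence.
\<close>
lemma extension_cover:
  assumes N: "smodule G actN N" and M: "smodule G actM M" and p: "equivariant G actN N actM M p" "p ` N = M"
    and al: "free_map G k actN (ker N p) \<alpha>" "\<alpha> ` Fr G k = ker N p"
    and be: "free_map G l actM M \<beta>" "\<beta> ` Fr G l = M"
  shows "\<exists>\<gamma>. free_map G (k + l) actN N \<gamma> \<and> \<gamma> ` Fr G (k + l) = N \<and>
    ker (ker (Fr G (k + l)) \<gamma>) (shift_down k) = ker (Fr G k) \<alpha> \<and>
    shift_down k ` ker (Fr G (k + l)) \<gamma> = ker (Fr G l) \<beta>"
proof -
  have add: "additive p" "additive \<alpha>" "additive \<beta>"
    using p al be by (auto simp: equivariant_def)
  have "\<exists>x\<in>N. p x = \<beta> (frag_of (j, \<one>))" if "j < l" for j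
  proof -
    have "frag_of (j, \<one>) \<in> Fr G l" using that by auto
    then show ?thesis using be(2) p(2) by (metis (no_types, lifting) imageE imageI)
  qed
  then obtain v where v: "\<And>j. j < l \<Longrightarrow> v j \<in> N" "\<And>j. j < l \<Longrightarrow> p (v j) = \<beta> (frag_of (j, \<one>))"
    by metis
  define \<gamma> where "\<gamma> = free_ext actN (\<lambda>j. if j < k then \<alpha> (frag_of (j, \<one>)) else v (j - k))"
  have al_in: "\<alpha> x \<in> N" "p (\<alpha> x) = 0" if "x \<in> Fr G k" for x
    using al that by (auto simp: ker_def equivariant_def)
  have ga: "free_map G (k + l) actN N \<gamma>"
    unfolding \<gamma>_def by (rule equivariant_free_ext[OF N]) (auto intro!: v al_in)
  have addg: "additive \<gamma>" using ga by (simp add: equivariant_def)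
  have low: "x \<in> Fr G (k + l)" if "x \<in> Fr G k" for x
    using that by (fastforce simp: frags_def)
  have ga_low: "\<gamma> x = \<alpha> x" if "x \<in> Fr G k" for x
  proof (rule equivariant_eq_Fr[OF _ _ _ that])
    show "free_map G k actN N \<gamma>"
      by (rule equivariant_subset[OF ga]) (use low ga in \<open>auto simp: equivariant_def\<close>)
    show "free_map G k actN N \<alpha>"
      by (rule equivariant_subset[OF al(1)]) (use al_in in auto)
    show "\<gamma> (frag_of (j, \<one>)) = \<alpha> (frag_of (j, \<one>))" if "j < k" for j
      using that al_in(1)[of "frag_of (j, \<one>)"] N by (simp add: \<gamma>_def smodule_def)
  qed
  have p_ga: "p (\<gamma> x) = \<beta> (shift_down k x)" if "x \<in> Fr G (k + l)" for x
  proof (rule equivariant_eq_Fr[OF _ _ _ that])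
    show "free_map G (k + l) actM M (\<lambda>x. p (\<gamma> x))"
      by (rule equivariant_comp[OF ga p(1)])
    show "free_map G (k + l) actM M (\<lambda>x. \<beta> (shift_down k x))"
      by (rule equivariant_comp[OF equivariant_shift_down be(1)])
    show "p (\<gamma> (frag_of (j, \<one>))) = \<beta> (shift_down k (frag_of (j, \<one>)))" if "j < k + l" for j
    proof (cases "j < k")
      case True
      then show ?thesis using ga_low[of "frag_of (j, \<one>)"] al_in[of "frag_of (j, \<one>)"]
        by (simp add: additive.zero[OF add(3)])
    next
      case False
      then have "j - k < l" using that by auto
      then show ?thesis using False v[of "j - k"] N by (simp add: \<gamma>_def smodule_def)
    qed
  qed
  have lift: "\<exists>z\<in>Fr G (k + l). \<gamma> z = x \<and> shift_down k z = y" if "x \<in> N" "y \<in> Fr G l" "p x = \<beta> y" for x y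
  proof -
    let ?u = "shift_up k y"
    have u: "?u \<in> Fr G (k + l)" by (rule shift_up_in[OF that(2)])
    have "p (\<gamma> ?u) = \<beta> y" using p_ga[OF u] shift_down_up[OF that(2)] by simp
    then have "x - \<gamma> ?u \<in> ker N p"
      using that ga u N by (auto simp: ker_def additive.diff[OF add(1)] equivariant_def smodule_def diff_closed_def)
    then obtain w where w: "w \<in> Fr G k" "\<alpha> w = x - \<gamma> ?u" using al(2) by (metis (no_types, lifting) imageE)
    show ?thesis
    proof (intro bexI conjI)
      show "\<gamma> (w + ?u) = x" using w ga_low[OF w(1)] by (simp add: additive.add[OF addg])
      show "shift_down k (w + ?u) = y"
        using shift_down_low[OF w(1)] shift_down_up[OF that(2)]
        by (simp add: additive.add[OF additive_shift(2)])
      show "w + ?u \<in> Fr G (k + l)"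
        using diff_closed_add[OF diff_closed_frags low[OF w(1)] u] .
    qed
  qed
  show ?thesis
  proof (intro exI conjI)
    show "free_map G (k + l) actN N \<gamma>" by (rule ga)
    show "\<gamma> ` Fr G (k + l) = N"
    proof (intro equalityI subsetI)
      fix x assume x: "x \<in> N"
      then obtain y where "y \<in> Fr G l" "p x = \<beta> y" using p(2) be(2) by blast
      then show "x \<in> \<gamma> ` Fr G (k + l)" using lift[OF x] by (metis (no_types, lifting) imageI)
    qed (use ga in \<open>auto simp: equivariant_def\<close>)
    show "ker (ker (Fr G (k + l)) \<gamma>) (shift_down k) = ker (Fr G k) \<alpha>"
      using shift_down_eq_0 low ga_low shift_down_low by (auto simp: ker_def)
    show "shift_down k ` ker (Fr G (k + l)) \<gamma> = ker (Fr G l) \<beta>"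
    proof (intro equalityI subsetI)
      fix y assume "y \<in> ker (Fr G l) \<beta>"
      then show "y \<in> shift_down k ` ker (Fr G (k + l)) \<gamma>"
        using lift[of 0 y] N by (force simp: ker_def additive.zero[OF add(1)] smodule_def diff_closed_def)
    next
      fix y assume "y \<in> shift_down k ` ker (Fr G (k + l)) \<gamma>"
      then obtain z where z: "z \<in> Fr G (k + l)" "\<gamma> z = 0" "y = shift_down k z" by (auto simp: ker_def)
      then show "y \<in> ker (Fr G l) \<beta>"
        using p_ga[OF z(1)] equivariant_shift_down[of k l]
        by (auto simp: ker_def equivariant_def additive.zero[OF add(1)])
    qed
  qed
qed

text \<open>
  The induction step is separate because the hypothesis concerns modules inside the type of
  free modules only, whereas its conclusion is for modules of any type. The induction itself
  can then be run inside that one type.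
\<close>
lemma FP_extension_Suc:
  assumes N: "smodule G actN N" and M: "smodule G actM M" and p: "equivariant G actN N actM M p" "p ` N = M"
    and K: "FP (Suc n) G actN (ker N p)" and FM: "FP (Suc n) G actM M"
    and IH: "\<And>(N :: (nat \<times> 'a) frag set) (M :: (nat \<times> 'a) frag set) p.
      smodule G (Fr_act G) N \<Longrightarrow> smodule G (Fr_act G) M \<Longrightarrow> equivariant G (Fr_act G) N (Fr_act G) M p \<Longrightarrow>
      p ` N = M \<Longrightarrow> FP n G (Fr_act G) (ker N p) \<Longrightarrow> FP n G (Fr_act G) M \<Longrightarrow> FP n G (Fr_act G) N"
  shows "FP (Suc n) G actN N"
proof -
  obtain k \<alpha> where al: "free_map G k actN (ker N p) \<alpha>" "\<alpha> ` Fr G k = ker N p"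
    and Fal: "FP n G (Fr_act G) (ker (Fr G k) \<alpha>)"
    using K by (rule FP_Suc_elim)
  obtain l \<beta> where be: "free_map G l actM M \<beta>" "\<beta> ` Fr G l = M"
    and Fbe: "FP n G (Fr_act G) (ker (Fr G l) \<beta>)"
    using FM by (rule FP_Suc_elim)
  obtain \<gamma> where ga: "free_map G (k + l) actN N \<gamma>" "\<gamma> ` Fr G (k + l) = N"
    and kk: "ker (ker (Fr G (k + l)) \<gamma>) (shift_down k) = ker (Fr G k) \<alpha>"
    and im: "shift_down k ` ker (Fr G (k + l)) \<gamma> = ker (Fr G l) \<beta>"
    using extension_cover[OF N M p al be] by (elim exE conjE)
  have "FP n G (Fr_act G) (ker (Fr G (k + l)) \<gamma>)"
  proof (rule IH)
    show "smodule G (Fr_act G) (ker (Fr G (k + l)) \<gamma>)" by (rule smodule_ker[OF smodule_Fr N ga(1)])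
    show "smodule G (Fr_act G) (ker (Fr G l) \<beta>)" by (rule smodule_ker[OF smodule_Fr M be(1)])
    show "equivariant G (Fr_act G) (ker (Fr G (k + l)) \<gamma>) (Fr_act G) (ker (Fr G l) \<beta>) (shift_down k)"
      by (rule equivariant_subset[OF equivariant_shift_down]) (use im in \<open>auto simp: ker_def\<close>)
  qed (use im kk Fal Fbe in auto)
  with ga show ?thesis by (rule FP_Suc_intro)
qed

lemma FP_extension_0:
  assumes N: "smodule G actN N" and M: "smodule G actM M" and p: "equivariant G actN N actM M p" "p ` N = M"
    and K: "FP 0 G actN (ker N p)" and FM: "FP 0 G actM M"
  shows "FP 0 G actN N"
proof -
  obtain k \<alpha> where al: "free_map G k actN (ker N p) \<alpha>" "\<alpha> ` Fr G k = ker N p"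
    using K by (rule FP_0_elim)
  obtain l \<beta> where be: "free_map G l actM M \<beta>" "\<beta> ` Fr G l = M"
    using FM by (rule FP_0_elim)
  obtain \<gamma> where "free_map G (k + l) actN N \<gamma>" "\<gamma> ` Fr G (k + l) = N"
    using extension_cover[OF N M p al be] by (elim exE conjE)
  then show ?thesis by (rule FP_0_intro)
qed

lemma FP_extension_free:
  fixes N M :: "(nat \<times> 'a) frag set"
  assumes "smodule G (Fr_act G) N" "smodule G (Fr_act G) M" "equivariant G (Fr_act G) N (Fr_act G) M p" "p ` N = M"
    "FP n G (Fr_act G) (ker N p)" "FP n G (Fr_act G) M"
  shows "FP n G (Fr_act G) N"
  using assms
proof (induction n arbitrary: N M p)
  case 0
  show ?case by (rule FP_extension_0[OF 0(1-4)]) (use 0(5,6) in auto)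
next
  case (Suc n)
  show ?case
  proof (rule FP_extension_Suc[OF Suc.prems(1-4)])
    show "FP (Suc n) G (Fr_act G) (ker N p)" "FP (Suc n) G (Fr_act G) M" using Suc.prems(5,6) by simp_all
  next
    fix N' M' :: "(nat \<times> 'a) frag set" and p'
    assume "smodule G (Fr_act G) N'" "smodule G (Fr_act G) M'" "equivariant G (Fr_act G) N' (Fr_act G) M' p'"
      "p' ` N' = M'" "FP n G (Fr_act G) (ker N' p')" "FP n G (Fr_act G) M'"
    then show "FP n G (Fr_act G) N'" by (rule Suc.IH)
  qed
qed

theorem FP_extension:
  assumes "smodule G actN N" "smodule G actM M" "equivariant G actN N actM M p" "p ` N = M"
    "FP n G actN (ker N p)" "FP n G actM M"
  shows "FP n G actN N"
proof (cases n)
  case 0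
  show ?thesis using FP_extension_0[OF assms(1-4)] assms(5,6) unfolding 0 by simp
next
  case (Suc m)
  show ?thesis unfolding Suc
  proof (rule FP_extension_Suc[OF assms(1-4)])
    show "FP (Suc m) G actN (ker N p)" "FP (Suc m) G actM M" using assms(5,6) Suc by simp_all
  next
    fix N' M' :: "(nat \<times> 'a) frag set" and p'
    assume "smodule G (Fr_act G) N'" "smodule G (Fr_act G) M'" "equivariant G (Fr_act G) N' (Fr_act G) M' p'"
      "p' ` N' = M'" "FP m G (Fr_act G) (ker N' p')" "FP m G (Fr_act G) M'"
    then show "FP m G (Fr_act G) N'" by (rule FP_extension_free)
  qed
qed

text \<open>
  Dimension shifting: if \<open>F \<rightarrow> N\<close> is a free cover, the kernel of \<open>F \<rightarrow> N \<rightarrow> M\<close> is an extension of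
  \<open>ker p\<close> by the kernel of the cover.
\<close>
theorem FP_quotient:
  assumes N: "smodule G actN N" and M: "smodule G actM M" and p: "equivariant G actN N actM M p" "p ` N = M"
    and K: "FP n G actN (ker N p)" and FN: "FP (Suc n) G actN N"
  shows "FP (Suc n) G actM M"
proof -
  obtain k \<phi> where phi: "free_map G k actN N \<phi>" "\<phi> ` Fr G k = N"
    and F: "FP n G (Fr_act G) (ker (Fr G k) \<phi>)"
    using FN by (rule FP_Suc_elim)
  let ?q = "\<lambda>x. p (\<phi> x)"
  have q: "free_map G k actM M ?q" "?q ` Fr G k = M"
    using equivariant_comp[OF phi(1) p(1)] phi(2) p(2) by (simp_all add: image_image[symmetric])
  have "additive p" using p by (simp add: equivariant_def)
  then have kk: "ker (ker (Fr G k) ?q) \<phi> = ker (Fr G k) \<phi>"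
    by (auto simp: ker_def additive.zero)
  have im: "\<phi> ` ker (Fr G k) ?q = ker N p"
    using phi(2) by (auto simp: ker_def)
  have "FP n G (Fr_act G) (ker (Fr G k) ?q)"
  proof (rule FP_extension)
    show "smodule G (Fr_act G) (ker (Fr G k) ?q)" by (rule smodule_ker[OF smodule_Fr M q(1)])
    show "smodule G actN (ker N p)" by (rule smodule_ker[OF N M p(1)])
    show "equivariant G (Fr_act G) (ker (Fr G k) ?q) actN (ker N p) \<phi>"
      by (rule equivariant_subset[OF phi(1)]) (use im in \<open>auto simp: ker_def\<close>)
  qed (use im kk K F in auto)
  with q show ?thesis by (rule FP_Suc_intro)
qed

end

section \<open>Permutation modules\<close>

lemma frags_empty: "frags {} = {0}"
  by (auto simp: frags_def)

lemma additive_0: "additive (\<lambda>_. 0)"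
  by (simp add: additive_def)

lemma additive_minus: "additive f \<Longrightarrow> additive g \<Longrightarrow> additive (\<lambda>x. f x - g x)"
  by (simp add: additive_def)

lemma diff_closed_ker: "additive p \<Longrightarrow> diff_closed N \<Longrightarrow> diff_closed (ker N p)"
  unfolding diff_closed_def ker_def by (auto simp: additive.zero additive.diff)

definition restrict_to :: "'b set \<Rightarrow> 'b frag \<Rightarrow> 'b frag" where
  "restrict_to Y = frag_extend (\<lambda>b. if b \<in> Y then frag_of b else 0)"

lemma restrict_to_of [simp]: "restrict_to Y (frag_of b) = (if b \<in> Y then frag_of b else 0)"
  by (simp add: restrict_to_def)

lemma additive_restrict_to: "additive (restrict_to Y)"
  by (simp add: restrict_to_def additive_frag_extend)

lemma lookup_restrict_to:
  "Poly_Mapping.lookup (restrict_to Y x) b = (if b \<in> Y then Poly_Mapping.lookup x b else 0)"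
proof -
  have "Poly_Mapping.keys x \<subseteq> UNIV" by simp
  then show ?thesis
    by (induction x rule: frag_induction)
      (auto simp: additive.zero[OF additive_restrict_to] additive.diff[OF additive_restrict_to] lookup_minus)
qed

lemma restrict_to_eq_0:
  assumes "x \<in> frags (X \<union> Y)" "restrict_to Y x = 0"
  shows "x \<in> frags X"
proof -
  have "b \<in> X" if "b \<in> Poly_Mapping.keys x" for b
  proof -
    have "Poly_Mapping.lookup x b \<noteq> 0" using that by (simp add: in_keys_iff)
    then have "b \<notin> Y" using lookup_restrict_to[of Y x b] assms(2) by auto
    then show ?thesis using assms(1) that by (auto simp: frags_def)
  qed
  then show ?thesis by (auto simp: frags_def)
qed

lemma restrict_to_outside: "x \<in> frags X \<Longrightarrow> X \<inter> Y = {} \<Longrightarrow> restrict_to Y x = 0"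
  by (rule additive_eq_on_frags[OF additive_restrict_to additive_0]) auto

lemma restrict_to_inside: "x \<in> frags Y \<Longrightarrow> restrict_to Y x = x"
  by (rule additive_eq_on_frags[OF additive_restrict_to additive_id]) auto

context monoid
begin

lemma FP_zero:
  fixes M :: "'c frag set"
  assumes "smodule G act M"
  shows "FP n G act {0}"
proof -
  have *: "free_map G 0 act' {0} (\<lambda>_. 0)"
    if "\<And>s. s \<in> carrier G \<Longrightarrow> additive (act' s)" for act' :: "'a \<Rightarrow> 'd frag \<Rightarrow> 'd frag"
    using that by (auto simp: equivariant_def additive_0 additive.zero)
  have free: "FP n G (Fr_act G) {0}" for n
  proof (induction n)
    case 0
    show ?case by (rule FP_0_intro[OF *[OF additive_perm_act]]) (simp add: frags_empty)
  next
    case (Suc n)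
    have "ker (Fr G 0) (\<lambda>_. 0 :: (nat \<times> 'a) frag) = {0}" by (auto simp: ker_def frags_empty)
    with Suc show ?case
      by (intro FP_Suc_intro[OF *[OF additive_perm_act]]) (simp_all add: frags_empty)
  qed
  have act: "\<And>s. s \<in> carrier G \<Longrightarrow> additive (act s)" using assms by (simp add: smodule_def)
  show ?thesis
  proof (cases n)
    case 0
    show ?thesis unfolding 0 by (rule FP_0_intro[OF *[OF act]]) (simp_all add: frags_empty)
  next
    case (Suc m)
    have "ker (Fr G 0) (\<lambda>_. 0 :: 'c frag) = {0}" by (auto simp: ker_def frags_empty)
    with free show ?thesis unfolding Suc
      by (intro FP_Suc_intro[OF *[OF act]]) (simp_all add: frags_empty)
  qed
qed

text \<open>
  The two maps, used in turn, resolve each other's kernel forever.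
\<close>
lemma FP_periodic:
  assumes "free_map G k (Fr_act G) (Fr G k) p" "free_map G k (Fr_act G) (Fr G k) q"
    and "p ` Fr G k = ker (Fr G k) q" "q ` Fr G k = ker (Fr G k) p"
  shows "FP n G (Fr_act G) (ker (Fr G k) p) \<and> FP n G (Fr_act G) (ker (Fr G k) q)"
proof -
  have p: "free_map G k (Fr_act G) (ker (Fr G k) q) p"
    by (rule equivariant_subset[OF assms(1)]) (use assms(3) in auto)
  have q: "free_map G k (Fr_act G) (ker (Fr G k) p) q"
    by (rule equivariant_subset[OF assms(2)]) (use assms(4) in auto)
  show ?thesis
  proof (induction n)
    case 0
    show ?case using FP_0_intro[OF q assms(4)] FP_0_intro[OF p assms(3)] by simp
  next
    case (Suc n)
    then show ?case using FP_Suc_intro[OF q assms(4)] FP_Suc_intro[OF p assms(3)] by simp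
  qed
qed

definition right_mult :: "'a \<Rightarrow> (nat \<times> 'a) frag \<Rightarrow> (nat \<times> 'a) frag" where
  "right_mult e = frag_extend (\<lambda>(j, s). frag_of (j, s \<otimes> e))"

lemma right_mult_of [simp]: "right_mult e (frag_of (j, s)) = frag_of (j, s \<otimes> e)"
  by (simp add: right_mult_def)

lemma additive_right_mult: "additive (right_mult e)"
  by (simp add: right_mult_def additive_frag_extend)

text \<open>
  Right multiplication by \<open>e\<close> and by \<open>1 - e\<close> are complementary projections of a free module,
  hence each has as image the kernel of the other.
\<close>
lemma FP_ker_right_mult:
  assumes e: "e \<in> carrier G" "e \<otimes> e = e"
  shows "FP n G (Fr_act G) (ker (Fr G k) (right_mult e))"
proof -
  let ?q = "\<lambda>x. x - right_mult e x"
  have idem: "right_mult e (right_mult e x) = right_mult e x" if "x \<in> Fr G k" for x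
    by (rule additive_eq_on_frags[OF additive_comp[OF additive_right_mult additive_right_mult] additive_right_mult that])
      (use e in \<open>auto simp: m_assoc\<close>)
  have addq: "additive ?q" by (rule additive_minus[OF additive_id additive_right_mult])
  have p: "free_map G k (Fr_act G) (Fr G k) (right_mult e)"
    by (rule equivariant_on_basis[OF additive_right_mult diff_closed_frags])
      (use e in \<open>auto simp: m_assoc\<close>)
  have q: "free_map G k (Fr_act G) (Fr G k) ?q"
    using p smodule_Fr[of k] addq unfolding equivariant_def smodule_def diff_closed_def
    by (auto simp: additive.diff[OF additive_perm_act])
  have "right_mult e ` Fr G k = ker (Fr G k) ?q"
    using p idem by (force simp: ker_def equivariant_def image_iff)
  moreover have "?q ` Fr G k = ker (Fr G k) (right_mult e)"
  proof (intro equalityI subsetI)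
    fix y assume "y \<in> ker (Fr G k) (right_mult e)"
    then show "y \<in> ?q ` Fr G k" by (intro rev_image_eqI[of y]) (auto simp: ker_def)
  next
    fix y assume "y \<in> ?q ` Fr G k"
    then show "y \<in> ker (Fr G k) (right_mult e)"
      using q idem by (auto simp: ker_def equivariant_def additive.diff[OF additive_right_mult])
  qed
  ultimately show ?thesis using FP_periodic[OF p q] by blast
qed

text \<open>
  The hypotheses say that \<open>X\<close> is isomorphic to the left ideal \<open>Ge\<close> as a \<open>G\<close>-set. The kernel of
  the orbit map \<open>\<int>G \<rightarrow> \<int>X\<close> is therefore that of right multiplication by \<open>e\<close>.
\<close>
lemma FP_cyclic:
  assumes act: "set_action G \<sigma> X" and x0: "x0 \<in> X" "\<And>x. x \<in> X \<Longrightarrow> \<exists>s\<in>carrier G. \<sigma> s x0 = x"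
    and e: "e \<in> carrier G" "\<sigma> e x0 = x0"
    and stab: "\<And>s t. s \<in> carrier G \<Longrightarrow> t \<in> carrier G \<Longrightarrow> \<sigma> s x0 = \<sigma> t x0 \<Longrightarrow> s \<otimes> e = t \<otimes> e"
  shows "FP n G (perm_act \<sigma>) (frags X)"
proof -
  have one: "\<sigma> \<one> x0 = x0" and mult: "\<And>s. s \<in> carrier G \<Longrightarrow> \<sigma> (s \<otimes> e) x0 = \<sigma> s x0"
    using act x0(1) e by (auto simp: set_action_def)
  have ee: "e \<otimes> e = e" using stab[of e \<one>] e one by simp
  let ?\<phi> = "free_ext (perm_act \<sigma>) (\<lambda>_. frag_of x0)"
  have phi: "free_map G 1 (perm_act \<sigma>) (frags X) ?\<phi>"
    by (rule equivariant_free_ext[OF smodule_frags[OF act]]) (simp add: x0)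
  have onto: "?\<phi> ` Fr G 1 = frags X"
  proof (intro equalityI subsetI)
    fix y assume y: "y \<in> frags X"
    have "diff_closed (?\<phi> ` Fr G 1)"
      unfolding diff_closed_def
    proof (intro conjI ballI)
      show "0 \<in> ?\<phi> ` Fr G 1"
        by (intro rev_image_eqI[of 0]) (simp_all add: additive.zero[OF additive_free_ext])
      show "a - b \<in> ?\<phi> ` Fr G 1" if "a \<in> ?\<phi> ` Fr G 1" "b \<in> ?\<phi> ` Fr G 1" for a b
        using that by (auto simp: additive.diff[OF additive_free_ext, symmetric] diff_frags)
    qed
    then show "y \<in> ?\<phi> ` Fr G 1"
    proof (rule additive_into[OF additive_id _ y])
      fix b assume "b \<in> X"
      then obtain s where s: "s \<in> carrier G" "\<sigma> s x0 = b" using x0(2) by blast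
      then have "frag_of b = ?\<phi> (frag_of (0, s))" by simp
      then show "frag_of b \<in> ?\<phi> ` Fr G 1" using s(1)
        by (intro rev_image_eqI[of "frag_of (0, s)"]) simp_all
    qed
  qed (use phi in \<open>auto simp: equivariant_def\<close>)
  (* By the hypothesis on stabilisers, s e does not depend on the choice of s. *)
  let ?\<theta> = "frag_extend (\<lambda>x. frag_of (0::nat, (SOME s. s \<in> carrier G \<and> \<sigma> s x0 = x) \<otimes> e))"
  have theta: "?\<theta> (?\<phi> x) = right_mult e x" if "x \<in> Fr G 1" for x
  proof (rule additive_eq_on_frags[OF additive_comp[OF additive_frag_extend additive_free_ext] additive_right_mult that])
    fix b assume "b \<in> {..<1::nat} \<times> carrier G"
    then obtain s where b: "b = (0, s)" "s \<in> carrier G" by auto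
    have "(SOME t. t \<in> carrier G \<and> \<sigma> t x0 = \<sigma> s x0) \<otimes> e = s \<otimes> e"
    proof (rule someI2[of _ s])
      fix u assume "u \<in> carrier G \<and> \<sigma> u x0 = \<sigma> s x0"
      then show "u \<otimes> e = s \<otimes> e" by (intro stab) (simp_all add: b)
    qed (simp add: b)
    then show "?\<theta> (?\<phi> (frag_of b)) = right_mult e (frag_of b)" by (simp add: b)
  qed
  have absorb: "?\<phi> (right_mult e x) = ?\<phi> x" if "x \<in> Fr G 1" for x
    by (rule additive_eq_on_frags[OF additive_comp[OF additive_free_ext additive_right_mult] additive_free_ext that])
      (auto simp: mult)
  have ke: "ker (Fr G 1) ?\<phi> = ker (Fr G 1) (right_mult e)"
  proof -
    have "?\<phi> x = 0 \<longleftrightarrow> right_mult e x = 0" if "x \<in> Fr G 1" for x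
    proof
      assume "?\<phi> x = 0"
      then show "right_mult e x = 0" using theta[OF that] by simp
    next
      assume "right_mult e x = 0"
      then show "?\<phi> x = 0" using absorb[OF that] by (simp add: additive.zero[OF additive_free_ext])
    qed
    then show ?thesis by (auto simp: ker_def)
  qed
  show ?thesis
  proof (cases n)
    case 0
    show ?thesis unfolding 0 by (rule FP_0_intro[OF phi onto])
  next
    case (Suc m)
    show ?thesis unfolding Suc
      by (rule FP_Suc_intro[OF phi onto]) (simp only: ke FP_ker_right_mult[OF e(1) ee])
  qed
qed

lemma set_action_UN:
  assumes "\<And>j. j \<in> J \<Longrightarrow> set_action G \<sigma> (X j)"
  shows "set_action G \<sigma> (\<Union>j\<in>J. X j)"
  unfolding set_action_def
proof (intro conjI ballI)
  fix x assume "x \<in> (\<Union>j\<in>J. X j)"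
  then obtain j where j: "j \<in> J" "x \<in> X j" by blast
  note a = assms[OF j(1), unfolded set_action_def]
  show "\<sigma> \<one> x = x" using a j(2) by simp
  fix s assume s: "s \<in> carrier G"
  show "\<sigma> s x \<in> (\<Union>j\<in>J. X j)" using a s j by auto
  fix t assume "t \<in> carrier G"
  then show "\<sigma> (s \<otimes> t) x = \<sigma> s (\<sigma> t x)" using a s j(2) by simp
qed

lemma FP_disjoint_union:
  assumes "finite J" and act: "\<And>j. j \<in> J \<Longrightarrow> set_action G \<sigma> (X j)"
    and disj: "\<And>i j. i \<in> J \<Longrightarrow> j \<in> J \<Longrightarrow> i \<noteq> j \<Longrightarrow> X i \<inter> X j = {}"
    and FP: "\<And>j. j \<in> J \<Longrightarrow> FP n G (perm_act \<sigma>) (frags (X j))"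
  shows "FP n G (perm_act \<sigma>) (frags (\<Union>j\<in>J. X j))"
  using assms
proof (induction J)
  case empty
  have "smodule G (perm_act \<sigma>) (frags {})" by (rule smodule_frags) (simp add: set_action_def)
  then show ?case using FP_zero by (simp add: frags_empty)
next
  case (insert a J)
  let ?Y = "\<Union>j\<in>J. X j" and ?XY = "\<Union>j\<in>insert a J. X j"
  have XY: "?XY = X a \<union> ?Y" and dis: "X a \<inter> ?Y = {}" using insert by auto
  have actY: "set_action G \<sigma> ?Y" and actXY: "set_action G \<sigma> (X a \<union> ?Y)" and actX: "set_action G \<sigma> (X a)"
    using set_action_UN[of J \<sigma> X] set_action_UN[of "insert a J" \<sigma> X] insert.prems(1)
    unfolding XY by simp_all
  have "FP n G (perm_act \<sigma>) (frags (X a \<union> ?Y))"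
  proof (rule FP_extension)
    show "smodule G (perm_act \<sigma>) (frags (X a \<union> ?Y))" "smodule G (perm_act \<sigma>) (frags ?Y)"
      by (rule smodule_frags[OF actXY], rule smodule_frags[OF actY])
    show "equivariant G (perm_act \<sigma>) (frags (X a \<union> ?Y)) (perm_act \<sigma>) (frags ?Y) (restrict_to ?Y)"
    proof (rule equivariant_on_basis[OF additive_restrict_to diff_closed_frags additive_perm_act])
      fix b assume b: "b \<in> X a \<union> ?Y"
      show "restrict_to ?Y (frag_of b) \<in> frags ?Y"
        by (simp del: UN_iff)
      fix s assume s: "s \<in> carrier G"
      have "\<sigma> s b \<in> ?Y \<longleftrightarrow> b \<in> ?Y"
      proof
        assume "\<sigma> s b \<in> ?Y"
        then have "\<sigma> s b \<notin> X a" using dis by blast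
        then have "b \<notin> X a" using actX s unfolding set_action_def by blast
        then show "b \<in> ?Y" using b by blast
      qed (use actY s in \<open>unfold set_action_def, blast\<close>)
      then show "restrict_to ?Y (frag_of (\<sigma> s b)) = perm_act \<sigma> s (restrict_to ?Y (frag_of b))"
        by (simp add: additive.zero[OF additive_perm_act] del: UN_iff)
    qed
    show "restrict_to ?Y ` frags (X a \<union> ?Y) = frags ?Y"
    proof (intro equalityI subsetI)
      fix y assume "y \<in> frags ?Y"
      then have "y \<in> frags (X a \<union> ?Y)" "restrict_to ?Y y = y"
        using restrict_to_inside by (auto simp: frags_def)
      then show "y \<in> restrict_to ?Y ` frags (X a \<union> ?Y)" by (intro rev_image_eqI[of y]) simp_all
    next
      fix y assume "y \<in> restrict_to ?Y ` frags (X a \<union> ?Y)"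
      then show "y \<in> frags ?Y"
        using lookup_restrict_to[of ?Y] by (auto simp: frags_def in_keys_iff split: if_splits)
    qed
    have "ker (frags (X a \<union> ?Y)) (restrict_to ?Y) = frags (X a)"
      using restrict_to_eq_0 restrict_to_outside[OF _ dis] by (auto simp: ker_def) (auto simp: frags_def)
    then show "FP n G (perm_act \<sigma>) (ker (frags (X a \<union> ?Y)) (restrict_to ?Y))"
      using insert.prems(3)[of a] by simp
    show "FP n G (perm_act \<sigma>) (frags ?Y)" using insert by auto
  qed
  then show ?case unfolding XY .
qed

text \<open>
  If \<open>X\<close> is a finite disjoint union of orbits \<open>G x\<^sub>j\<close>, each isomorphic to \<open>Ge\<^sub>j\<close> for an
  idempotent \<open>e\<^sub>j\<close>, then \<open>\<int>X\<close> is a finitely generated projective module. The modules \<open>\<int>(Ue)\<close>,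
  \<open>\<int>U\<close> and \<open>\<int>(eU)\<close>, on which the theorem rests, are of this form.
\<close>
theorem FP_projective_action:
  assumes act: "set_action G \<sigma> X" and J: "finite J" and x: "\<And>j. j \<in> J \<Longrightarrow> x j \<in> X"
    and gen: "\<And>y. y \<in> X \<Longrightarrow> \<exists>j\<in>J. \<exists>s\<in>carrier G. y = \<sigma> s (x j)"
    and disj: "\<And>i j s t. i \<in> J \<Longrightarrow> j \<in> J \<Longrightarrow> s \<in> carrier G \<Longrightarrow> t \<in> carrier G \<Longrightarrow>
      \<sigma> s (x i) = \<sigma> t (x j) \<Longrightarrow> i = j"
    and e: "\<And>j. j \<in> J \<Longrightarrow> e j \<in> carrier G" "\<And>j. j \<in> J \<Longrightarrow> \<sigma> (e j) (x j) = x j"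
    and stab: "\<And>j s t. j \<in> J \<Longrightarrow> s \<in> carrier G \<Longrightarrow> t \<in> carrier G \<Longrightarrow>
      \<sigma> s (x j) = \<sigma> t (x j) \<Longrightarrow> s \<otimes> e j = t \<otimes> e j"
  shows "FP n G (perm_act \<sigma>) (frags X)"
proof -
  define Orb where "Orb j = (\<lambda>s. \<sigma> s (x j)) ` carrier G" for j
  have "\<sigma> s (x j) \<in> X" if "s \<in> carrier G" "j \<in> J" for s j
    using act x that by (auto simp: set_action_def)
  then have X: "X = (\<Union>j\<in>J. Orb j)" using gen by (auto simp: Orb_def image_iff)
  have actO: "set_action G \<sigma> (Orb j)" if j: "j \<in> J" for j
    unfolding set_action_def
  proof (intro conjI ballI)
    fix y assume y: "y \<in> Orb j"
    then have yX: "y \<in> X" using X j by blast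
    show "\<sigma> \<one> y = y" using act yX by (simp add: set_action_def)
    fix s assume s: "s \<in> carrier G"
    obtain t where t: "t \<in> carrier G" "y = \<sigma> t (x j)" using y by (auto simp: Orb_def)
    have "\<sigma> s y = \<sigma> (s \<otimes> t) (x j)" using act x[OF j] s t by (simp add: set_action_def)
    then show "\<sigma> s y \<in> Orb j" using s t by (auto simp: Orb_def)
    fix u assume "u \<in> carrier G"
    then show "\<sigma> (s \<otimes> u) y = \<sigma> s (\<sigma> u y)" using act s yX by (simp add: set_action_def)
  qed
  show ?thesis unfolding X
  proof (rule FP_disjoint_union[OF J actO])
    fix j assume j: "j \<in> J"
    show "FP n G (perm_act \<sigma>) (frags (Orb j))"
    proof (rule FP_cyclic[OF actO[OF j]])
      have "x j = \<sigma> \<one> (x j)" using act x[OF j] by (simp add: set_action_def)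
      then show "x j \<in> Orb j" unfolding Orb_def by (rule image_eqI) simp
      show "\<exists>s\<in>carrier G. \<sigma> s (x j) = y" if "y \<in> Orb j" for y using that by (auto simp: Orb_def)
      show "e j \<in> carrier G" "\<sigma> (e j) (x j) = x j" by (rule e(1)[OF j], rule e(2)[OF j])
    qed (rule stab[OF j])
  qed (use disj in \<open>auto simp: Orb_def\<close>)
qed

end

section \<open>Change of monoid along a monomial representation\<close>

text \<open>
  The free abelian group on \<open>E \<times> X\<close> is a direct sum of copies of the one on \<open>X\<close>; these are its
  inclusions and projections.
\<close>
definition inj_at :: "'e \<Rightarrow> 'b frag \<Rightarrow> ('e \<times> 'b) frag" where
  "inj_at i = frag_extend (\<lambda>b. frag_of (i, b))"

definition slice :: "'e \<Rightarrow> ('e \<times> 'b) frag \<Rightarrow> 'b frag" where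
  "slice i = frag_extend (\<lambda>(j, b). if j = i then frag_of b else 0)"

lemma inj_at_of [simp]: "inj_at i (frag_of b) = frag_of (i, b)"
  by (simp add: inj_at_def)

lemma slice_of [simp]: "slice i (frag_of (j, b)) = (if j = i then frag_of b else 0)"
  by (simp add: slice_def)

lemma additive_inj_at: "additive (inj_at i)"
  by (simp add: inj_at_def additive_frag_extend)

lemma additive_slice: "additive (slice i)"
  by (simp add: slice_def additive_frag_extend)

lemma additive_eq:
  assumes "additive f" "additive g" "\<And>b. f (frag_of b) = g (frag_of b)"
  shows "f x = g x"
  by (rule additive_eq_on_frags[OF assms(1,2), of x UNIV]) (simp_all add: assms(3) frags_def)

lemma slice_inj_at: "slice i (inj_at j x) = (if j = i then x else 0)"
proof (cases "j = i")
  case True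
  have "slice i (inj_at i x) = x"
    by (rule additive_eq[OF additive_comp[OF additive_slice additive_inj_at] additive_id]) simp
  then show ?thesis using True by simp
next
  case False
  have "slice i (inj_at j x) = 0"
    by (rule additive_eq[OF additive_comp[OF additive_slice additive_inj_at] additive_0]) (simp add: False)
  then show ?thesis using False by simp
qed

lemma additive_sum: "(\<And>i. i \<in> I \<Longrightarrow> additive (f i)) \<Longrightarrow> additive (\<lambda>x. \<Sum>i\<in>I. f i x)"
  by (simp add: additive_def sum.distrib)

lemma sum_slices:
  assumes "finite E" "x \<in> frags (E \<times> X)"
  shows "(\<Sum>i\<in>E. inj_at i (slice i x)) = x"
proof (rule additive_eq_on_frags[OF _ additive_id assms(2)])
  show "additive (\<lambda>x. \<Sum>i\<in>E. inj_at i (slice i x))"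
    by (intro additive_sum additive_comp[OF additive_inj_at additive_slice])
  fix b assume "b \<in> E \<times> X"
  then obtain i c where b: "b = (i, c)" "i \<in> E" by auto
  have "(\<Sum>j\<in>E. inj_at j (slice j (frag_of b))) = (\<Sum>j\<in>E. if i = j then frag_of b else 0)"
    by (intro sum.cong) (auto simp: b additive.zero[OF additive_inj_at])
  then show "(\<Sum>j\<in>E. inj_at j (slice j (frag_of b))) = frag_of b" using assms(1) b by simp
qed

lemma inj_at_in: "x \<in> frags X \<Longrightarrow> i \<in> E \<Longrightarrow> inj_at i x \<in> frags (E \<times> X)"
  by (rule additive_into[OF additive_inj_at diff_closed_frags]) auto

lemma slice_in: "x \<in> frags (E \<times> X) \<Longrightarrow> slice i x \<in> frags X"
  by (rule additive_into[OF additive_slice diff_closed_frags]) auto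

definition power_of :: "'e set \<Rightarrow> 'b frag set \<Rightarrow> ('e \<times> 'b) frag set" where
  "power_of E M = {x \<in> frags (E \<times> UNIV). \<forall>i\<in>E. slice i x \<in> M}"

lemma diff_closed_power_of: "diff_closed M \<Longrightarrow> diff_closed (power_of E M)"
  unfolding diff_closed_def power_of_def
  by (auto simp: additive.zero[OF additive_slice] additive.diff[OF additive_slice] diff_frags)

lemma inj_at_power_of: "diff_closed M \<Longrightarrow> i \<in> E \<Longrightarrow> x \<in> M \<Longrightarrow> inj_at i x \<in> power_of E M"
  using inj_at_in[of x UNIV i E]
  by (auto simp: power_of_def slice_inj_at diff_closed_def frags_def)

lemma power_of_rep:
  assumes "finite E" "x \<in> power_of E M"
  shows "x = (\<Sum>i\<in>E. inj_at i (slice i x))"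
  using sum_slices[OF assms(1), of x UNIV] assms(2) by (simp add: power_of_def)

lemma additive_eq_on_power_of:
  assumes "finite E" "x \<in> power_of E M" "additive f" "additive g"
    and "\<And>i m. i \<in> E \<Longrightarrow> m \<in> M \<Longrightarrow> f (inj_at i m) = g (inj_at i m)"
  shows "f x = g x"
proof -
  let ?s = "\<Sum>i\<in>E. inj_at i (slice i x)"
  have "f ?s = g ?s"
    unfolding additive.sum[OF assms(3)] additive.sum[OF assms(4)]
    by (rule sum.cong) (use assms(2,5) in \<open>auto simp: power_of_def\<close>)
  then show ?thesis using power_of_rep[OF assms(1,2)] by simp
qed

lemma additive_into_power_of:
  assumes "finite E" "x \<in> power_of E M" "additive f" "diff_closed N"
    and "\<And>i m. i \<in> E \<Longrightarrow> m \<in> M \<Longrightarrow> f (inj_at i m) \<in> N"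
  shows "f x \<in> N"
proof -
  have "f (\<Sum>i\<in>E. inj_at i (slice i x)) \<in> N"
    unfolding additive.sum[OF assms(3)]
    by (rule diff_closed_sum[OF assms(4)]) (use assms(2,5) in \<open>auto simp: power_of_def\<close>)
  then show ?thesis using power_of_rep[OF assms(1,2)] by simp
qed

text \<open>
  The map \<open>p\<close> applied in every coordinate.
\<close>
definition power_map :: "('b frag \<Rightarrow> 'c frag) \<Rightarrow> ('e \<times> 'b) frag \<Rightarrow> ('e \<times> 'c) frag" where
  "power_map p = frag_extend (\<lambda>(i, b). inj_at i (p (frag_of b)))"

lemma additive_power_map: "additive (power_map p)"
  by (simp add: power_map_def additive_frag_extend)

lemma power_map_inj_at: "additive p \<Longrightarrow> power_map p (inj_at i x) = inj_at i (p x)"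
  by (rule additive_eq[OF additive_comp[OF additive_power_map additive_inj_at]
        additive_comp[OF additive_inj_at]]) (simp_all add: power_map_def)

lemma slice_power_map: "additive p \<Longrightarrow> slice i (power_map p x) = p (slice i x)"
  by (rule additive_eq[OF additive_comp[OF additive_slice additive_power_map]
        additive_comp[OF _ additive_slice]])
    (auto simp: power_map_def slice_inj_at additive.zero)

lemma power_map_in:
  assumes "finite E" "additive p" "diff_closed M" "\<And>x. x \<in> N \<Longrightarrow> p x \<in> M" "x \<in> power_of E N"
  shows "power_map p x \<in> power_of E M"
  by (rule additive_into_power_of[OF assms(1,5) additive_power_map diff_closed_power_of[OF assms(3)]])
    (simp add: power_map_inj_at[OF assms(2)] inj_at_power_of assms(3,4))

text \<open>
  A multiplicative map from \<open>H\<close> to the \<open>E \<times> E\<close> matrices over \<open>\<int>G\<close> with one nonzero entry \<open>w s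
  i \<in> G\<close> in each column \<open>i\<close>, in row \<open>\<pi> s i\<close>. The identity of \<open>H\<close> may go to an idempotent
  matrix other than the identity matrix. That generality is what allows \<open>M \<mapsto> eM\<close> to be an
  instance, with \<open>E\<close> a single point.
\<close>
locale monomial_rep = G: monoid G + H: monoid H
  for G :: "('a, 'x) monoid_scheme" and H :: "('h, 'y) monoid_scheme" +
  fixes E :: "'e set" and \<pi> :: "'h \<Rightarrow> 'e \<Rightarrow> 'e" and w :: "'h \<Rightarrow> 'e \<Rightarrow> 'a"
  assumes finite_E: "finite E"
    and pi_closed: "\<lbrakk>s \<in> carrier H; i \<in> E\<rbrakk> \<Longrightarrow> \<pi> s i \<in> E"
    and w_closed: "\<lbrakk>s \<in> carrier H; i \<in> E\<rbrakk> \<Longrightarrow> w s i \<in> carrier G"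
    and pi_mult: "\<lbrakk>s \<in> carrier H; t \<in> carrier H; i \<in> E\<rbrakk> \<Longrightarrow> \<pi> (s \<otimes>\<^bsub>H\<^esub> t) i = \<pi> s (\<pi> t i)"
    and w_mult: "\<lbrakk>s \<in> carrier H; t \<in> carrier H; i \<in> E\<rbrakk> \<Longrightarrow>
      w (s \<otimes>\<^bsub>H\<^esub> t) i = w s (\<pi> t i) \<otimes>\<^bsub>G\<^esub> w t i"
begin

text \<open>
  The matrices act on the direct power \<open>M\<^sup>E\<close> of a \<open>G\<close>-module. The image of the idempotent that
  represents the identity of \<open>H\<close> is an \<open>H\<close>-module, the transfer of \<open>M\<close>.
\<close>
definition tr_act :: "('a \<Rightarrow> 'b frag \<Rightarrow> 'b frag) \<Rightarrow> 'h \<Rightarrow> ('e \<times> 'b) frag \<Rightarrow> ('e \<times> 'b) frag" where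
  "tr_act act s = frag_extend (\<lambda>(i, b). inj_at (\<pi> s i) (act (w s i) (frag_of b)))"

definition tr :: "('a \<Rightarrow> 'b frag \<Rightarrow> 'b frag) \<Rightarrow> 'b frag set \<Rightarrow> ('e \<times> 'b) frag set" where
  "tr act M = {x \<in> power_of E M. tr_act act \<one>\<^bsub>H\<^esub> x = x}"

lemma additive_tr_act: "additive (tr_act act s)"
  by (simp add: tr_act_def additive_frag_extend)

lemma tr_act_inj_at:
  assumes "smodule G act M" "s \<in> carrier H" "i \<in> E"
  shows "tr_act act s (inj_at i x) = inj_at (\<pi> s i) (act (w s i) x)"
  by (rule additive_eq[OF additive_comp[OF additive_tr_act additive_inj_at]
        additive_comp[OF additive_inj_at]])
    (use assms w_closed in \<open>auto simp: smodule_def tr_act_def\<close>)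

lemma tr_act_closed:
  assumes M: "smodule G act M" and s: "s \<in> carrier H" and x: "x \<in> power_of E M"
  shows "tr_act act s x \<in> power_of E M"
proof (rule additive_into_power_of[OF finite_E x additive_tr_act diff_closed_power_of])
  show dM: "diff_closed M" using M by (simp add: smodule_def)
  show "tr_act act s (inj_at i m) \<in> power_of E M" if "i \<in> E" "m \<in> M" for i m
    using M that s unfolding tr_act_inj_at[OF M s that(1)]
    by (intro inj_at_power_of dM pi_closed) (auto simp: smodule_def w_closed)
qed

lemma tr_act_mult:
  assumes M: "smodule G act M" and s: "s \<in> carrier H" and t: "t \<in> carrier H" and x: "x \<in> power_of E M"
  shows "tr_act act (s \<otimes>\<^bsub>H\<^esub> t) x = tr_act act s (tr_act act t x)"
proof (rule additive_eq_on_power_of[OF finite_E x additive_tr_act additive_comp[OF additive_tr_act additive_tr_act]])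
  fix i m assume i: "i \<in> E" and m: "m \<in> M"
  have "act (w s (\<pi> t i) \<otimes>\<^bsub>G\<^esub> w t i) m = act (w s (\<pi> t i)) (act (w t i) m)"
    using M w_closed[OF s pi_closed[OF t i]] w_closed[OF t i] m by (simp add: smodule_def)
  then show "tr_act act (s \<otimes>\<^bsub>H\<^esub> t) (inj_at i m) = tr_act act s (tr_act act t (inj_at i m))"
    by (simp add: tr_act_inj_at[OF M] s t i pi_closed pi_mult w_mult)
qed

lemma smodule_tr:
  assumes M: "smodule G act M"
  shows "smodule H (tr_act act) (tr act M)"
  unfolding smodule_def
proof (intro conjI ballI)
  have "diff_closed (power_of E M)" using M by (simp add: smodule_def diff_closed_power_of)
  then show "diff_closed (tr act M)"
    unfolding tr_def diff_closed_def
    by (auto simp: additive.zero[OF additive_tr_act] additive.diff[OF additive_tr_act])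
  fix x assume x: "x \<in> tr act M"
  show "tr_act act \<one>\<^bsub>H\<^esub> x = x" using x by (simp add: tr_def)
  fix s assume s: "s \<in> carrier H"
  show "tr_act act s x \<in> tr act M"
    using tr_act_closed[OF M s] tr_act_mult[OF M H.one_closed s] x s by (simp add: tr_def)
  fix t assume t: "t \<in> carrier H"
  show "tr_act act (s \<otimes>\<^bsub>H\<^esub> t) x = tr_act act s (tr_act act t x)"
    using tr_act_mult[OF M s t] x by (simp add: tr_def)
qed (rule additive_tr_act)

lemma power_map_tr_act:
  assumes N: "smodule G actN N" and M: "smodule G actM M" and p: "equivariant G actN N actM M p"
    and s: "s \<in> carrier H" and x: "x \<in> power_of E N"
  shows "power_map p (tr_act actN s x) = tr_act actM s (power_map p x)"
proof (rule additive_eq_on_power_of[OF finite_E x additive_comp[OF additive_power_map additive_tr_act]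
      additive_comp[OF additive_tr_act additive_power_map]])
  have addp: "additive p" using p by (simp add: equivariant_def)
  fix i m assume i: "i \<in> E" and m: "m \<in> N"
  have "p (actN (w s i) m) = actM (w s i) (p m)"
    using p w_closed[OF s i] m by (simp add: equivariant_def)
  then show "power_map p (tr_act actN s (inj_at i m)) = tr_act actM s (power_map p (inj_at i m))"
    by (simp add: tr_act_inj_at[OF N s i] tr_act_inj_at[OF M s i] power_map_inj_at[OF addp])
qed

text \<open>
  Transfer is an exact functor: direct powers are exact, and applying the idempotent to a
  preimage of a fixed element gives a fixed preimage.
\<close>
lemma
  assumes N: "smodule G actN N" and M: "smodule G actM M" and p: "equivariant G actN N actM M p"
  shows equivariant_tr: "equivariant H (tr_act actN) (tr actN N) (tr_act actM) (tr actM M) (power_map p)"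
    and tr_onto: "p ` N = M \<Longrightarrow> power_map p ` tr actN N = tr actM M"
    and ker_tr: "ker (tr actN N) (power_map p) = tr actN (ker N p)"
proof -
  have addp: "additive p" and pN: "\<And>x. x \<in> N \<Longrightarrow> p x \<in> M" using p by (auto simp: equivariant_def)
  have dM: "diff_closed M" and dN: "diff_closed N" using N M by (auto simp: smodule_def)
  note comm = power_map_tr_act[OF N M p]
  have into: "power_map p x \<in> tr actM M" if "x \<in> tr actN N" for x
    using that comm[OF H.one_closed, of x] power_map_in[OF finite_E addp dM pN, of N x]
    by (auto simp: tr_def)
  show eq: "equivariant H (tr_act actN) (tr actN N) (tr_act actM) (tr actM M) (power_map p)"
    unfolding equivariant_def
    using additive_power_map into comm by (auto simp: tr_def)
  show "power_map p ` tr actN N = tr actM M" if onto: "p ` N = M"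
  proof (intro equalityI subsetI)
    fix y assume y: "y \<in> tr actM M"
    then have yp: "y \<in> power_of E M" by (simp add: tr_def)
    have "\<exists>n\<in>N. p n = slice i y" if "i \<in> E" for i
      using yp that onto by (force simp: power_of_def)
    then obtain n where n: "\<And>i. i \<in> E \<Longrightarrow> n i \<in> N" "\<And>i. i \<in> E \<Longrightarrow> p (n i) = slice i y" by metis
    define z where "z = (\<Sum>i\<in>E. inj_at i (n i))"
    have z: "z \<in> power_of E N" unfolding z_def
      by (rule diff_closed_sum[OF diff_closed_power_of[OF dN]]) (simp add: inj_at_power_of dN n)
    have "power_map p z = (\<Sum>i\<in>E. inj_at i (slice i y))"
      unfolding z_def additive.sum[OF additive_power_map]
      by (rule sum.cong) (simp_all add: power_map_inj_at[OF addp] n)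
    then have pz: "power_map p z = y" using power_of_rep[OF finite_E yp] by simp
    (* The preimage z need not be fixed by the idempotent, but its image under the idempotent is. *)
    show "y \<in> power_map p ` tr actN N"
    proof (rule rev_image_eqI)
      show "tr_act actN \<one>\<^bsub>H\<^esub> z \<in> tr actN N"
        using tr_act_closed[OF N H.one_closed z] tr_act_mult[OF N H.one_closed H.one_closed z]
        by (simp add: tr_def)
      show "y = power_map p (tr_act actN \<one>\<^bsub>H\<^esub> z)"
        using comm[OF H.one_closed z] pz y by (simp add: tr_def)
    qed
  qed (use into in auto)
  have "power_map p x = 0 \<longleftrightarrow> (\<forall>i\<in>E. p (slice i x) = 0)" if "x \<in> power_of E N" for x
  proof
    assume "power_map p x = 0"
    then show "\<forall>i\<in>E. p (slice i x) = 0"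
      using slice_power_map[OF addp, of _ x] by (simp add: additive.zero[OF additive_slice])
  next
    assume *: "\<forall>i\<in>E. p (slice i x) = 0"
    have "power_map p (\<Sum>i\<in>E. inj_at i (slice i x)) = 0"
      unfolding additive.sum[OF additive_power_map]
      by (rule sum.neutral) (use * in \<open>simp add: power_map_inj_at[OF addp] additive.zero[OF additive_inj_at]\<close>)
    then show "power_map p x = 0" using power_of_rep[OF finite_E that] by simp
  qed
  then show "ker (tr actN N) (power_map p) = tr actN (ker N p)"
    by (auto simp: ker_def tr_def power_of_def)
qed

lemma FP_tr_0:
  assumes M: "smodule G act M" and FM: "FP 0 G act M"
    and free: "\<And>k. FP 0 H (tr_act (Fr_act G)) (tr (Fr_act G) (Fr G k))"
  shows "FP 0 H (tr_act act) (tr act M)"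
proof -
  obtain k \<phi> where phi: "free_map G k act M \<phi>" "\<phi> ` Fr G k = M"
    using FM by (rule FP_0_elim)
  show ?thesis
    by (rule H.FP_0_image[OF free equivariant_tr[OF G.smodule_Fr M phi(1)] tr_onto[OF G.smodule_Fr M phi]])
qed

lemma FP_tr_Suc:
  assumes M: "smodule G act M" and FM: "FP (Suc n) G act M"
    and free: "\<And>k. FP (Suc n) H (tr_act (Fr_act G)) (tr (Fr_act G) (Fr G k))"
    and IH: "\<And>N. smodule G (Fr_act G) N \<Longrightarrow> FP n G (Fr_act G) N \<Longrightarrow>
      FP n H (tr_act (Fr_act G)) (tr (Fr_act G) N)"
  shows "FP (Suc n) H (tr_act act) (tr act M)"
proof -
  obtain k \<phi> where phi: "free_map G k act M \<phi>" "\<phi> ` Fr G k = M"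
    and F: "FP n G (Fr_act G) (ker (Fr G k) \<phi>)"
    using FM by (rule FP_Suc_elim)
  have "FP n H (tr_act (Fr_act G)) (tr (Fr_act G) (ker (Fr G k) \<phi>))"
    by (rule IH[OF smodule_ker[OF G.smodule_Fr M phi(1)] F])
  then have "FP n H (tr_act (Fr_act G)) (ker (tr (Fr_act G) (Fr G k)) (power_map \<phi>))"
    by (simp add: ker_tr[OF G.smodule_Fr M phi(1)])
  then show ?thesis
    by (rule H.FP_quotient[OF smodule_tr[OF G.smodule_Fr] smodule_tr[OF M]
          equivariant_tr[OF G.smodule_Fr M phi(1)] tr_onto[OF G.smodule_Fr M phi] _ free])
qed

text \<open>
  An exact functor that sends free modules to modules of type FP preserves type FP, by
  induction on \<open>n\<close> through dimension shifting.
\<close>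
theorem FP_tr:
  assumes M: "smodule G act M" and FM: "FP n G act M"
    and free: "\<And>n k. FP n H (tr_act (Fr_act G)) (tr (Fr_act G) (Fr G k))"
  shows "FP n H (tr_act act) (tr act M)"
proof -
  have IH: "smodule G (Fr_act G) N \<Longrightarrow> FP n G (Fr_act G) N \<Longrightarrow>
      FP n H (tr_act (Fr_act G)) (tr (Fr_act G) N)" for N n
  proof (induction n arbitrary: N)
    case 0
    then show ?case by (rule FP_tr_0[OF _ _ free])
  next
    case (Suc n)
    show ?case by (rule FP_tr_Suc[OF Suc.prems free Suc.IH])
  qed
  show ?thesis
  proof (cases n)
    case 0
    show ?thesis using FP_tr_0[OF M _ free] FM unfolding 0 .
  next
    case (Suc m)
    show ?thesis unfolding Suc by (rule FP_tr_Suc[OF M FM[unfolded Suc] free IH])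
  qed
qed

text \<open>
  The transfer of a free module is the permutation module on the fixed points of the
  idempotent.
\<close>
definition tr_perm :: "'h \<Rightarrow> 'e \<times> nat \<times> 'a \<Rightarrow> 'e \<times> nat \<times> 'a" where
  "tr_perm s = (\<lambda>(i, j, t). (\<pi> s i, j, w s i \<otimes>\<^bsub>G\<^esub> t))"

definition tr_basis :: "nat \<Rightarrow> ('e \<times> nat \<times> 'a) set" where
  "tr_basis k = {x \<in> E \<times> {..<k} \<times> carrier G. tr_perm \<one>\<^bsub>H\<^esub> x = x}"

lemma tr_perm_closed:
  "s \<in> carrier H \<Longrightarrow> x \<in> E \<times> {..<k} \<times> carrier G \<Longrightarrow> tr_perm s x \<in> E \<times> {..<k} \<times> carrier G"
  by (auto simp: tr_perm_def pi_closed w_closed)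

lemma tr_perm_mult:
  "s \<in> carrier H \<Longrightarrow> t \<in> carrier H \<Longrightarrow> x \<in> E \<times> {..<k} \<times> carrier G \<Longrightarrow>
    tr_perm (s \<otimes>\<^bsub>H\<^esub> t) x = tr_perm s (tr_perm t x)"
  by (auto simp: tr_perm_def pi_closed w_closed pi_mult w_mult G.m_assoc)

lemma set_action_tr_perm: "set_action H tr_perm (tr_basis k)"
  unfolding set_action_def
proof (intro conjI ballI)
  fix x assume "x \<in> tr_basis k"
  then have x: "x \<in> E \<times> {..<k} \<times> carrier G" "tr_perm \<one>\<^bsub>H\<^esub> x = x" by (auto simp: tr_basis_def)
  show "tr_perm \<one>\<^bsub>H\<^esub> x = x" by (rule x)
  fix s assume s: "s \<in> carrier H"
  show "tr_perm s x \<in> tr_basis k"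
    using tr_perm_closed[OF s x(1)] tr_perm_mult[OF H.one_closed s x(1)] s by (simp add: tr_basis_def)
  fix t assume t: "t \<in> carrier H"
  show "tr_perm (s \<otimes>\<^bsub>H\<^esub> t) x = tr_perm s (tr_perm t x)" by (rule tr_perm_mult[OF s t x(1)])
qed

lemma tr_act_free: "tr_act (Fr_act G) = perm_act tr_perm"
proof (intro ext)
  show "tr_act (Fr_act G) s x = perm_act tr_perm s x" for s x
    unfolding tr_act_def perm_act_def by (rule frag_extend_eq) (auto simp: tr_perm_def perm_act_def)
qed

lemma tr_free: "tr (Fr_act G) (Fr G k) = frags (tr_basis k)"
proof -
  have eq: "power_of E (Fr G k) = frags (E \<times> {..<k} \<times> carrier G)"
  proof (intro equalityI subsetI)
    fix x assume x: "x \<in> power_of E (Fr G k)"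
    then have "(\<Sum>i\<in>E. inj_at i (slice i x)) \<in> frags (E \<times> {..<k} \<times> carrier G)"
      by (intro diff_closed_sum[OF diff_closed_frags] inj_at_in) (auto simp: power_of_def)
    then show "x \<in> frags (E \<times> {..<k} \<times> carrier G)" using power_of_rep[OF finite_E x] by simp
  next
    fix x assume "x \<in> frags (E \<times> {..<k} \<times> carrier G)"
    then show "x \<in> power_of E (Fr G k)"
      using slice_in[of x E "{..<k} \<times> carrier G"] by (auto simp: power_of_def) (auto simp: frags_def)
  qed
  show ?thesis
  proof (intro equalityI subsetI)
    fix x assume "x \<in> tr (Fr_act G) (Fr G k)"
    then have x: "x \<in> frags (E \<times> {..<k} \<times> carrier G)" "perm_act tr_perm \<one>\<^bsub>H\<^esub> x = x"
      by (auto simp: tr_def eq tr_act_free)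
    have "perm_act tr_perm \<one>\<^bsub>H\<^esub> x \<in> frags (tr_basis k)"
    proof (rule additive_into[OF additive_perm_act diff_closed_frags x(1)])
      fix b assume b: "b \<in> E \<times> {..<k} \<times> carrier G"
      show "perm_act tr_perm \<one>\<^bsub>H\<^esub> (frag_of b) \<in> frags (tr_basis k)"
        using tr_perm_closed[OF H.one_closed b] tr_perm_mult[OF H.one_closed H.one_closed b]
        by (simp add: tr_basis_def)
    qed
    then show "x \<in> frags (tr_basis k)" using x(2) by simp
  next
    fix x assume x: "x \<in> frags (tr_basis k)"
    then have "x \<in> frags (E \<times> {..<k} \<times> carrier G)" by (auto simp: frags_def tr_basis_def)
    moreover have "perm_act tr_perm \<one>\<^bsub>H\<^esub> x = x"
      by (rule additive_eq_on_frags[OF additive_perm_act additive_id x]) (simp add: tr_basis_def)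
    ultimately show "x \<in> tr (Fr_act G) (Fr G k)" by (simp add: tr_def eq tr_act_free)
  qed
qed

end

section \<open>Opposites\<close>

definition op_sgrp :: "'a sgrp \<Rightarrow> 'a sgrp" where
  "op_sgrp U = \<lparr>carrier = carrier U, sgmult = (\<lambda>x y. y \<cdot>\<^bsub>U\<^esub> x)\<rparr>"

definition op_monoid :: "'a monoid \<Rightarrow> 'a monoid" where
  "op_monoid S = \<lparr>carrier = carrier S, mult = (\<lambda>x y. y \<otimes>\<^bsub>S\<^esub> x), one = \<one>\<^bsub>S\<^esub>\<rparr>"

lemma op_monoid_simps [simp]:
  "carrier (op_monoid S) = carrier S" "x \<otimes>\<^bsub>op_monoid S\<^esub> y = y \<otimes>\<^bsub>S\<^esub> x" "\<one>\<^bsub>op_monoid S\<^esub> = \<one>\<^bsub>S\<^esub>"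
  by (simp_all add: op_monoid_def)

lemma op_sgrp_simps [simp]:
  "carrier (op_sgrp U) = carrier U" "x \<cdot>\<^bsub>op_sgrp U\<^esub> y = y \<cdot>\<^bsub>U\<^esub> x"
  by (simp_all add: op_sgrp_def)

lemma op_op_sgrp [simp]: "op_sgrp (op_sgrp U) = U"
  by (simp add: op_sgrp_def)

lemma sgroup_op: "sgroup U \<Longrightarrow> sgroup (op_sgrp U)"
  by (simp add: sgroup_def)

lemma left_ideal_op [simp]: "left_ideal (op_sgrp U) = right_ideal U"
  by (intro ext) (simp add: left_ideal_def right_ideal_def)

lemma right_ideal_op [simp]: "right_ideal (op_sgrp U) = left_ideal U"
  by (intro ext) (simp add: left_ideal_def right_ideal_def)

lemma completely_simple_op: "completely_simple U \<Longrightarrow> completely_simple (op_sgrp U)"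
  by (auto simp: completely_simple_def simple_semigroup_def two_sided_ideal_def
      minimal_left_ideal_def minimal_right_ideal_def sgroup_op)

lemma is_identity_op [simp]: "is_identity (op_sgrp U) = is_identity U"
  by (intro ext) (auto simp: is_identity_def)

lemma as_monoid_op: "as_monoid (op_sgrp U) = op_monoid (as_monoid U)"
  by (simp add: as_monoid_def op_monoid_def op_sgrp_def is_identity_op[unfolded op_sgrp_def])

lemma adjoin_one_op: "adjoin_one (op_sgrp U) = op_monoid (adjoin_one U)"
  by (auto simp: adjoin_one_def op_monoid_def op_sgrp_def intro!: ext split: option.splits)

lemma monoid_op: "monoid S \<Longrightarrow> monoid (op_monoid S)"
  unfolding monoid_def by simp

lemma monoid_adjoin_one: "sgroup U \<Longrightarrow> monoid (adjoin_one U)"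
  by (rule monoidI) (auto simp: adjoin_one_def sgroup_def)

lemma adjoin_one_simps [simp]:
  "None \<in> carrier (adjoin_one U)" "Some u \<in> carrier (adjoin_one U) \<longleftrightarrow> u \<in> carrier U"
  "\<one>\<^bsub>adjoin_one U\<^esub> = None"
  "None \<otimes>\<^bsub>adjoin_one U\<^esub> y = y" "y \<otimes>\<^bsub>adjoin_one U\<^esub> None = y"
  "Some u \<otimes>\<^bsub>adjoin_one U\<^esub> Some v = Some (u \<cdot>\<^bsub>U\<^esub> v)"
  by (auto simp: adjoin_one_def split: option.splits)

lemma carrier_adjoin_one: "carrier (adjoin_one U) = insert None (Some ` carrier U)"
  by (simp add: adjoin_one_def)


section \<open>Completely simple semigroups\<close>

text \<open>
  Minimality of \<open>zU\<close>, proved without first decomposing \<open>U\<close>: if \<open>K\<close> is a minimal right ideal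
  then \<open>UK\<close> is a two-sided ideal, so \<open>z = xk\<close> with \<open>k \<in> K\<close>; and \<open>kuU \<subseteq> K\<close> is a right ideal, so
  it contains \<open>k\<close>.
\<close>
lemma completely_simple_right_cancel:
  fixes U :: "'a sgrp" (structure)
  assumes "completely_simple U" "z \<in> carrier U" "u \<in> carrier U"
  shows "\<exists>v\<in>carrier U. (z \<cdot> u) \<cdot> v = z"
proof -
  interpret sgroup U using assms(1) by (simp add: completely_simple_def simple_semigroup_def)
  have simple: "two_sided_ideal U I \<Longrightarrow> I = carrier U" for I
    using assms(1) by (simp add: completely_simple_def simple_semigroup_def)
  obtain K where K: "right_ideal U K" and min: "\<And>K'. right_ideal U K' \<Longrightarrow> K' \<subseteq> K \<Longrightarrow> K' = K"
    using assms(1) by (auto simp: completely_simple_def minimal_right_ideal_def)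
  then have KU: "K \<subseteq> carrier U" and Kne: "K \<noteq> {}" and Kr: "\<And>x u. x \<in> K \<Longrightarrow> u \<in> carrier U \<Longrightarrow> x \<cdot> u \<in> K"
    by (auto simp: right_ideal_def)
  let ?I = "{x \<cdot> k | x k. x \<in> carrier U \<and> k \<in> K}"
  have "two_sided_ideal U ?I"
    unfolding two_sided_ideal_def left_ideal_def right_ideal_def
  proof (intro conjI ballI)
    show "?I \<subseteq> carrier U" using KU sg_closed by auto
    then show "?I \<subseteq> carrier U" .
    show "?I \<noteq> {}" using Kne KU by blast
    then show "?I \<noteq> {}" .
    fix w y assume w: "w \<in> carrier U" and "y \<in> ?I"
    then obtain x k where xk: "y = x \<cdot> k" "x \<in> carrier U" "k \<in> K" by blast
    then have "w \<cdot> y = (w \<cdot> x) \<cdot> k" "y \<cdot> w = x \<cdot> (k \<cdot> w)"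
      using w KU by (auto simp: sg_assoc)
    then show "w \<cdot> y \<in> ?I" "y \<cdot> w \<in> ?I" using xk w Kr sg_closed by blast+
  qed
  then have "z \<in> ?I" using simple assms(2) by blast
  then obtain x k where xk: "z = x \<cdot> k" "x \<in> carrier U" "k \<in> K" by blast
  have k: "k \<in> carrier U" using xk KU by blast
  let ?K' = "{(k \<cdot> u) \<cdot> v | v. v \<in> carrier U}"
  have ku: "k \<cdot> u \<in> carrier U" "k \<cdot> u \<in> K" using Kr xk(3) assms(3) KU by auto
  have "right_ideal U ?K'"
    unfolding right_ideal_def
  proof (intro conjI ballI)
    fix w y assume w: "w \<in> carrier U" and "y \<in> ?K'"
    then obtain v where v: "y = (k \<cdot> u) \<cdot> v" "v \<in> carrier U" by blast
    then have "y \<cdot> w = (k \<cdot> u) \<cdot> (v \<cdot> w)" using sg_assoc ku w by simp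
    then show "y \<cdot> w \<in> ?K'" using v w sg_closed by blast
  qed (use ku assms(3) sg_closed in auto)
  moreover have "?K' \<subseteq> K" using Kr ku by auto
  ultimately have "k \<in> ?K'" using min xk(3) by blast
  then obtain v where v: "v \<in> carrier U" "k = (k \<cdot> u) \<cdot> v" by blast
  have "(z \<cdot> u) \<cdot> v = x \<cdot> ((k \<cdot> u) \<cdot> v)"
    using xk k v(1) assms(3) sg_closed sg_assoc by simp
  then show ?thesis using v xk by auto
qed

lemma completely_simple_left_cancel:
  fixes U :: "'a sgrp" (structure)
  assumes "completely_simple U" "z \<in> carrier U" "u \<in> carrier U"
  shows "\<exists>v\<in>carrier U. v \<cdot> (u \<cdot> z) = z"
  using completely_simple_right_cancel[OF completely_simple_op[OF assms(1)]] assms(2,3) by simp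

text \<open>
  What is used of complete simplicity. For an idempotent \<open>e\<close>, the element \<open>g x\<close> is the inverse
  of \<open>exe\<close> in the group \<open>eUe\<close>; then \<open>x \<cdot> g x\<close> is the idempotent of \<open>Ue\<close> in the minimal right
  ideal of \<open>x\<close>, and \<open>g x \<cdot> x\<close> the idempotent of \<open>eU\<close> in its minimal left ideal. Relative to
  \<open>e\<close>, the Rees matrix coordinates of \<open>x\<close> are these two idempotents and \<open>exe\<close>. The axioms are
  symmetric under passing to the opposite semigroup, with the same \<open>g\<close>.
\<close>
locale pointed_rees = sgroup U for U :: "'a sgrp" (structure) +
  fixes e :: 'a and g :: "'a \<Rightarrow> 'a"
  assumes e_closed [simp]: "e \<in> carrier U"
    and ee [simp]: "e \<cdot> e = e"
    and g_closed [simp]: "x \<in> carrier U \<Longrightarrow> g x \<in> carrier U"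
    and e_g [simp]: "x \<in> carrier U \<Longrightarrow> e \<cdot> g x = g x"
    and g_e [simp]: "x \<in> carrier U \<Longrightarrow> g x \<cdot> e = g x"
    and g_x_e [simp]: "x \<in> carrier U \<Longrightarrow> g x \<cdot> (x \<cdot> e) = e"
    and e_x_g [simp]: "x \<in> carrier U \<Longrightarrow> e \<cdot> (x \<cdot> g x) = e"
    and x_g_x [simp]: "x \<in> carrier U \<Longrightarrow> x \<cdot> (g x \<cdot> x) = x"

text \<open>
  Right and left cancellation at \<open>e\<close> give a right and a left inverse of \<open>exe\<close> in \<open>eUe\<close>, which
  agree; let \<open>h\<close> be this inverse, so that \<open>hxh = h\<close>. Applied to \<open>x\<close> and \<open>h\<close>, cancellation
  gives \<open>x = xhu\<close>, so that \<open>xhx = xhxhu = xhu = x\<close>.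
\<close>
lemma completely_simple_pointed_rees:
  fixes U :: "'a sgrp" (structure)
  assumes U: "completely_simple U" and e: "e \<in> carrier U" "e \<cdot> e = e"
  obtains g where "pointed_rees U e g"
proof -
  interpret sgroup U using U by (simp add: completely_simple_def simple_semigroup_def)
  have "\<exists>h\<in>carrier U. e \<cdot> h = h \<and> h \<cdot> e = h \<and> h \<cdot> (x \<cdot> e) = e \<and> e \<cdot> (x \<cdot> h) = e \<and>
      x \<cdot> (h \<cdot> x) = x" if x: "x \<in> carrier U" for x
  proof -
    obtain v where v: "v \<in> carrier U" "(e \<cdot> (x \<cdot> e)) \<cdot> v = e"
      using completely_simple_right_cancel[OF U e(1), of "x \<cdot> e"] e x sg_closed by blast
    obtain w where w: "w \<in> carrier U" "w \<cdot> ((e \<cdot> x) \<cdot> e) = e"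
      using completely_simple_left_cancel[OF U e(1), of "e \<cdot> x"] e x sg_closed by blast
    have ee': "e \<cdot> (e \<cdot> y) = e \<cdot> y" if "y \<in> carrier U" for y
      using that e sg_assoc[of e e y] by simp
    define h where "h = e \<cdot> (v \<cdot> e)"
    define l where "l = e \<cdot> (w \<cdot> e)"
    have h: "h \<in> carrier U" "e \<cdot> h = h" "h \<cdot> e = h" and l: "l \<in> carrier U" "l \<cdot> e = l"
      using v(1) w(1) e by (simp_all add: h_def l_def sg_closed sg_assoc ee')
    have exh: "e \<cdot> (x \<cdot> h) = e"
    proof -
      have "e \<cdot> (x \<cdot> h) = ((e \<cdot> (x \<cdot> e)) \<cdot> v) \<cdot> e"
        using v(1) x e(1) by (simp add: h_def sg_closed sg_assoc)
      then show ?thesis using v e by simp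
    qed
    have lxe: "l \<cdot> (x \<cdot> e) = e"
    proof -
      have "l \<cdot> (x \<cdot> e) = e \<cdot> (w \<cdot> ((e \<cdot> x) \<cdot> e))"
        using w(1) x e(1) by (simp add: l_def sg_closed sg_assoc)
      then show ?thesis using w e by simp
    qed
    have "l = l \<cdot> (e \<cdot> (x \<cdot> h))" using exh l by simp
    also have "\<dots> = (l \<cdot> e) \<cdot> (x \<cdot> (e \<cdot> h))"
      using h l(1) x e(1) by (simp only: sg_closed sg_assoc)
    also have "\<dots> = (l \<cdot> (x \<cdot> e)) \<cdot> h"
      using h(1) l x e(1) by (simp add: sg_closed sg_assoc)
    also have "\<dots> = h" using lxe h(2) by simp
    finally have lh: "l = h" .
    have hxh: "h \<cdot> (x \<cdot> h) = h"
    proof -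
      have "h \<cdot> (x \<cdot> h) = (h \<cdot> e) \<cdot> (x \<cdot> h)" using h(3) by simp
      also have "\<dots> = h \<cdot> (e \<cdot> (x \<cdot> h))" using h(1) x e(1) by (simp only: sg_closed sg_assoc)
      finally show ?thesis using exh h(3) by simp
    qed
    obtain u where u: "u \<in> carrier U" "(x \<cdot> h) \<cdot> u = x"
      using completely_simple_right_cancel[OF U x h(1)] by blast
    have "x \<cdot> (h \<cdot> x) = x \<cdot> (h \<cdot> ((x \<cdot> h) \<cdot> u))" by (simp only: u(2))
    also have "\<dots> = (x \<cdot> (h \<cdot> (x \<cdot> h))) \<cdot> u"
      using h(1) x u(1) by (simp only: sg_closed sg_assoc)
    also have "\<dots> = x" using hxh u(2) by simp
    finally show ?thesis using h exh lxe lh by blast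
  qed
  then obtain g where "\<forall>x\<in>carrier U. g x \<in> carrier U \<and> e \<cdot> g x = g x \<and> g x \<cdot> e = g x \<and>
      g x \<cdot> (x \<cdot> e) = e \<and> e \<cdot> (x \<cdot> g x) = e \<and> x \<cdot> (g x \<cdot> x) = x"
    by metis
  then have "pointed_rees U e g" using e by unfold_locales auto
  then show ?thesis by (rule that)
qed

lemma pointed_rees_op: "pointed_rees U e g \<Longrightarrow> pointed_rees (op_sgrp U) e g"
  unfolding pointed_rees_def pointed_rees_axioms_def
  by (simp add: sgroup_op) (simp add: sgroup_def)

context pointed_rees
begin

lemma sg_closed' [simp]: "x \<in> carrier U \<Longrightarrow> y \<in> carrier U \<Longrightarrow> x \<cdot> y \<in> carrier U"
  by (rule sg_closed)

lemma assoc [simp]: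
  "x \<in> carrier U \<Longrightarrow> y \<in> carrier U \<Longrightarrow> z \<in> carrier U \<Longrightarrow> (x \<cdot> y) \<cdot> z = x \<cdot> (y \<cdot> z)"
  by (rule sg_assoc)

text \<open>
  With products nested to the right, the axioms need these continued forms to rewrite inside a
  product.
\<close>
lemma absorb [simp]:
  assumes "y \<in> carrier U"
  shows "e \<cdot> (e \<cdot> y) = e \<cdot> y"
    and "x \<in> carrier U \<Longrightarrow> e \<cdot> (g x \<cdot> y) = g x \<cdot> y"
    and "x \<in> carrier U \<Longrightarrow> g x \<cdot> (e \<cdot> y) = g x \<cdot> y"
    and "x \<in> carrier U \<Longrightarrow> g x \<cdot> (x \<cdot> (e \<cdot> y)) = e \<cdot> y"
    and "x \<in> carrier U \<Longrightarrow> e \<cdot> (x \<cdot> (g x \<cdot> y)) = e \<cdot> y"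
    and "x \<in> carrier U \<Longrightarrow> x \<cdot> (g x \<cdot> (x \<cdot> y)) = x \<cdot> y"
  using assms
  by (simp_all add: assoc[symmetric] del: assoc)
     (simp_all add: assoc)

end

context pointed_rees
begin

text \<open>
  The idempotents of the minimal left ideal \<open>Ue\<close>, which form a left zero band; dually for
  \<open>eU\<close>.
\<close>
definition left_band :: "'a set" where
  "left_band = {f \<in> carrier U. f \<cdot> f = f \<and> f \<cdot> e = f}"

definition right_band :: "'a set" where
  "right_band = {f \<in> carrier U. f \<cdot> f = f \<and> e \<cdot> f = f}"

definition grp :: "'a monoid" where
  "grp = \<lparr>carrier = {x \<in> carrier U. e \<cdot> x = x \<and> x \<cdot> e = x}, mult = sgmult U, one = e\<rparr>"

lemma grp_simps [simp]:
  "x \<in> carrier grp \<longleftrightarrow> x \<in> carrier U \<and> e \<cdot> x = x \<and> x \<cdot> e = x"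
  "x \<otimes>\<^bsub>grp\<^esub> y = x \<cdot> y" "\<one>\<^bsub>grp\<^esub> = e"
  by (auto simp: grp_def)

lemma group_grp: "group grp"
proof (rule groupI)
  fix x assume "x \<in> carrier grp"
  then have x: "x \<in> carrier U" "e \<cdot> x = x" "x \<cdot> e = x" by auto
  have "g x \<cdot> x = e" using g_x_e[OF x(1)] x(3) by simp
  then show "\<exists>y\<in>carrier grp. y \<otimes>\<^bsub>grp\<^esub> x = \<one>\<^bsub>grp\<^esub>" using x by (intro bexI[of _ "g x"]) auto
  show "\<one>\<^bsub>grp\<^esub> \<otimes>\<^bsub>grp\<^esub> x = x" using x by simp
  fix y assume "y \<in> carrier grp"
  then have y: "y \<in> carrier U" "e \<cdot> y = y" "y \<cdot> e = y" by auto
  show "x \<otimes>\<^bsub>grp\<^esub> y \<in> carrier grp"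
    using x y assoc[OF e_closed x(1) y(1)] by (simp del: assoc) (simp add: x y)
qed auto

lemma maximal_subgroup_eq_grp: "units_of (local_monoid U e) = grp"
proof -
  interpret G: group grp by (rule group_grp)
  have "local_monoid U e = grp"
  proof -
    have "{e \<cdot> u \<cdot> e | u. u \<in> carrier U} = {x \<in> carrier U. e \<cdot> x = x \<and> x \<cdot> e = x}"
    proof (intro equalityI subsetI)
      fix x assume "x \<in> {x \<in> carrier U. e \<cdot> x = x \<and> x \<cdot> e = x}"
      then have "x \<in> carrier U" "x = e \<cdot> x \<cdot> e" by auto
      then show "x \<in> {e \<cdot> u \<cdot> e | u. u \<in> carrier U}" by blast
    qed auto
    then show ?thesis by (simp add: local_monoid_def grp_def)
  qed
  then show ?thesis
    using G.Units_eq by (simp add: units_of_def grp_def)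
qed

lemma left_bandD: "f \<in> left_band \<Longrightarrow> f \<in> carrier U" "f \<in> left_band \<Longrightarrow> f \<cdot> f = f" "f \<in> left_band \<Longrightarrow> f \<cdot> e = f"
  by (auto simp: left_band_def)

lemma proj_in_left_band: "x \<in> carrier U \<Longrightarrow> x \<cdot> g x \<in> left_band"
  by (simp add: left_band_def)

text \<open>
  The element \<open>ef\<close> is an idempotent of the group \<open>eUe\<close>.
\<close>
lemma e_left_band: "f \<in> left_band \<Longrightarrow> e \<cdot> f = e"
proof -
  assume "f \<in> left_band"
  then have f: "f \<in> carrier U" "f \<cdot> f = f" "f \<cdot> e = f" by (auto dest: left_bandD)
  have "e \<cdot> f = e \<cdot> (f \<cdot> e)" using f by simp
  also have "\<dots> = e \<cdot> (f \<cdot> (e \<cdot> (f \<cdot> g f)))" using f by simp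
  also have "\<dots> = e \<cdot> (((f \<cdot> e) \<cdot> f) \<cdot> g f)" using f(1) by (simp del: absorb)
  also have "\<dots> = e \<cdot> (f \<cdot> g f)" by (simp only: f)
  also have "\<dots> = e" using f by simp
  finally show ?thesis .
qed

lemma left_band_left_zero: "f \<in> left_band \<Longrightarrow> h \<in> left_band \<Longrightarrow> f \<cdot> h = f"
proof -
  assume fh: "f \<in> left_band" "h \<in> left_band"
  then have "f \<cdot> h = f \<cdot> (e \<cdot> h)"
    using left_bandD(1,3) assoc by (metis e_closed)
  then show ?thesis using fh by (simp add: e_left_band left_bandD)
qed

lemma proj_left_band: "f \<in> left_band \<Longrightarrow> f \<cdot> g f = f"
proof -
  assume f: "f \<in> left_band"
  have "f \<cdot> g f = (f \<cdot> f) \<cdot> g f" using f by (simp add: left_bandD(2))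
  also have "\<dots> = f \<cdot> (f \<cdot> g f)" using left_bandD(1)[OF f] by simp
  also have "\<dots> = f" using f left_band_left_zero proj_in_left_band left_bandD(1) by blast
  finally show ?thesis .
qed

text \<open>
  The elements \<open>x\<close> and \<open>xy\<close> lie in the same minimal right ideal.
\<close>
lemma proj_mult: "x \<in> carrier U \<Longrightarrow> y \<in> carrier U \<Longrightarrow> (x \<cdot> y) \<cdot> g (x \<cdot> y) = x \<cdot> g x"
proof -
  assume xy: "x \<in> carrier U" "y \<in> carrier U"
  then have "(x \<cdot> g x) \<cdot> ((x \<cdot> y) \<cdot> g (x \<cdot> y)) = x \<cdot> g x"
    by (intro left_band_left_zero proj_in_left_band) auto
  moreover have "(x \<cdot> g x) \<cdot> ((x \<cdot> y) \<cdot> g (x \<cdot> y)) = (x \<cdot> y) \<cdot> g (x \<cdot> y)" using xy by simp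
  ultimately show ?thesis by simp
qed

text \<open>
  A right ideal is a union of minimal ones, and each of these contains exactly one element of
  the band. So a right ideal is determined by its idempotents in \<open>Ue\<close>, and each such
  idempotent has a right ideal of its own.
\<close>
lemma finite_right_ideals: "finite {K. right_ideal U K} \<longleftrightarrow> finite left_band"
proof
  assume fin: "finite {K. right_ideal U K}"
  let ?R = "\<lambda>f. {x \<in> carrier U. x \<cdot> g x = f}"
  have in_R: "f \<in> ?R f" if "f \<in> left_band" for f using that proj_left_band left_bandD(1) by auto
  have "inj_on ?R left_band"
  proof (rule inj_onI)
    fix f h assume f: "f \<in> left_band" and "?R f = ?R h"
    then have "f \<in> ?R h" using in_R by blast
    then show "f = h" using proj_left_band[OF f] by simp
  qed
  moreover have "right_ideal U (?R f)" if f: "f \<in> left_band" for f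
    unfolding right_ideal_def using in_R[OF f] proj_mult by (auto simp del: assoc)
  then have "?R ` left_band \<subseteq> {K. right_ideal U K}" by blast
  ultimately show "finite left_band" using fin finite_imageD finite_subset by metis
next
  assume fin: "finite left_band"
  have mem: "x \<in> K \<longleftrightarrow> x \<in> carrier U \<and> x \<cdot> g x \<in> K \<inter> left_band" if K: "right_ideal U K" for K x
  proof
    assume "x \<in> K"
    then show "x \<in> carrier U \<and> x \<cdot> g x \<in> K \<inter> left_band"
      using K proj_in_left_band by (auto simp: right_ideal_def)
  next
    assume x: "x \<in> carrier U \<and> x \<cdot> g x \<in> K \<inter> left_band"
    then have "(x \<cdot> g x) \<cdot> x \<in> K" using K by (simp add: right_ideal_def del: assoc)
    then show "x \<in> K" using x by simp
  qed
  have "inj_on (\<lambda>K. K \<inter> left_band) {K. right_ideal U K}"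
  proof (rule inj_onI)
    fix K L assume KL: "K \<in> {K. right_ideal U K}" "L \<in> {K. right_ideal U K}" and eq: "K \<inter> left_band = L \<inter> left_band"
    have "x \<in> K \<longleftrightarrow> x \<in> L" for x using mem[of K x] mem[of L x] KL eq by simp
    then show "K = L" by blast
  qed
  moreover have "(\<lambda>K. K \<inter> left_band) ` {K. right_ideal U K} \<subseteq> Pow left_band" by blast
  ultimately show "finite {K. right_ideal U K}"
    using fin finite_imageD finite_subset finite_Pow_iff by metis
qed

lemma right_band_conv: "right_band = pointed_rees.left_band (op_sgrp U) e"
  by (simp add: right_band_def pointed_rees.left_band_def[OF pointed_rees_op[OF pointed_rees_axioms]])

lemma right_bandD: "f \<in> right_band \<Longrightarrow> f \<in> carrier U" "f \<in> right_band \<Longrightarrow> e \<cdot> f = f"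
  by (auto simp: right_band_def)

lemmas coproj_in_right_band =
  pointed_rees.proj_in_left_band[OF pointed_rees_op[OF pointed_rees_axioms], folded right_band_conv, simplified]
lemmas coproj_right_band =
  pointed_rees.proj_left_band[OF pointed_rees_op[OF pointed_rees_axioms], folded right_band_conv, simplified]
lemmas coproj_mult =
  pointed_rees.proj_mult[OF pointed_rees_op[OF pointed_rees_axioms], unfolded op_sgrp_simps]
lemmas right_band_e =
  pointed_rees.e_left_band[OF pointed_rees_op[OF pointed_rees_axioms], folded right_band_conv, simplified]
lemmas finite_left_ideals =
  pointed_rees.finite_right_ideals[OF pointed_rees_op[OF pointed_rees_axioms], folded right_band_conv, unfolded right_ideal_op]

end

text \<open>
  The trivial module is the free abelian group on one point.
\<close>
abbreviation FPZ :: "nat \<Rightarrow> ('a, 'x) monoid_scheme \<Rightarrow> bool" where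
  "FPZ n S \<equiv> FP n S (\<lambda>_ x. x) (UNIV :: unit frag set)"

lemma smodule_trivial: "smodule S (\<lambda>_ x. x) (UNIV :: 'b frag set)"
  by (simp add: smodule_def diff_closed_def additive_id)

text \<open>
  For an idempotent \<open>i\<close> of \<open>Ue\<close> let \<open>\<Psi>\<close> be the augmentation of the part of an element of \<open>A\<^sub>0\<close>
  that lies in the minimal right ideal of \<open>i\<close>. If this right ideal avoids the supports of the
  generators of the kernel, \<open>\<Psi>\<close> vanishes on the whole kernel. If it also avoids the support of
  some \<open>a\<close> of augmentation one, this is refuted by the element \<open>i a - a\<close> of the kernel.
\<close>
lemma (in pointed_rees) finite_left_band:
  assumes "FPZ 1 (adjoin_one U)"
  shows "finite left_band"
proof -
  let ?S = "adjoin_one U"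
  interpret S: monoid ?S by (rule monoid_adjoin_one) (rule sgroup_axioms)
  obtain k \<phi> d where r: "free_res 1 ?S (\<lambda>_ x. x) (UNIV :: unit frag set) k \<phi> d"
    using assms by (rule FP_elim)
  have phi: "free_map ?S (k 0) (\<lambda>_ x. x) UNIV \<phi>" "\<phi> ` Fr ?S (k 0) = UNIV"
    and d0: "d 0 ` Fr ?S (k 1) = ker (Fr ?S (k 0)) \<phi>"
    and d: "free_map ?S (k 1) (Fr_act ?S) (Fr ?S (k 0)) (d 0)"
    using free_resD[OF r] by auto
  have addphi: "additive \<phi>" and addd: "additive (d 0)" using phi d by (auto simp: equivariant_def)
  define b where "b j = d 0 (frag_of (j, None))" for j
  have b: "b j \<in> ker (Fr ?S (k 0)) \<phi>" if "j < k 1" for j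
  proof -
    have "frag_of (j, None) \<in> Fr ?S (k 1)" using that by simp
    then show ?thesis using d0 unfolding b_def by blast
  qed
  have "frag_of () \<in> \<phi> ` Fr ?S (k 0)" using phi(2) by simp
  then obtain a where a: "a \<in> Fr ?S (k 0)" "\<phi> a = frag_of ()" by force
  define W where "W = (\<Union>j<k 1. Poly_Mapping.keys (b j)) \<union> Poly_Mapping.keys a"
  have finW: "finite W" by (simp add: W_def)
  have "left_band \<subseteq> (\<lambda>(j, s). case s of None \<Rightarrow> e | Some u \<Rightarrow> u \<cdot> g u) ` W"
  proof (rule ccontr)
    assume "\<not> ?thesis"
    then obtain i where i: "i \<in> left_band"
      and avoid: "i \<notin> (\<lambda>(j, s). case s of None \<Rightarrow> e | Some u \<Rightarrow> u \<cdot> g u) ` W" by blast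
    have iU: "i \<in> carrier U" and ii: "i \<cdot> g i = i" using i left_bandD proj_left_band by auto
    define \<Psi> where "\<Psi> = frag_extend (\<lambda>(j :: nat, s). case s of None \<Rightarrow> 0
      | Some u \<Rightarrow> if u \<cdot> g u = i then \<phi> (frag_of (j, None)) else 0)"
    have addPsi: "additive \<Psi>" by (simp add: \<Psi>_def additive_frag_extend)
    have Psi_of: "\<Psi> (frag_of (j, Some u)) = (if u \<cdot> g u = i then \<phi> (frag_of (j, None)) else 0)" for j u
      by (simp add: \<Psi>_def)
    have Psi_avoid: "\<Psi> x = 0" if "Poly_Mapping.keys x \<subseteq> W" for x
      unfolding \<Psi>_def
    proof (rule frag_extend_eq_0)
      fix y assume y: "y \<in> Poly_Mapping.keys x"
      obtain j s where js: "y = (j, s)" by fastforce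
      have "(j, s) \<in> W" using y js that by blast
      then have "s = Some u \<Longrightarrow> u \<cdot> g u \<noteq> i" for u using avoid by force
      then show "(case y of (j, s) \<Rightarrow> case s of None \<Rightarrow> 0
          | Some u \<Rightarrow> if u \<cdot> g u = i then \<phi> (frag_of (j, None)) else 0) = 0"
        by (simp add: js split: option.splits)
    qed
    have phi_of: "\<phi> (frag_of (j, s)) = \<phi> (frag_of (j, None))" if "j < k 0" "s \<in> carrier ?S" for j s
    proof -
      have "frag_of (j, None) \<in> Fr ?S (k 0)" using that by simp
      then have "\<phi> (Fr_act ?S s (frag_of (j, None))) = \<phi> (frag_of (j, None))"
        using phi(1) that(2) unfolding equivariant_def by blast
      then show ?thesis by simp
    qed
    have Psi_act: "\<Psi> (Fr_act ?S (Some u) x) = (if u \<cdot> g u = i then \<phi> x else 0)"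
      if u: "u \<in> carrier U" and x: "x \<in> Fr ?S (k 0)" for u x
    proof (rule additive_eq_on_frags[OF additive_comp[OF addPsi additive_perm_act] _ x])
      show "additive (\<lambda>x. if u \<cdot> g u = i then \<phi> x else 0)"
        using addphi by (simp add: additive_def)
      fix y assume "y \<in> {..<k 0} \<times> carrier ?S"
      then obtain j s where y: "y = (j, s)" "j < k 0" "s \<in> carrier ?S" by auto
      show "\<Psi> (Fr_act ?S (Some u) (frag_of y)) = (if u \<cdot> g u = i then \<phi> (frag_of y) else 0)"
      proof (cases s)
        case None
        then show ?thesis by (simp add: y Psi_of)
      next
        case (Some v)
        then have "v \<in> carrier U" using y by simp
        then show ?thesis using phi_of[OF y(2,3)] proj_mult[OF u]
          by (simp add: y(1) Some Psi_of del: assoc)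
      qed
    qed
    have Psi_d: "\<Psi> (d 0 y) = 0" if "y \<in> Fr ?S (k 1)" for y
    proof (rule additive_eq_on_frags[OF additive_comp[OF addPsi addd] additive_0 that])
      fix z assume "z \<in> {..<k 1} \<times> carrier ?S"
      then obtain j s where z: "z = (j, s)" "j < k 1" "s \<in> carrier ?S" by auto
      have "frag_of (j, None) \<in> Fr ?S (k 1)" using z by simp
      then have "d 0 (Fr_act ?S s (frag_of (j, None))) = Fr_act ?S s (b j)"
        using d z(3) unfolding equivariant_def b_def by blast
      then have dz: "d 0 (frag_of z) = Fr_act ?S s (b j)" by (simp add: z)
      have bj: "b j \<in> Fr ?S (k 0)" "\<phi> (b j) = 0" using b[OF z(2)] by (auto simp: ker_def)
      show "\<Psi> (d 0 (frag_of z)) = 0"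
      proof (cases s)
        case None
        have "Fr_act ?S \<one>\<^bsub>?S\<^esub> (b j) = b j" using S.smodule_Fr[of "k 0"] bj(1) by (simp only: smodule_def)
        then have "d 0 (frag_of z) = b j" by (simp add: dz None)
        then show ?thesis using Psi_avoid[of "b j"] z(2) by (auto simp: W_def)
      next
        case (Some u)
        then show ?thesis using Psi_act[OF _ bj(1), of u] bj(2) z(3) by (simp add: dz)
      qed
    qed
    let ?c = "Fr_act ?S (Some i) a - a"
    have ia: "Fr_act ?S (Some i) a \<in> Fr ?S (k 0)" "\<phi> (Fr_act ?S (Some i) a) = \<phi> a"
      using S.smodule_Fr[of "k 0"] phi(1) iU a(1) by (simp_all add: smodule_def equivariant_def)
    have "?c \<in> ker (Fr ?S (k 0)) \<phi>"
      using ia a(1) by (simp add: ker_def diff_frags additive.diff[OF addphi])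
    then obtain y where "y \<in> Fr ?S (k 1)" "?c = d 0 y" using d0 by force
    then have "\<Psi> ?c = 0" using Psi_d by simp
    moreover have "\<Psi> ?c = frag_of ()"
      using Psi_act[OF iU a(1)] Psi_avoid[of a] a(2) ii
      by (simp add: additive.diff[OF addPsi] W_def)
    ultimately show False by simp
  qed
  then show ?thesis using finW finite_surj by blast
qed

lemma (in monoid) FP_iso:
  assumes N: "smodule G actN N" and M: "smodule G actM M" and p: "equivariant G actN N actM M p" "p ` N = M"
    and ker: "ker N p = {0}" and F: "FP n G actN N"
  shows "FP n G actM M"
proof (cases n)
  case 0
  show ?thesis using FP_0_image[OF _ p] F unfolding 0 .
next
  case (Suc m)
  show ?thesis unfolding Suc
    by (rule FP_quotient[OF N M p]) (use ker FP_zero[OF N] F Suc in auto)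
qed

definition aug :: "'b frag \<Rightarrow> unit frag" where
  "aug = frag_extend (\<lambda>_. frag_of ())"

lemma aug_of [simp]: "aug (frag_of b) = frag_of ()"
  by (simp add: aug_def)

lemma additive_aug: "additive aug"
  by (simp add: aug_def additive_frag_extend)

lemma aug_inj_at: "aug (inj_at i x) = x"
  by (rule additive_eq[OF additive_comp[OF additive_aug additive_inj_at] additive_id]) simp

lemma FP_act_cong:
  assumes "\<And>s x. s \<in> carrier S \<Longrightarrow> x \<in> M \<Longrightarrow> act s x = act' s x" and F: "FP n S act M"
  shows "FP n S act' M"
proof -
  obtain k \<phi> d where r: "free_res n S act M k \<phi> d" using F by (rule FP_elim)
  have "free_map S (k 0) act' M \<phi>"
    using free_resD(1)[OF r] assms(1) unfolding equivariant_def by simp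
  then have "free_res n S act' M k \<phi> d" using r unfolding free_res_def by simp
  then show ?thesis by (rule FP_intro)
qed

context monomial_rep
begin

lemma tr_act_trivial:
  "tr_act (\<lambda>_ x. x) = perm_act (\<lambda>s (i, b :: 'c). (\<pi> s i, b))"
proof (intro ext)
  show "tr_act (\<lambda>_ x. x) s x = perm_act (\<lambda>s (i, b :: 'c). (\<pi> s i, b)) s x" for s x
    unfolding tr_act_def perm_act_def by (rule frag_extend_eq) auto
qed

lemma tr_trivial:
  assumes "\<And>i. i \<in> E \<Longrightarrow> \<pi> \<one>\<^bsub>H\<^esub> i = i"
  shows "tr (\<lambda>_ x. x) (UNIV :: unit frag set) = frags (E \<times> UNIV)"
proof -
  have "perm_act (\<lambda>s (i, b :: unit). (\<pi> s i, b)) \<one>\<^bsub>H\<^esub> x = x" if "x \<in> frags (E \<times> UNIV)" for x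
    by (rule additive_eq_on_frags[OF additive_perm_act additive_id that]) (auto simp: assms)
  then show ?thesis by (auto simp: tr_def power_of_def tr_act_trivial)
qed

lemma equivariant_aug:
  assumes "\<And>i. i \<in> E \<Longrightarrow> \<pi> \<one>\<^bsub>H\<^esub> i = i"
  shows "equivariant H (tr_act (\<lambda>_ x. x)) (tr (\<lambda>_ x. x) (UNIV :: unit frag set))
    (\<lambda>_ x. x) UNIV aug"
proof -
  have "equivariant H (perm_act (\<lambda>s (i, b). (\<pi> s i, b))) (frags (E \<times> (UNIV :: unit set))) (\<lambda>_ x. x) UNIV aug"
    by (rule equivariant_on_basis[OF additive_aug]) (auto simp: diff_closed_def additive_id)
  moreover have "tr (\<lambda>_ x. x) (UNIV :: unit frag set) = frags (E \<times> UNIV)"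
    by (rule tr_trivial[OF assms])
  ultimately show ?thesis by (simp only: tr_act_trivial)
qed

lemma aug_onto:
  assumes "\<And>i. i \<in> E \<Longrightarrow> \<pi> \<one>\<^bsub>H\<^esub> i = i" "E \<noteq> {}"
  shows "aug ` tr (\<lambda>_ x. x) (UNIV :: unit frag set) = UNIV"
proof -
  obtain i where "i \<in> E" using assms(2) by blast
  then have "y \<in> aug ` frags (E \<times> (UNIV :: unit set))" for y
    by (intro rev_image_eqI[of "inj_at i y"]) (simp_all add: aug_inj_at inj_at_in frags_def[of UNIV])
  then have "aug ` frags (E \<times> (UNIV :: unit set)) = UNIV" by (rule UNIV_eq_I[symmetric])
  moreover have "tr (\<lambda>_ x. x) (UNIV :: unit frag set) = frags (E \<times> UNIV)"
    by (rule tr_trivial[OF assms(1)])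
  ultimately show ?thesis by simp
qed

text \<open>
  When \<open>E\<close> is a point, transfer fixes the trivial module.
\<close>
lemma FPZ_singleton:
  assumes E: "E = {i}"
    and free: "\<And>n k. FP n H (perm_act tr_perm) (frags (tr_basis k))"
    and F: "FPZ n G"
  shows "FPZ n H"
proof -
  have pi1: "\<pi> \<one>\<^bsub>H\<^esub> j = j" if "j \<in> E" for j
    using pi_closed[OF H.one_closed that] that E by simp
  have ke: "ker (tr (\<lambda>_ x. x) (UNIV :: unit frag set)) aug = {0}"
  proof -
    have "x = 0" if "x \<in> frags (E \<times> (UNIV :: unit set))" "aug x = 0" for x
    proof -
      have "inj_at i (slice i x) = x" using sum_slices[OF finite_E that(1)] E by simp
      then show ?thesis using that(2) aug_inj_at[of i "slice i x"] by (simp add: additive.zero[OF additive_inj_at])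
    qed
    moreover have "tr (\<lambda>_ x. x) (UNIV :: unit frag set) = frags (E \<times> UNIV)"
      by (rule tr_trivial) (rule pi1)
    ultimately show ?thesis by (auto simp: ker_def additive.zero[OF additive_aug])
  qed
  show ?thesis
  proof (rule H.FP_iso[OF smodule_tr[OF smodule_trivial] smodule_trivial equivariant_aug[OF pi1] aug_onto[OF pi1] ke])
    show "FP n H (tr_act (\<lambda>_ x. x)) (tr (\<lambda>_ x. x) (UNIV :: unit frag set))"
      by (rule FP_tr[OF smodule_trivial F]) (simp add: tr_free tr_act_free free)
  qed (use E in auto)
qed

end

text \<open>
  A left module over a group becomes one over the opposite group through inversion, which is a
  representation by \<open>1 \<times> 1\<close> matrices.
\<close>
lemma FPZ_op:
  fixes S :: "'a monoid"
  assumes S: "group S" and F: "FPZ n S"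
  shows "FPZ n (op_monoid S)"
proof -
  interpret S: group S by (rule S)
  interpret op: monoid "op_monoid S" by (rule monoid_op[OF S.monoid_axioms])
  interpret R: monomial_rep S "op_monoid S" "{()}" "\<lambda>_ _. ()" "\<lambda>s _. inv\<^bsub>S\<^esub> s"
    by unfold_locales (auto simp: S.inv_mult_group)
  have tp: "R.tr_perm s (i, j, t) = ((), j, inv\<^bsub>S\<^esub> s \<otimes>\<^bsub>S\<^esub> t)" for s i j t
    by (simp add: R.tr_perm_def)
  have tb: "R.tr_basis k = {()} \<times> {..<k} \<times> carrier S" for k
    by (auto simp: R.tr_basis_def tp)
  show ?thesis
  proof (rule R.FPZ_singleton[OF refl _ F])
    fix n k
    show "FP n (op_monoid S) (perm_act R.tr_perm) (frags (R.tr_basis k))"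
    proof (rule op.FP_projective_action[OF R.set_action_tr_perm, where J = "{..<k}"
          and x = "\<lambda>j. ((), j, \<one>\<^bsub>S\<^esub>)" and e = "\<lambda>_. \<one>\<^bsub>S\<^esub>"])
      fix y assume "y \<in> R.tr_basis k"
      then obtain j t where y: "y = ((), j, t)" "j < k" "t \<in> carrier S" by (auto simp: tb)
      show "\<exists>j\<in>{..<k}. \<exists>s\<in>carrier (op_monoid S). y = R.tr_perm s ((), j, \<one>\<^bsub>S\<^esub>)"
        by (rule bexI[of _ j], rule bexI[of _ "inv\<^bsub>S\<^esub> t"]) (use y in \<open>auto simp: tp\<close>)
    next
      fix j s t assume "s \<in> carrier (op_monoid S)" "t \<in> carrier (op_monoid S)"
        "R.tr_perm s ((), j, \<one>\<^bsub>S\<^esub>) = R.tr_perm t ((), j, \<one>\<^bsub>S\<^esub>)"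
      then have "s \<in> carrier S" "t \<in> carrier S" "inv\<^bsub>S\<^esub> s = inv\<^bsub>S\<^esub> t" by (auto simp: tp)
      then have "s = t" using S.inv_inv by metis
      then show "s \<otimes>\<^bsub>op_monoid S\<^esub> \<one>\<^bsub>S\<^esub> = t \<otimes>\<^bsub>op_monoid S\<^esub> \<one>\<^bsub>S\<^esub>" by simp
    qed (auto simp: tb tp)
  qed
qed

context pointed_rees
begin

lemma monoid_S: "monoid (adjoin_one U)"
  by (rule monoid_adjoin_one) (rule sgroup_axioms)

text \<open>
  Transfer along the inclusion of \<open>H\<close> in \<open>U\<^sup>1\<close> is \<open>M \<mapsto> eM\<close>. It takes the free module of rank
  one to \<open>\<int>(eU)\<close>, where \<open>eU\<close> is the disjoint union of the free orbits \<open>Hf\<close> with \<open>f\<close> an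
  idempotent of \<open>eU\<close>.
\<close>
lemma FPZ_grp_of_adjoin_one:
  assumes fin: "finite right_band" and F: "FPZ n (adjoin_one U)"
  shows "FPZ n grp"
proof -
  interpret S: monoid "adjoin_one U" by (rule monoid_S)
  interpret G: group grp by (rule group_grp)
  interpret R: monomial_rep "adjoin_one U" grp "{()}" "\<lambda>_ _. ()" "\<lambda>s _. Some s"
    by unfold_locales auto
  have tp: "R.tr_perm s (i, j, t) = ((), j, Some s \<otimes>\<^bsub>adjoin_one U\<^esub> t)" for s i j t
    by (simp add: R.tr_perm_def)
  have tb: "R.tr_basis k = {((), j, Some u) | j u. j < k \<and> u \<in> carrier U \<and> e \<cdot> u = u}" for k
    by (auto simp: R.tr_basis_def tp carrier_adjoin_one)
  show ?thesis
  proof (rule R.FPZ_singleton[OF refl _ F])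
    fix n k
    show "FP n grp (perm_act R.tr_perm) (frags (R.tr_basis k))"
    proof (rule G.FP_projective_action[OF R.set_action_tr_perm, where J = "{..<k} \<times> right_band"
          and x = "\<lambda>(j, f). ((), j, Some f)" and e = "\<lambda>_. e"])
      show "finite ({..<k} \<times> right_band)" using fin by simp
    next
      fix y assume "y \<in> R.tr_basis k"
      then obtain j u where y: "y = ((), j, Some u)" "j < k" "u \<in> carrier U" "e \<cdot> u = u" by (auto simp: tb)
      have "e \<cdot> (u \<cdot> e) = u \<cdot> e" using y(3) assoc[of e u e] y(4) by (simp del: assoc)
      then show "\<exists>p\<in>{..<k} \<times> right_band. \<exists>s\<in>carrier grp. y = R.tr_perm s (case p of (j, f) \<Rightarrow> ((), j, Some f))"
        using y coproj_in_right_band[OF y(3)]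
        by (intro bexI[of _ "(j, g u \<cdot> u)"] bexI[of _ "u \<cdot> e"]) (auto simp: tp)
    next
      fix p q s t assume p: "p \<in> {..<k} \<times> right_band" and q: "q \<in> {..<k} \<times> right_band"
        and st: "s \<in> carrier grp" "t \<in> carrier grp"
        and eq: "R.tr_perm s (case p of (j, f) \<Rightarrow> ((), j, Some f)) = R.tr_perm t (case q of (j, f) \<Rightarrow> ((), j, Some f))"
      obtain i f j h where pq: "p = (i, f)" "q = (j, h)" by fastforce
      have fh: "f \<in> right_band" "h \<in> right_band" "f \<in> carrier U" "h \<in> carrier U"
        using p q pq right_bandD by auto
      have "i = j" "s \<cdot> f = t \<cdot> h" using eq by (auto simp: pq tp)
      moreover have "f = g (s \<cdot> f) \<cdot> (s \<cdot> f)" "h = g (t \<cdot> h) \<cdot> (t \<cdot> h)"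
        using coproj_mult[of f s] coproj_mult[of h t] coproj_right_band fh st by auto
      ultimately show "p = q" unfolding pq by metis
    next
      fix p s t assume p: "p \<in> {..<k} \<times> right_band" and st: "s \<in> carrier grp" "t \<in> carrier grp"
        and eq: "R.tr_perm s (case p of (j, f) \<Rightarrow> ((), j, Some f)) = R.tr_perm t (case p of (j, f) \<Rightarrow> ((), j, Some f))"
      obtain i f where pf: "p = (i, f)" by fastforce
      have f: "f \<in> right_band" "f \<in> carrier U" using p pf right_bandD by auto
      have "s \<cdot> f = t \<cdot> f" using eq by (auto simp: pf tp)
      then have "(s \<cdot> f) \<cdot> e = (t \<cdot> f) \<cdot> e" by simp
      then show "s \<otimes>\<^bsub>grp\<^esub> e = t \<otimes>\<^bsub>grp\<^esub> e" using st f right_band_e[OF f(1)] by simp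
    qed (auto simp: tb tp right_bandD)
  qed
qed

text \<open>
  On a copy of the integers this is the module \<open>\<int>S/\<int>U\<close>, where \<open>S = U\<^sup>1\<close>.
\<close>
definition act0 :: "'a option \<Rightarrow> 'b frag \<Rightarrow> 'b frag" where
  "act0 s x = (if s = None then x else 0)"

lemma smodule_act0: "diff_closed M \<Longrightarrow> smodule (adjoin_one U) act0 M"
  unfolding smodule_def act0_def by (auto simp: additive_def diff_closed_def carrier_adjoin_one)

text \<open>
  The kernel of \<open>\<int>S \<rightarrow> \<int>S/\<int>U\<close>. As a left \<open>S\<close>-set, \<open>U\<close> is the disjoint union of its minimal left
  ideals \<open>Sf\<close>.
\<close>
lemma FP_semigroup_ideal:
  assumes fin: "finite right_band"
  shows "FP n (adjoin_one U) (Fr_act (adjoin_one U)) (frags ({0} \<times> Some ` carrier U))"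
proof -
  interpret S: monoid "adjoin_one U" by (rule monoid_S)
  let ?X = "{0 :: nat} \<times> Some ` carrier U"
  have act: "set_action (adjoin_one U) (free_act (adjoin_one U)) ?X"
    by (auto simp: set_action_def carrier_adjoin_one)
  show ?thesis
  proof (rule S.FP_projective_action[OF act fin, where x = "\<lambda>f. (0, Some f)" and e = Some])
    fix y assume "y \<in> ?X"
    then obtain u where u: "y = (0, Some u)" "u \<in> carrier U" by auto
    then show "\<exists>f\<in>right_band. \<exists>s\<in>carrier (adjoin_one U). y = free_act (adjoin_one U) s (0, Some f)"
      by (intro bexI[of _ "g u \<cdot> u"] bexI[of _ "Some u"]) (auto simp: coproj_in_right_band)
  next
    fix f h s t assume fh: "f \<in> right_band" "h \<in> right_band"
      and st: "s \<in> carrier (adjoin_one U)" "t \<in> carrier (adjoin_one U)"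
      and eq: "free_act (adjoin_one U) s (0, Some f) = free_act (adjoin_one U) t (0, Some h)"
    define val where "val s f = (case s of None \<Rightarrow> f | Some u \<Rightarrow> u \<cdot> f)" for s f
    have v: "s \<otimes>\<^bsub>adjoin_one U\<^esub> Some f = Some (val s f)" for s f
      by (cases s) (auto simp: val_def)
    have "g (val s f) \<cdot> val s f = f" if "f \<in> right_band" "s \<in> carrier (adjoin_one U)" for s f
      using that coproj_right_band coproj_mult[of f] right_bandD(1)
      by (cases s) (auto simp: val_def)
    moreover have "val s f = val t h" using eq by (simp add: v)
    ultimately show "f = h" using fh st by metis
  qed (auto dest: right_bandD simp: right_band_def)
qed

lemma FP_act0_singleton:
  fixes a :: 'b
  assumes fin: "finite right_band"
  shows "FP n (adjoin_one U) act0 (frags {a})"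
proof -
  let ?S = "adjoin_one U"
  interpret S: monoid ?S by (rule monoid_S)
  let ?\<phi> = "free_ext act0 (\<lambda>_. frag_of a)"
  have phi: "free_map ?S 1 act0 (frags {a}) ?\<phi>"
    by (rule S.equivariant_free_ext[OF smodule_act0[OF diff_closed_frags]]) simp
  have phi_of: "?\<phi> (frag_of (0, None)) = frag_of a" by (simp add: act0_def)
  let ?\<psi> = "frag_extend (\<lambda>_ :: 'b. frag_of (0 :: nat, None :: 'a option))"
  have "?\<phi> (?\<psi> y) = y" if "y \<in> frags {a}" for y
    by (rule additive_eq_on_frags[OF additive_comp[OF additive_free_ext additive_frag_extend] additive_id that])
      (auto simp: act0_def)
  moreover have "?\<psi> y \<in> Fr ?S 1" if "y \<in> frags {a}" for y
    by (rule additive_into[OF additive_frag_extend diff_closed_frags that]) simp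
  ultimately have onto: "?\<phi> ` Fr ?S 1 = frags {a}"
    using phi unfolding equivariant_def by force
  have ke: "ker (Fr ?S 1) ?\<phi> = frags ({0} \<times> Some ` carrier U)"
  proof -
    have split: "{..<1 :: nat} \<times> carrier ?S = {0} \<times> Some ` carrier U \<union> {(0, None)}"
      by (auto simp: carrier_adjoin_one)
    have psi_phi: "?\<psi> (?\<phi> x) = restrict_to {(0, None)} x" if "x \<in> Fr ?S 1" for x
      by (rule additive_eq_on_frags[OF additive_comp[OF additive_frag_extend additive_free_ext] additive_restrict_to that])
        (auto simp: act0_def carrier_adjoin_one)
    have "x \<in> frags ({0} \<times> Some ` carrier U)" if x: "x \<in> Fr ?S 1" "?\<phi> x = 0" for x
    proof (rule restrict_to_eq_0)
      show "x \<in> frags ({0} \<times> Some ` carrier U \<union> {(0, None)})" using x(1) unfolding split .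
      show "restrict_to {(0, None)} x = 0" using psi_phi[OF x(1)] x(2) by simp
    qed
    moreover have "?\<phi> x = 0" if "x \<in> frags ({0} \<times> Some ` carrier U)" for x
      by (rule additive_eq_on_frags[OF additive_free_ext additive_0 that]) (auto simp: act0_def)
    moreover have "frags ({0} \<times> Some ` carrier U) \<subseteq> Fr ?S 1"
      unfolding split by (auto simp: frags_def)
    ultimately show ?thesis by (auto simp: ker_def)
  qed
  show ?thesis
  proof (cases n)
    case 0
    show ?thesis unfolding 0 by (rule FP_0_intro[OF phi onto])
  next
    case (Suc m)
    show ?thesis unfolding Suc
      by (rule FP_Suc_intro[OF phi onto]) (simp only: ke FP_semigroup_ideal[OF fin])
  qed
qed

text \<open>
  Adding one basis element to \<open>A\<close> extends the kernel of the augmentation by a copy of the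
  integers with the annihilating action; a second element of \<open>A\<close> is needed to balance the new
  coordinate.
\<close>
lemma FP_act0_ker_aug:
  fixes A :: "'b set"
  assumes fin: "finite right_band" and A: "finite A" "A \<noteq> {}"
  shows "FP n (adjoin_one U) act0 (ker (frags A) aug)"
  using A
proof (induction A rule: finite_ne_induct)
  let ?S = "adjoin_one U"
  interpret S: monoid ?S by (rule monoid_S)
  case (singleton b)
  have "frag_extend (\<lambda>_. frag_of b) (aug x) = x" if "x \<in> frags {b}" for x
    by (rule additive_eq_on_frags[OF additive_comp[OF additive_frag_extend additive_aug] additive_id that]) simp
  then have "ker (frags {b}) aug = {0}"
    by (auto simp: ker_def additive.zero[OF additive_aug]) (metis frag_extend_0)
  then show ?case using S.FP_zero[OF smodule_act0[OF diff_closed_frags]] by simp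
next
  let ?S = "adjoin_one U"
  interpret S: monoid ?S by (rule monoid_S)
  case (insert a A)
  let ?N = "ker (frags (insert a A)) aug" and ?p = "restrict_to {a}"
  have N: "smodule ?S act0 ?N" and M: "smodule ?S act0 (frags {a})"
    by (intro smodule_act0 diff_closed_ker additive_aug diff_closed_frags)+
  obtain b where b: "b \<in> A" using insert by blast
  then have ba: "b \<noteq> a" using insert by blast
  have p_in: "?p x \<in> frags {a}" for x
    using lookup_restrict_to[of "{a}" x] by (auto simp: frags_def in_keys_iff split: if_splits)
  have p: "equivariant ?S act0 ?N act0 (frags {a}) ?p"
    unfolding equivariant_def using additive_restrict_to p_in
    by (auto simp: act0_def additive.zero[OF additive_restrict_to])
  have onto: "?p ` ?N = frags {a}"
  proof (intro equalityI subsetI)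
    fix y assume y: "y \<in> frags {a}"
    (* Moving a coefficient from b to a keeps the augmentation zero. *)
    let ?z = "frag_extend (\<lambda>_. frag_of a - frag_of b)"
    have "?z y \<in> frags (insert a A)"
      by (rule additive_into[OF additive_frag_extend diff_closed_frags y]) (simp add: diff_frags b)
    moreover have "aug (?z y) = 0"
      by (rule additive_eq_on_frags[OF additive_comp[OF additive_aug additive_frag_extend] additive_0 y])
        (simp add: additive.diff[OF additive_aug])
    moreover have "?p (?z y) = y"
      by (rule additive_eq_on_frags[OF additive_comp[OF additive_restrict_to additive_frag_extend] additive_id y])
        (simp add: additive.diff[OF additive_restrict_to] ba)
    ultimately show "y \<in> ?p ` ?N" by (intro rev_image_eqI[of "?z y"]) (simp_all add: ker_def)
  qed (use p_in in auto)
  have ke: "ker ?N ?p = ker (frags A) aug"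
  proof -
    have "x \<in> frags A" if "x \<in> frags (insert a A)" "?p x = 0" for x
      using restrict_to_eq_0[of x A "{a}"] that by simp
    moreover have "?p x = 0" "x \<in> frags (insert a A)" if "x \<in> frags A" for x
      using restrict_to_outside[OF that, of "{a}"] insert(3) that by (auto simp: frags_def)
    ultimately show ?thesis by (auto simp: ker_def)
  qed
  show ?case
    by (rule S.FP_extension[OF N M p onto]) (simp_all add: ke insert.IH FP_act0_singleton[OF fin])
qed

text \<open>
  In \<open>Ue\<close> every element is uniquely \<open>i h\<close> with \<open>i\<close> in the band and \<open>h\<close> in the group, and \<open>u i\<close>
  decomposes as \<open>(u \<cdot> g u) (e u i)\<close>. This defines the monomial representation whose transfer
  is \<open>M \<mapsto> \<int>(Ue) \<otimes> M\<close>.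
\<close>
lemma FPZ_adjoin_one_of_grp:
  assumes finL: "finite left_band" and finR: "finite right_band" and F: "FPZ n grp"
  shows "FPZ n (adjoin_one U)"
proof -
  let ?S = "adjoin_one U"
  interpret S: monoid ?S by (rule monoid_S)
  interpret G: group grp by (rule group_grp)
  let ?\<pi> = "\<lambda>s i. case s of None \<Rightarrow> i | Some u \<Rightarrow> u \<cdot> g u"
  let ?w = "\<lambda>s i. case s of None \<Rightarrow> e | Some u \<Rightarrow> e \<cdot> (u \<cdot> i)"
  have lbU: "i \<in> carrier U" if "i \<in> left_band" for i using that left_bandD by blast
  interpret R: monomial_rep grp ?S left_band ?\<pi> ?w
  proof unfold_locales
    show "?\<pi> (s \<otimes>\<^bsub>?S\<^esub> t) i = ?\<pi> s (?\<pi> t i)" if "s \<in> carrier ?S" "t \<in> carrier ?S" for s t i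
      using that proj_mult by (auto simp: carrier_adjoin_one simp del: assoc)
    show "?w (s \<otimes>\<^bsub>?S\<^esub> t) i = ?w s (?\<pi> t i) \<otimes>\<^bsub>grp\<^esub> ?w t i"
      if "s \<in> carrier ?S" "t \<in> carrier ?S" "i \<in> left_band" for s t i
      using that lbU[OF that(3)] left_bandD(3)[OF that(3)] by (auto simp: carrier_adjoin_one)
    show "?\<pi> s i \<in> left_band" "?w s i \<in> carrier grp" if "s \<in> carrier ?S" "i \<in> left_band" for s i
      using that lbU[OF that(2)] left_bandD(3)[OF that(2)] proj_in_left_band by (auto simp: carrier_adjoin_one)
  qed (rule finL)
  have tp: "R.tr_perm s (i, j, t) = (?\<pi> s i, j, ?w s i \<cdot> t)" for s i j t
    by (simp add: R.tr_perm_def)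
  have tb: "R.tr_basis k = left_band \<times> {..<k} \<times> carrier grp" for k
    by (auto simp: R.tr_basis_def tp)
  have e_left: "e \<in> left_band" by (simp add: left_band_def)
  have free: "FP n ?S (perm_act R.tr_perm) (frags (R.tr_basis k))" for n k
  proof (rule S.FP_projective_action[OF R.set_action_tr_perm, where J = "{..<k}"
        and x = "\<lambda>j. (e, j, e)" and e = "\<lambda>_. Some e"])
    fix y assume "y \<in> R.tr_basis k"
    then obtain i j h where y: "y = (i, j, h)" "i \<in> left_band" "j < k" "h \<in> carrier U" "e \<cdot> h = h" "h \<cdot> e = h"
      by (auto simp: tb)
    have i: "i \<in> carrier U" "e \<cdot> i = e" "i \<cdot> g i = i" using y lbU e_left_band proj_left_band by auto
    have "(i \<cdot> h) \<cdot> g (i \<cdot> h) = i" using proj_mult[OF i(1) y(4)] i(3) by simp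
    moreover have "e \<cdot> (i \<cdot> h) = h" using assoc[OF e_closed i(1) y(4)] i(2) y(5) by (simp del: assoc)
    ultimately have "y = R.tr_perm (Some (i \<cdot> h)) (e, j, e)"
      using y i(1) by (simp add: tp)
    then show "\<exists>j\<in>{..<k}. \<exists>s\<in>carrier ?S. y = R.tr_perm s (e, j, e)"
      using y i by (intro bexI[of _ j] bexI[of _ "Some (i \<cdot> h)"]) auto
  next
    fix j s t assume st: "s \<in> carrier ?S" "t \<in> carrier ?S"
      and eq: "R.tr_perm s (e, j, e) = R.tr_perm t (e, j, e)"
    (* The product s e is recovered from the first and third coordinates of s (e, j, e). *)
    have rec: "s \<otimes>\<^bsub>?S\<^esub> Some e = Some (?\<pi> s e \<cdot> (?w s e \<cdot> e))" if "s \<in> carrier ?S" for s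
      using that by (auto simp: carrier_adjoin_one)
    show "s \<otimes>\<^bsub>?S\<^esub> Some e = t \<otimes>\<^bsub>?S\<^esub> Some e"
      using eq unfolding tp rec[OF st(1)] rec[OF st(2)] by simp
  qed (auto simp: tb tp e_left proj_left_band)
  have pi1: "?\<pi> \<one>\<^bsub>?S\<^esub> i = i" for i by simp
  let ?N = "R.tr (\<lambda>_ x. x) (UNIV :: unit frag set)"
  have trN: "?N = frags (left_band \<times> UNIV)" by (rule R.tr_trivial) (rule pi1)
  have FN: "FP n ?S (R.tr_act (\<lambda>_ x. x)) ?N" if "FPZ n grp" for n
    by (rule R.FP_tr[OF smodule_trivial that]) (simp add: R.tr_free R.tr_act_free free)
  have ne: "left_band \<noteq> {}" using e_left by blast
  have "FP m ?S (R.tr_act (\<lambda>_ x. x)) (ker ?N aug)" for m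
  proof (rule FP_act_cong[where act = act0])
    show "FP m ?S act0 (ker ?N aug)"
      unfolding trN by (rule FP_act0_ker_aug[OF finR]) (use finL ne in auto)
    fix s x assume s: "s \<in> carrier ?S" and x: "x \<in> ker ?N aug"
    then have xf: "x \<in> frags (left_band \<times> (UNIV :: unit set))" and ax: "aug x = 0"
      by (auto simp: ker_def trN)
    show "act0 s x = R.tr_act (\<lambda>_ x. x) s x"
    proof (cases s)
      case None
      then show ?thesis using x by (simp add: act0_def ker_def R.tr_def)
    next
      case (Some u)
      have "R.tr_act (\<lambda>_ x. x) s x = inj_at (u \<cdot> g u) (aug x)"
        unfolding R.tr_act_trivial
        by (rule additive_eq_on_frags[OF additive_perm_act additive_comp[OF additive_inj_at additive_aug] xf])
          (auto simp: Some)
      then show ?thesis by (simp add: act0_def Some ax additive.zero[OF additive_inj_at])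
    qed
  qed
  note K = this
  note onto = R.equivariant_aug[OF pi1] R.aug_onto[OF pi1 ne]
  show ?thesis
  proof (cases n)
    case 0
    show ?thesis using S.FP_0_image[OF FN[of 0] onto] F unfolding 0 by simp
  next
    case (Suc m)
    show ?thesis unfolding Suc
      by (rule S.FP_quotient[OF R.smodule_tr[OF smodule_trivial] smodule_trivial onto K FN])
        (use F Suc in simp)
  qed
qed

end

section \<open>The monoid ring\<close>

lemma monoid_ring_simps [simp]:
  "carrier (monoid_ring S) = frags (carrier S)"
  "\<one>\<^bsub>monoid_ring S\<^esub> = frag_of \<one>\<^bsub>S\<^esub>" "\<zero>\<^bsub>monoid_ring S\<^esub> = 0" "a \<oplus>\<^bsub>monoid_ring S\<^esub> b = a + b"
  by (simp_all add: monoid_ring_def frags_def)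

lemma monoid_ring_mult_of [simp]:
  "frag_of s \<otimes>\<^bsub>monoid_ring S\<^esub> frag_of t = frag_of (s \<otimes>\<^bsub>S\<^esub> t)"
  by (simp add: monoid_ring_def)

lemma frag_extend_plus: "frag_extend (\<lambda>s. f s + h s) a = frag_extend f a + frag_extend h a"
  by (rule additive_eq[OF additive_frag_extend]) (simp_all add: additive_def frag_extend_add)

lemma additive_monoid_ring_mult:
  "additive (\<lambda>a. a \<otimes>\<^bsub>monoid_ring S\<^esub> b)" "additive (\<lambda>b. a \<otimes>\<^bsub>monoid_ring S\<^esub> b)"
  by (simp_all add: monoid_ring_def additive_def frag_extend_add frag_extend_plus)

lemma monoid_ring_op: "monoid_ring (op_monoid S) = opposite_ring (monoid_ring S)"
proof -
  have "a \<otimes>\<^bsub>monoid_ring (op_monoid S)\<^esub> b = b \<otimes>\<^bsub>monoid_ring S\<^esub> a" for a b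
  proof (rule additive_eq[OF additive_monoid_ring_mult(1) additive_monoid_ring_mult(2)])
    fix s show "frag_of s \<otimes>\<^bsub>monoid_ring (op_monoid S)\<^esub> b = b \<otimes>\<^bsub>monoid_ring S\<^esub> frag_of s"
      by (rule additive_eq[OF additive_monoid_ring_mult(2) additive_monoid_ring_mult(1)]) simp
  qed
  then have "mult (monoid_ring (op_monoid S)) = (\<lambda>a b. b \<otimes>\<^bsub>monoid_ring S\<^esub> a)" by (intro ext)
  then show ?thesis by (simp add: monoid_ring_def opposite_ring_def)
qed

lemma right_FP_op: "right_FP n S \<longleftrightarrow> left_FP n (op_monoid S)"
  by (simp add: left_FP_def right_FP_def monoid_ring_op)

lemma augmentation_aug: "augmentation a = Poly_Mapping.lookup (aug a) ()"
proof -
  have "Poly_Mapping.lookup (\<Sum>i\<in>I. frag_cmul (Poly_Mapping.lookup a i) (frag_of ())) () = (\<Sum>i\<in>I. Poly_Mapping.lookup a i)" for I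
    by (induction I rule: infinite_finite_induct) (simp_all add: lookup_add)
  then show ?thesis by (simp add: augmentation_def aug_def frag_extend_def)
qed

lemma augmentation_add: "augmentation (a + b) = augmentation a + augmentation b"
  by (simp add: augmentation_aug additive.add[OF additive_aug] lookup_add)

lemma augmentation_of [simp]: "augmentation (frag_of s) = 1"
  by (simp add: augmentation_aug)

lemma additive_cmul_aug: "additive (\<lambda>x. frag_cmul (f x) c)" if "\<And>x y. f (x + y) = f x + f y"
  using that by (simp add: additive_def frag_cmul_distrib)

lemma augmentation_mult: "augmentation (a \<otimes>\<^bsub>monoid_ring S\<^esub> b) = augmentation a * augmentation b"
proof -
  have "frag_cmul (augmentation (a \<otimes>\<^bsub>monoid_ring S\<^esub> b)) (frag_of ()) = frag_cmul (augmentation a * augmentation b) (frag_of ())"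
  proof (rule additive_eq[of _ _ a])
    fix s show "frag_cmul (augmentation (frag_of s \<otimes>\<^bsub>monoid_ring S\<^esub> b)) (frag_of ()) =
        frag_cmul (augmentation (frag_of s) * augmentation b) (frag_of ())"
      by (rule additive_eq[of _ _ b])
        (auto intro!: additive_cmul_aug simp: augmentation_add additive.add[OF additive_monoid_ring_mult(2)] algebra_simps)
  qed (auto intro!: additive_cmul_aug simp: augmentation_add additive.add[OF additive_monoid_ring_mult(1)] algebra_simps)
  then have "Poly_Mapping.lookup (frag_cmul (augmentation (a \<otimes>\<^bsub>monoid_ring S\<^esub> b)) (frag_of ())) () =
    Poly_Mapping.lookup (frag_cmul (augmentation a * augmentation b) (frag_of ())) ()" by simp
  then show ?thesis by simp
qed

context monoid
begin

lemma monoid_ring_mult_closed: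
  assumes "a \<in> frags (carrier G)" "b \<in> frags (carrier G)"
  shows "a \<otimes>\<^bsub>monoid_ring G\<^esub> b \<in> frags (carrier G)"
proof (rule additive_into[OF additive_monoid_ring_mult(1) diff_closed_frags assms(1)])
  fix s assume s: "s \<in> carrier G"
  show "frag_of s \<otimes>\<^bsub>monoid_ring G\<^esub> b \<in> frags (carrier G)"
    by (rule additive_into[OF additive_monoid_ring_mult(2) diff_closed_frags assms(2)]) (use s in simp)
qed

lemma monoid_ring_assoc:
  assumes "a \<in> frags (carrier G)" "b \<in> frags (carrier G)" "c \<in> frags (carrier G)"
  shows "(a \<otimes>\<^bsub>monoid_ring G\<^esub> b) \<otimes>\<^bsub>monoid_ring G\<^esub> c = a \<otimes>\<^bsub>monoid_ring G\<^esub> (b \<otimes>\<^bsub>monoid_ring G\<^esub> c)"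
proof (rule additive_eq_on_frags[OF _ additive_monoid_ring_mult(1) assms(1)])
  show "additive (\<lambda>a. (a \<otimes>\<^bsub>monoid_ring G\<^esub> b) \<otimes>\<^bsub>monoid_ring G\<^esub> c)"
    by (rule additive_comp[OF additive_monoid_ring_mult(1) additive_monoid_ring_mult(1)])
  fix s assume s: "s \<in> carrier G"
  show "(frag_of s \<otimes>\<^bsub>monoid_ring G\<^esub> b) \<otimes>\<^bsub>monoid_ring G\<^esub> c = frag_of s \<otimes>\<^bsub>monoid_ring G\<^esub> (b \<otimes>\<^bsub>monoid_ring G\<^esub> c)"
  proof (rule additive_eq_on_frags[OF _ _ assms(2)])
    show "additive (\<lambda>b. (frag_of s \<otimes>\<^bsub>monoid_ring G\<^esub> b) \<otimes>\<^bsub>monoid_ring G\<^esub> c)"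
      by (rule additive_comp[OF additive_monoid_ring_mult(1) additive_monoid_ring_mult(2)])
    show "additive (\<lambda>b. frag_of s \<otimes>\<^bsub>monoid_ring G\<^esub> (b \<otimes>\<^bsub>monoid_ring G\<^esub> c))"
      by (rule additive_comp[OF additive_monoid_ring_mult(2) additive_monoid_ring_mult(1)])
    fix t assume t: "t \<in> carrier G"
    show "(frag_of s \<otimes>\<^bsub>monoid_ring G\<^esub> frag_of t) \<otimes>\<^bsub>monoid_ring G\<^esub> c = frag_of s \<otimes>\<^bsub>monoid_ring G\<^esub> (frag_of t \<otimes>\<^bsub>monoid_ring G\<^esub> c)"
      by (rule additive_eq_on_frags[OF additive_monoid_ring_mult(2)
            additive_comp[OF additive_monoid_ring_mult(2) additive_monoid_ring_mult(2)] assms(3)])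
        (use s t in \<open>simp add: m_assoc\<close>)
  qed
qed

lemma ring_monoid_ring: "ring (monoid_ring G)"
proof (rule ringI)
  show "abelian_group (monoid_ring G)"
  proof (rule abelian_groupI)
    fix x assume "x \<in> carrier (monoid_ring G)"
    then show "\<exists>y\<in>carrier (monoid_ring G). y \<oplus>\<^bsub>monoid_ring G\<^esub> x = \<zero>\<^bsub>monoid_ring G\<^esub>"
      by (intro bexI[of _ "- x"]) (auto simp: frags_def)
  qed (auto simp: diff_closed_add[OF diff_closed_frags] algebra_simps)
  show "monoid (monoid_ring G)"
  proof (rule monoidI)
    fix x assume "x \<in> carrier (monoid_ring G)"
    then have x: "x \<in> frags (carrier G)" by simp
    show "\<one>\<^bsub>monoid_ring G\<^esub> \<otimes>\<^bsub>monoid_ring G\<^esub> x = x"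
      by (simp, rule additive_eq_on_frags[OF additive_monoid_ring_mult(2) additive_id x]) simp
    show "x \<otimes>\<^bsub>monoid_ring G\<^esub> \<one>\<^bsub>monoid_ring G\<^esub> = x"
      by (simp, rule additive_eq_on_frags[OF additive_monoid_ring_mult(1) additive_id x]) simp
  qed (auto simp: monoid_ring_mult_closed monoid_ring_assoc)
qed (auto simp: additive.add[OF additive_monoid_ring_mult(1)] additive.add[OF additive_monoid_ring_mult(2)])

lemma left_module_trivial: "left_module (monoid_ring G) trivial_module"
proof -
  interpret R: ring "monoid_ring G" by (rule ring_monoid_ring)
  have "abelian_group trivial_module"
  proof (rule abelian_groupI)
    fix x :: int
    show "\<exists>y\<in>carrier trivial_module. y \<oplus>\<^bsub>trivial_module\<^esub> x = \<zero>\<^bsub>trivial_module\<^esub>"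
      by (intro bexI[of _ "- x"]) (auto simp: trivial_module_def)
  qed (auto simp: trivial_module_def)
  then show ?thesis
    by (intro left_module.intro left_module_axioms.intro R.ring_axioms)
      (auto simp: trivial_module_def augmentation_add augmentation_mult algebra_simps)
qed

end

context left_module
begin

lemma lsmult_zero_left: "x \<in> carrier M \<Longrightarrow> \<zero>\<^bsub>R\<^esub> \<odot>\<^bsub>M\<^esub> x = \<zero>\<^bsub>M\<^esub>"
  using lsmult_l_distr[of "\<zero>\<^bsub>R\<^esub>" "\<zero>\<^bsub>R\<^esub>" x] lsmult_closed[of "\<zero>\<^bsub>R\<^esub>" x] M.add.l_cancel_one' by simp

lemma lsmult_zero_right: "a \<in> carrier R \<Longrightarrow> a \<odot>\<^bsub>M\<^esub> \<zero>\<^bsub>M\<^esub> = \<zero>\<^bsub>M\<^esub>"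
  using lsmult_r_distr[of a "\<zero>\<^bsub>M\<^esub>" "\<zero>\<^bsub>M\<^esub>"] lsmult_closed[of a "\<zero>\<^bsub>M\<^esub>"] M.add.l_cancel_one' by simp

lemma lsmult_finsum:
  assumes "a \<in> carrier R" "f \<in> I \<rightarrow> carrier M"
  shows "a \<odot>\<^bsub>M\<^esub> (\<Oplus>\<^bsub>M\<^esub>i\<in>I. f i) = (\<Oplus>\<^bsub>M\<^esub>i\<in>I. a \<odot>\<^bsub>M\<^esub> f i)"
  using assms(2)
proof (induction I rule: infinite_finite_induct)
  case (insert x F)
  then have "f \<in> F \<rightarrow> carrier M" "f x \<in> carrier M" by auto
  moreover have "(\<lambda>i. a \<odot>\<^bsub>M\<^esub> f i) \<in> F \<rightarrow> carrier M" using insert assms(1) lsmult_closed by auto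
  ultimately show ?case using insert assms(1) by (simp add: lsmult_r_distr lsmult_closed)
qed (simp_all add: lsmult_zero_right assms(1))

lemma finsum_in:
  assumes "I \<subseteq> carrier M" "\<zero>\<^bsub>M\<^esub> \<in> I" "\<And>x y. x \<in> I \<Longrightarrow> y \<in> I \<Longrightarrow> x \<oplus>\<^bsub>M\<^esub> y \<in> I"
    and "\<And>i. i \<in> F \<Longrightarrow> f i \<in> I"
  shows "(\<Oplus>\<^bsub>M\<^esub>i\<in>F. f i) \<in> I"
  using assms(4)
proof (induction F rule: infinite_finite_induct)
  case (insert x F)
  have "f \<in> F \<rightarrow> carrier M" "f x \<in> carrier M" using insert.prems assms(1) by auto
  then show ?case using insert assms(3) by simp
qed (simp_all add: assms(2))

end

section \<open>Free modules over a monoid ring in coordinates\<close>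

text \<open>
  An isomorphism between a subgroup of a free abelian group with \<open>S\<close>-action and a module over
  the monoid ring of \<open>S\<close>.
\<close>
definition lin_iso :: "('a, 'x) monoid_scheme \<Rightarrow> ('a \<Rightarrow> 'b frag \<Rightarrow> 'b frag) \<Rightarrow> 'b frag set \<Rightarrow>
    ('a frag, 'm) module \<Rightarrow> ('b frag \<Rightarrow> 'm) \<Rightarrow> bool" where
  "lin_iso S act P A \<psi> \<longleftrightarrow> bij_betw \<psi> P (carrier A) \<and>
     (\<forall>x\<in>P. \<forall>y\<in>P. \<psi> (x + y) = \<psi> x \<oplus>\<^bsub>A\<^esub> \<psi> y) \<and>
     (\<forall>s\<in>carrier S. \<forall>x\<in>P. \<psi> (act s x) = frag_of s \<odot>\<^bsub>A\<^esub> \<psi> x)"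

lemma lin_isoD:
  assumes "lin_iso S act P A \<psi>"
  shows "bij_betw \<psi> P (carrier A)" "inj_on \<psi> P" "\<psi> ` P = carrier A"
    and "x \<in> P \<Longrightarrow> \<psi> x \<in> carrier A"
    and "x \<in> P \<Longrightarrow> y \<in> P \<Longrightarrow> \<psi> (x + y) = \<psi> x \<oplus>\<^bsub>A\<^esub> \<psi> y"
    and "s \<in> carrier S \<Longrightarrow> x \<in> P \<Longrightarrow> \<psi> (act s x) = frag_of s \<odot>\<^bsub>A\<^esub> \<psi> x"
  using assms by (auto simp: lin_iso_def bij_betw_def)

lemma lin_iso_zero:
  assumes "lin_iso S act P A \<psi>" "diff_closed P" "abelian_group A"
  shows "\<psi> 0 = \<zero>\<^bsub>A\<^esub>"
proof -
  interpret A: abelian_group A by (rule assms(3))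
  have "0 \<in> P" using assms(2) by (simp add: diff_closed_def)
  then have "\<psi> 0 \<in> carrier A" "\<psi> 0 \<oplus>\<^bsub>A\<^esub> \<psi> 0 = \<psi> 0"
    using lin_isoD(4)[OF assms(1)] lin_isoD(5)[OF assms(1), of 0 0] by simp_all
  then show ?thesis using A.add.l_cancel_one' by simp
qed

text \<open>
  Linearity over the monoid ring follows from additivity and compatibility with the elements
  of the monoid, since these span the ring.
\<close>
lemma (in monoid) linear_mapsI:
  assumes A: "left_module (monoid_ring G) A" and B: "left_module (monoid_ring G) B"
    and f: "f \<in> carrier A \<rightarrow> carrier B"
    and add: "\<And>x y. x \<in> carrier A \<Longrightarrow> y \<in> carrier A \<Longrightarrow> f (x \<oplus>\<^bsub>A\<^esub> y) = f x \<oplus>\<^bsub>B\<^esub> f y"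
    and act: "\<And>s x. s \<in> carrier G \<Longrightarrow> x \<in> carrier A \<Longrightarrow> f (frag_of s \<odot>\<^bsub>A\<^esub> x) = frag_of s \<odot>\<^bsub>B\<^esub> f x"
  shows "f \<in> linear_maps (monoid_ring G) A B"
proof -
  interpret A: left_module "monoid_ring G" A by (rule A)
  interpret B: left_module "monoid_ring G" B by (rule B)
  have f0: "f \<zero>\<^bsub>A\<^esub> = \<zero>\<^bsub>B\<^esub>"
    using add[of "\<zero>\<^bsub>A\<^esub>" "\<zero>\<^bsub>A\<^esub>"] f B.M.add.l_cancel_one'[of "f \<zero>\<^bsub>A\<^esub>" "f \<zero>\<^bsub>A\<^esub>"] by auto
  have "f (a \<odot>\<^bsub>A\<^esub> x) = a \<odot>\<^bsub>B\<^esub> f x" if a: "a \<in> frags (carrier G)" and x: "x \<in> carrier A" for a x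
  proof -
    have fx: "f x \<in> carrier B" using f x by blast
    have "Poly_Mapping.keys a \<subseteq> carrier G" using a by (simp add: frags_def)
    then have "a \<in> frags (carrier G) \<and> f (a \<odot>\<^bsub>A\<^esub> x) = a \<odot>\<^bsub>B\<^esub> f x"
    proof (induction a rule: frag_induction)
      case zero
      then show ?case using A.lsmult_zero_left[OF x] B.lsmult_zero_left[OF fx] f0 by simp
    next
      case (one s)
      then show ?case using act x by simp
    next
      case (diff a b)
      then have ab: "a \<in> frags (carrier G)" "b \<in> frags (carrier G)" "a - b \<in> frags (carrier G)"
        by (auto simp: diff_frags)
      have xs: "(a - b) \<odot>\<^bsub>A\<^esub> x \<in> carrier A" "b \<odot>\<^bsub>A\<^esub> x \<in> carrier A" "(a - b) \<odot>\<^bsub>B\<^esub> f x \<in> carrier B" "b \<odot>\<^bsub>B\<^esub> f x \<in> carrier B"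
        using ab x fx A.lsmult_closed B.lsmult_closed by auto
      have "f ((a - b) \<odot>\<^bsub>A\<^esub> x) \<oplus>\<^bsub>B\<^esub> f (b \<odot>\<^bsub>A\<^esub> x) = f (a \<odot>\<^bsub>A\<^esub> x)"
        using add[OF xs(1,2)] A.lsmult_l_distr[of "a - b" b x] ab x by simp
      moreover have "(a - b) \<odot>\<^bsub>B\<^esub> f x \<oplus>\<^bsub>B\<^esub> b \<odot>\<^bsub>B\<^esub> f x = a \<odot>\<^bsub>B\<^esub> f x"
        using B.lsmult_l_distr[of "a - b" b "f x"] ab fx by simp
      ultimately have "f ((a - b) \<odot>\<^bsub>A\<^esub> x) \<oplus>\<^bsub>B\<^esub> b \<odot>\<^bsub>B\<^esub> f x = (a - b) \<odot>\<^bsub>B\<^esub> f x \<oplus>\<^bsub>B\<^esub> b \<odot>\<^bsub>B\<^esub> f x"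
        using diff by simp
      moreover have "f ((a - b) \<odot>\<^bsub>A\<^esub> x) \<in> carrier B" using f xs(1) by blast
      ultimately show ?case using B.M.add.right_cancel xs ab by simp
    qed
    then show ?thesis by simp
  qed
  then show ?thesis using f add by (auto simp: linear_maps_def)
qed

text \<open>
  A linear map between modules, read through the isomorphisms, is a priori defined and
  additive on \<open>frags X\<close> only. As this group is free on \<open>X\<close>, the map extends to one that is
  additive on the whole ambient group.
\<close>
lemma lift_to_frags:
  assumes P: "lin_iso S actP (frags X) A \<psi>" and Q: "lin_iso S actQ Q B \<chi>"
    and smP: "smodule S actP (frags X)" and smQ: "smodule S actQ Q"
    and ab: "abelian_group A" "abelian_group B"
    and f: "f \<in> linear_maps (monoid_ring S) A B"
  shows "\<exists>D. equivariant S actP (frags X) actQ Q D \<and> (\<forall>x\<in>frags X. \<chi> (D x) = f (\<psi> x))"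
proof -
  interpret A: abelian_group A by (rule ab)
  interpret B: abelian_group B by (rule ab)
  have dQ: "diff_closed Q" using smQ by (simp add: smodule_def)
  have f_in: "\<And>x. x \<in> carrier A \<Longrightarrow> f x \<in> carrier B"
    and f_add: "\<And>x y. x \<in> carrier A \<Longrightarrow> y \<in> carrier A \<Longrightarrow> f (x \<oplus>\<^bsub>A\<^esub> y) = f x \<oplus>\<^bsub>B\<^esub> f y"
    and f_act: "\<And>s x. s \<in> carrier S \<Longrightarrow> x \<in> carrier A \<Longrightarrow> f (frag_of s \<odot>\<^bsub>A\<^esub> x) = frag_of s \<odot>\<^bsub>B\<^esub> f x"
    using f by (auto simp: linear_maps_def)
  have f0: "f \<zero>\<^bsub>A\<^esub> = \<zero>\<^bsub>B\<^esub>"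
    using f_add[of "\<zero>\<^bsub>A\<^esub>" "\<zero>\<^bsub>A\<^esub>"] f_in[of "\<zero>\<^bsub>A\<^esub>"] B.add.l_cancel_one'[of "f \<zero>\<^bsub>A\<^esub>" "f \<zero>\<^bsub>A\<^esub>"] by simp
  have "\<exists>q\<in>Q. \<chi> q = f (\<psi> (frag_of b))" if "b \<in> X" for b
  proof -
    have "f (\<psi> (frag_of b)) \<in> \<chi> ` Q"
      using lin_isoD(3)[OF Q] f_in lin_isoD(4)[OF P, of "frag_of b"] that by simp
    then show ?thesis by (metis imageE)
  qed
  then obtain v where v: "\<And>b. b \<in> X \<Longrightarrow> v b \<in> Q" "\<And>b. b \<in> X \<Longrightarrow> \<chi> (v b) = f (\<psi> (frag_of b))" by metis
  define D where "D = frag_extend v"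
  have addD: "additive D" by (simp add: D_def additive_frag_extend)
  have "x \<in> frags X \<and> D x \<in> Q \<and> \<chi> (D x) = f (\<psi> x)" if "Poly_Mapping.keys x \<subseteq> X" for x
    using that
  proof (induction x rule: frag_induction)
    case zero
    show ?case using dQ lin_iso_zero[OF P diff_closed_frags ab(1)] lin_iso_zero[OF Q dQ ab(2)] f0
      by (simp add: additive.zero[OF addD] diff_closed_def)
  next
    case (one b)
    then show ?case using v by (simp add: D_def)
  next
    case (diff a b)
    have ab: "a - b \<in> frags X" "D a - D b \<in> Q" using diff dQ by (auto simp: diff_frags diff_closed_def)
    have "\<chi> (D a - D b) \<oplus>\<^bsub>B\<^esub> \<chi> (D b) = \<chi> (D a)"
      using lin_isoD(5)[OF Q ab(2), of "D b"] diff by simp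
    moreover have "f (\<psi> (a - b)) \<oplus>\<^bsub>B\<^esub> f (\<psi> b) = f (\<psi> a)"
      using lin_isoD(5)[OF P ab(1), of b] f_add[of "\<psi> (a - b)" "\<psi> b"] lin_isoD(4)[OF P] ab diff by simp
    ultimately have "\<chi> (D a - D b) \<oplus>\<^bsub>B\<^esub> f (\<psi> b) = f (\<psi> (a - b)) \<oplus>\<^bsub>B\<^esub> f (\<psi> b)" using diff by simp
    moreover have "\<chi> (D a - D b) \<in> carrier B" "f (\<psi> (a - b)) \<in> carrier B" "f (\<psi> b) \<in> carrier B"
      using lin_isoD(4)[OF P] lin_isoD(4)[OF Q] f_in ab diff by auto
    ultimately show ?case using ab B.add.right_cancel by (simp add: additive.diff[OF addD])
  qed
  then have D: "D x \<in> Q" "\<chi> (D x) = f (\<psi> x)" if "x \<in> frags X" for x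
    using that by (auto simp: frags_def)
  have "D (actP s x) = actQ s (D x)" if s: "s \<in> carrier S" and x: "x \<in> frags X" for s x
  proof (rule inj_onD[OF lin_isoD(2)[OF Q]])
    have sx: "actP s x \<in> frags X" using smP s x by (simp add: smodule_def)
    show "D (actP s x) \<in> Q" by (rule D(1)[OF sx])
    show "actQ s (D x) \<in> Q" using smQ s D(1)[OF x] by (simp add: smodule_def)
    show "\<chi> (D (actP s x)) = \<chi> (actQ s (D x))"
      using D(2)[OF sx] lin_isoD(6)[OF P s x] f_act[OF s lin_isoD(4)[OF P x]]
        lin_isoD(6)[OF Q s D(1)[OF x]] D(2)[OF x] by simp
  qed
  then show ?thesis using addD D unfolding equivariant_def by blast
qed

lemma (in monoid) lower_from_frags:
  assumes P: "lin_iso G actP P A \<psi>" and Q: "lin_iso G actQ Q B \<chi>"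
    and smP: "smodule G actP P"
    and A: "left_module (monoid_ring G) A" and B: "left_module (monoid_ring G) B"
    and D: "equivariant G actP P actQ Q D"
  shows "\<exists>f. f \<in> linear_maps (monoid_ring G) A B \<and> (\<forall>x\<in>P. f (\<psi> x) = \<chi> (D x))"
proof -
  define f where "f = (\<lambda>y. \<chi> (D (inv_into P \<psi> y)))"
  have f: "f (\<psi> x) = \<chi> (D x)" if "x \<in> P" for x
    using inv_into_f_f[OF lin_isoD(2)[OF P] that] by (simp add: f_def)
  have repr: "\<exists>x\<in>P. y = \<psi> x" if "y \<in> carrier A" for y
    using that lin_isoD(3)[OF P] by blast
  have addD: "additive D" and DQ: "\<And>x. x \<in> P \<Longrightarrow> D x \<in> Q"
    and Dact: "\<And>s x. s \<in> carrier G \<Longrightarrow> x \<in> P \<Longrightarrow> D (actP s x) = actQ s (D x)"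
    using D by (auto simp: equivariant_def)
  have dP: "diff_closed P" using smP by (simp add: smodule_def)
  have "f \<in> linear_maps (monoid_ring G) A B"
  proof (rule linear_mapsI[OF A B])
    show "f \<in> carrier A \<rightarrow> carrier B"
      using repr f DQ lin_isoD(4)[OF Q] by fastforce
    fix y assume "y \<in> carrier A"
    then obtain x where x: "x \<in> P" "y = \<psi> x" using repr by blast
    show "f (frag_of s \<odot>\<^bsub>A\<^esub> y) = frag_of s \<odot>\<^bsub>B\<^esub> f y" if s: "s \<in> carrier G" for s
    proof -
      have "actP s x \<in> P" using smP s x by (simp add: smodule_def)
      then show ?thesis
        using lin_isoD(6)[OF P s x(1)] f[of "actP s x"] Dact[OF s x(1)] lin_isoD(6)[OF Q s DQ[OF x(1)]] f[OF x(1)] x(2)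
        by simp
    qed
    fix y' assume "y' \<in> carrier A"
    then obtain x' where x': "x' \<in> P" "y' = \<psi> x'" using repr by blast
    have "x + x' \<in> P" using dP x x' diff_closed_add by blast
    then show "f (y \<oplus>\<^bsub>A\<^esub> y') = f y \<oplus>\<^bsub>B\<^esub> f y'"
      using lin_isoD(5)[OF P x(1) x'(1)] f[of "x + x'"] lin_isoD(5)[OF Q DQ[OF x(1)] DQ[OF x'(1)]]
        f[OF x(1)] f[OF x'(1)] x(2) x'(2) by (simp add: additive.add[OF addD])
  qed
  then show ?thesis using f by blast
qed

lemma (in monoid) slice_Fr_act:
  assumes "x \<in> Fr G k" "s \<in> carrier G"
  shows "slice j (Fr_act G s x) = frag_of s \<otimes>\<^bsub>monoid_ring G\<^esub> slice j x"
  by (rule additive_eq_on_frags[OF additive_comp[OF additive_slice additive_perm_act]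
        additive_comp[OF additive_monoid_ring_mult(2) additive_slice] assms(1)])
    (auto simp: additive.zero[OF additive_monoid_ring_mult(2)])

lemma ex_slices:
  fixes c :: "nat \<Rightarrow> 'a frag"
  assumes "\<And>j. j < k \<Longrightarrow> c j \<in> frags X"
  shows "\<exists>x\<in>frags ({..<k} \<times> X). \<forall>j<k. slice j x = c j"
proof (intro bexI[of _ "\<Sum>i<k. inj_at i (c i)"] allI impI)
  show "(\<Sum>i<k. inj_at i (c i)) \<in> frags ({..<k} \<times> X)"
    by (rule diff_closed_sum[OF diff_closed_frags]) (simp add: inj_at_in assms)
  fix j assume "j < k"
  have "slice j (\<Sum>i<k. inj_at i (c i)) = (\<Sum>i<k. if i = j then c i else 0)"
    by (simp add: additive.sum[OF additive_slice] slice_inj_at)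
  also have "\<dots> = c j" using \<open>j < k\<close> by simp
  finally show "slice j (\<Sum>i<k. inj_at i (c i)) = c j" .
qed

lemma slices_zero:
  assumes "x \<in> frags ({..<k :: nat} \<times> X)" "\<And>j. j < k \<Longrightarrow> slice j x = 0"
  shows "x = 0"
proof -
  have "(\<Sum>i<k. inj_at i (slice i x)) = 0"
    by (rule sum.neutral) (simp add: assms(2) additive.zero[OF additive_inj_at])
  then show ?thesis using sum_slices[OF _ assms(1)] by simp
qed

lemma independent_subset:
  assumes "independent R A B" "X \<subseteq> B"
  shows "independent R A X"
  unfolding independent_def
proof (intro conjI allI impI)
  show "X \<subseteq> carrier A" using assms by (auto simp: independent_def)
  fix F c
  assume *: "finite F \<and> F \<subseteq> X \<and> c \<in> F \<rightarrow> carrier R \<and> (\<Oplus>\<^bsub>A\<^esub>x\<in>F. c x \<odot>\<^bsub>A\<^esub> x) = \<zero>\<^bsub>A\<^esub>"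
  then have "F \<subseteq> B" using assms(2) by blast
  then show "\<forall>x\<in>F. c x = \<zero>\<^bsub>R\<^esub>"
    using * assms(1)[unfolded independent_def, THEN conjunct2, rule_format, of F c] by blast
qed

definition lsubmodule :: "('r, 'x) ring_scheme \<Rightarrow> ('r, 'm, 'y) module_scheme \<Rightarrow> 'm set \<Rightarrow> bool" where
  "lsubmodule R A I \<longleftrightarrow> I \<subseteq> carrier A \<and> \<zero>\<^bsub>A\<^esub> \<in> I \<and> (\<forall>x\<in>I. \<forall>y\<in>I. x \<oplus>\<^bsub>A\<^esub> y \<in> I) \<and>
     (\<forall>a\<in>carrier R. \<forall>x\<in>I. a \<odot>\<^bsub>A\<^esub> x \<in> I)"

text \<open>
  A basis of a finitely generated free module may a priori be infinite. The basis elements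
  that occur in finitely many generators already generate, and they are still independent.
  Stating generation as a closure property spares the rearrangement of iterated sums.
\<close>
lemma finite_basis:
  assumes A: "left_module R A" and fg: "finitely_generated R A" and fr: "free R A"
  shows "\<exists>X. finite X \<and> X \<subseteq> carrier A \<and> independent R A X \<and>
    (\<forall>I. lsubmodule R A I \<longrightarrow> X \<subseteq> I \<longrightarrow> I = carrier A)"
proof -
  interpret left_module R A by (rule A)
  obtain Y where Y: "finite Y" "generates R A Y" using fg by (auto simp: finitely_generated_def)
  obtain B where B: "generates R A B" "independent R A B" using fr by (auto simp: free_def)
  have "\<forall>y\<in>Y. \<exists>F. finite F \<and> F \<subseteq> B \<and> (\<exists>c. c \<in> F \<rightarrow> carrier R \<and> y = (\<Oplus>\<^bsub>A\<^esub>x\<in>F. c x \<odot>\<^bsub>A\<^esub> x))"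
  proof
    fix y assume "y \<in> Y"
    then have "y \<in> carrier A" using Y(2) by (auto simp: generates_def)
    then show "\<exists>F. finite F \<and> F \<subseteq> B \<and> (\<exists>c. c \<in> F \<rightarrow> carrier R \<and> y = (\<Oplus>\<^bsub>A\<^esub>x\<in>F. c x \<odot>\<^bsub>A\<^esub> x))"
      using B(1) unfolding generates_def by blast
  qed
  from bchoice[OF this] obtain F where
    F: "\<forall>y\<in>Y. finite (F y) \<and> F y \<subseteq> B \<and> (\<exists>c. c \<in> F y \<rightarrow> carrier R \<and> y = (\<Oplus>\<^bsub>A\<^esub>x\<in>F y. c x \<odot>\<^bsub>A\<^esub> x))" ..
  let ?X = "\<Union>y\<in>Y. F y"
  have XB: "?X \<subseteq> B" using F by blast
  show ?thesis
  proof (intro exI[of _ ?X] conjI allI impI)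
    show "finite ?X" using Y(1) F by blast
    show "?X \<subseteq> carrier A" using XB B(1) by (auto simp: generates_def)
    show "independent R A ?X" by (rule independent_subset[OF B(2) XB])
    fix I assume sub: "lsubmodule R A I" and XI: "?X \<subseteq> I"
    have I: "I \<subseteq> carrier A" "\<zero>\<^bsub>A\<^esub> \<in> I" "\<And>x y. x \<in> I \<Longrightarrow> y \<in> I \<Longrightarrow> x \<oplus>\<^bsub>A\<^esub> y \<in> I"
      and act: "\<And>a x. a \<in> carrier R \<Longrightarrow> x \<in> I \<Longrightarrow> a \<odot>\<^bsub>A\<^esub> x \<in> I"
      using sub by (auto simp: lsubmodule_def)
    have YI: "y \<in> I" if y: "y \<in> Y" for y
    proof -
      obtain c where c: "c \<in> F y \<rightarrow> carrier R" "y = (\<Oplus>\<^bsub>A\<^esub>x\<in>F y. c x \<odot>\<^bsub>A\<^esub> x)" using F y by blast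
      have "(\<Oplus>\<^bsub>A\<^esub>x\<in>F y. c x \<odot>\<^bsub>A\<^esub> x) \<in> I"
      proof (rule finsum_in[OF I])
        fix x assume x: "x \<in> F y"
        then have "c x \<in> carrier R" "x \<in> I" using c(1) XI y by auto
        then show "c x \<odot>\<^bsub>A\<^esub> x \<in> I" by (rule act)
      qed
      then show ?thesis using c(2) by simp
    qed
    show "I = carrier A"
    proof (intro equalityI subsetI)
      fix m assume "m \<in> carrier A"
      then obtain E c where E: "E \<subseteq> Y" "c \<in> E \<rightarrow> carrier R" "m = (\<Oplus>\<^bsub>A\<^esub>x\<in>E. c x \<odot>\<^bsub>A\<^esub> x)"
        using Y(2) unfolding generates_def by blast
      have "(\<Oplus>\<^bsub>A\<^esub>x\<in>E. c x \<odot>\<^bsub>A\<^esub> x) \<in> I"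
      proof (rule finsum_in[OF I])
        fix y assume y: "y \<in> E"
        then have "c y \<in> carrier R" "y \<in> I" using E YI by auto
        then show "c y \<odot>\<^bsub>A\<^esub> y \<in> I" by (rule act)
      qed
      then show "m \<in> I" using E(3) by simp
    qed (use I(1) in blast)
  qed
qed

lemma (in monoid) free_module_lin_iso:
  assumes A: "left_module (monoid_ring G) A" and fg: "finitely_generated (monoid_ring G) A"
    and fr: "free (monoid_ring G) A"
  shows "\<exists>k \<psi>. lin_iso G (Fr_act G) (Fr G k) A \<psi>"
proof -
  interpret A: left_module "monoid_ring G" A by (rule A)
  obtain X where X: "finite X" "X \<subseteq> carrier A" "independent (monoid_ring G) A X"
    and gen: "\<forall>I. lsubmodule (monoid_ring G) A I \<longrightarrow> X \<subseteq> I \<longrightarrow> I = carrier A"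
    using finite_basis[OF A fg fr] by (elim exE conjE)
  obtain k and b :: "nat \<Rightarrow> _" where b: "bij_betw b {..<k} X"
    using ex_bij_betw_nat_finite[OF X(1)] by (auto simp: atLeast0LessThan)
  have bA: "b j \<in> carrier A" if "j < k" for j
    using b X(2) that by (auto simp: bij_betw_def)
  have sl: "slice j x \<in> frags (carrier G)" if "x \<in> Fr G k" for j x
    by (rule slice_in[OF that])
  define \<psi> where "\<psi> x = (\<Oplus>\<^bsub>A\<^esub>j\<in>{..<k}. slice j x \<odot>\<^bsub>A\<^esub> b j)" for x
  have combf: "(\<lambda>j. c j \<odot>\<^bsub>A\<^esub> b j) \<in> {..<k} \<rightarrow> carrier A" if "\<And>j. j < k \<Longrightarrow> c j \<in> frags (carrier G)" for c
    using that bA A.lsmult_closed by auto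
  have psi_in: "\<psi> x \<in> carrier A" if "x \<in> Fr G k" for x
    unfolding \<psi>_def by (rule A.M.finsum_closed) (rule combf, rule sl[OF that])
  have psi_add: "\<psi> (x + y) = \<psi> x \<oplus>\<^bsub>A\<^esub> \<psi> y" if "x \<in> Fr G k" "y \<in> Fr G k" for x y
  proof -
    have "\<psi> (x + y) = (\<Oplus>\<^bsub>A\<^esub>j\<in>{..<k}. slice j x \<odot>\<^bsub>A\<^esub> b j \<oplus>\<^bsub>A\<^esub> slice j y \<odot>\<^bsub>A\<^esub> b j)"
      unfolding \<psi>_def
      by (rule A.M.finsum_cong')
        (use that bA sl A.lsmult_closed A.lsmult_l_distr in \<open>auto simp: additive.add[OF additive_slice]\<close>)
    also have "\<dots> = \<psi> x \<oplus>\<^bsub>A\<^esub> \<psi> y"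
      unfolding \<psi>_def by (rule A.M.finsum_addf; rule combf; rule sl; rule that)
    finally show ?thesis .
  qed
  have psi_comb: "\<exists>x\<in>Fr G k. \<psi> x = (\<Oplus>\<^bsub>A\<^esub>j\<in>{..<k}. c j \<odot>\<^bsub>A\<^esub> b j)"
    if c: "\<And>j. j < k \<Longrightarrow> c j \<in> frags (carrier G)" for c
  proof -
    obtain x where x: "x \<in> Fr G k" "\<And>j. j < k \<Longrightarrow> slice j x = c j"
      using ex_slices[of k c "carrier G"] c by metis
    have "\<psi> x = (\<Oplus>\<^bsub>A\<^esub>j\<in>{..<k}. c j \<odot>\<^bsub>A\<^esub> b j)"
      unfolding \<psi>_def by (rule A.M.finsum_cong') (use x combf c in auto)
    then show ?thesis using x(1) by blast
  qed
  have act_comb: "a \<odot>\<^bsub>A\<^esub> \<psi> x = (\<Oplus>\<^bsub>A\<^esub>j\<in>{..<k}. (a \<otimes>\<^bsub>monoid_ring G\<^esub> slice j x) \<odot>\<^bsub>A\<^esub> b j)"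
    if a: "a \<in> frags (carrier G)" and x: "x \<in> Fr G k" for a x
  proof -
    have "a \<odot>\<^bsub>A\<^esub> \<psi> x = (\<Oplus>\<^bsub>A\<^esub>j\<in>{..<k}. a \<odot>\<^bsub>A\<^esub> (slice j x \<odot>\<^bsub>A\<^esub> b j))"
      unfolding \<psi>_def by (rule A.lsmult_finsum) (use a combf sl[OF x] in auto)
    also have "\<dots> = (\<Oplus>\<^bsub>A\<^esub>j\<in>{..<k}. (a \<otimes>\<^bsub>monoid_ring G\<^esub> slice j x) \<odot>\<^bsub>A\<^esub> b j)"
      by (rule A.M.finsum_cong')
        (use a sl[OF x] bA A.lsmult_assoc A.lsmult_closed monoid_ring_mult_closed in auto)
    finally show ?thesis .
  qed
  have onto: "\<psi> ` Fr G k = carrier A"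
  proof (rule gen[rule_format])
    have "\<zero>\<^bsub>A\<^esub> \<in> \<psi> ` Fr G k"
    proof -
      have "\<psi> 0 \<oplus>\<^bsub>A\<^esub> \<psi> 0 = \<psi> 0" "\<psi> 0 \<in> carrier A" using psi_add[of 0 0] psi_in[of 0] by simp_all
      then have "\<psi> 0 = \<zero>\<^bsub>A\<^esub>" using A.M.add.l_cancel_one' by simp
      then show ?thesis by (intro rev_image_eqI[of 0]) simp_all
    qed
    moreover have "x \<oplus>\<^bsub>A\<^esub> y \<in> \<psi> ` Fr G k" if "x \<in> \<psi> ` Fr G k" "y \<in> \<psi> ` Fr G k" for x y
    proof -
      obtain x' y' where xy: "x' \<in> Fr G k" "x = \<psi> x'" "y' \<in> Fr G k" "y = \<psi> y'" using \<open>x \<in> _\<close> \<open>y \<in> _\<close> by blast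
      then show ?thesis
        using psi_add[OF xy(1,3)] diff_closed_add[OF diff_closed_frags xy(1,3)]
        by (intro rev_image_eqI[of "x' + y'"]) simp_all
    qed
    moreover have "a \<odot>\<^bsub>A\<^esub> x \<in> \<psi> ` Fr G k" if a: "a \<in> carrier (monoid_ring G)" and x: "x \<in> \<psi> ` Fr G k" for a x
    proof -
      obtain y where y: "y \<in> Fr G k" "x = \<psi> y" using x by blast
      have "\<exists>z\<in>Fr G k. \<psi> z = a \<odot>\<^bsub>A\<^esub> \<psi> y"
        using psi_comb[of "\<lambda>j. a \<otimes>\<^bsub>monoid_ring G\<^esub> slice j y"] act_comb[OF _ y(1)] a sl[OF y(1)]
          monoid_ring_mult_closed by simp
      then show ?thesis using y(2) by force
    qed
    moreover have "\<psi> ` Fr G k \<subseteq> carrier A" using psi_in by blast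
    ultimately show "lsubmodule (monoid_ring G) A (\<psi> ` Fr G k)" by (simp only: lsubmodule_def) blast
    show "X \<subseteq> \<psi> ` Fr G k"
    proof
      fix x assume "x \<in> X"
      then obtain i where i: "i < k" "x = b i" using b by (auto simp: bij_betw_def)
      let ?c = "\<lambda>j. if j = i then frag_of \<one> else (0 :: 'a frag)"
      have "\<exists>y\<in>Fr G k. \<psi> y = (\<Oplus>\<^bsub>A\<^esub>j\<in>{..<k}. ?c j \<odot>\<^bsub>A\<^esub> b j)"
        by (rule psi_comb) simp
      then obtain y where y: "y \<in> Fr G k" "\<psi> y = (\<Oplus>\<^bsub>A\<^esub>j\<in>{..<k}. ?c j \<odot>\<^bsub>A\<^esub> b j)" by blast
      have "(\<Oplus>\<^bsub>A\<^esub>j\<in>{..<k}. ?c j \<odot>\<^bsub>A\<^esub> b j) = (\<Oplus>\<^bsub>A\<^esub>j\<in>{..<k}. if i = j then b j else \<zero>\<^bsub>A\<^esub>)"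
        by (rule A.M.finsum_cong')
          (use bA A.lsmult_one A.lsmult_zero_left in auto)
      also have "\<dots> = b i" by (rule A.M.finsum_singleton) (use i bA in auto)
      finally show "x \<in> \<psi> ` Fr G k" using y i(2) by force
    qed
  qed
  have inj: "inj_on \<psi> (Fr G k)"
  proof (rule inj_onI)
    fix x y assume x: "x \<in> Fr G k" and y: "y \<in> Fr G k" and eq: "\<psi> x = \<psi> y"
    let ?z = "x - y"
    have z: "?z \<in> Fr G k" using x y by (simp add: diff_frags)
    have "\<psi> ?z \<oplus>\<^bsub>A\<^esub> \<psi> y = \<psi> y" using psi_add[OF z y] eq by simp
    then have z0: "\<psi> ?z = \<zero>\<^bsub>A\<^esub>" using psi_in[OF z] psi_in[OF y] A.M.add.r_cancel_one' by simp
    have inv: "inv_into {..<k} b (b j) = j" if "j < k" for j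
      using b that by (simp add: bij_betw_def)
    define c where "c v = slice (inv_into {..<k} b v) ?z" for v
    have c: "c (b j) = slice j ?z" if "j < k" for j using inv[OF that] by (simp add: c_def)
    have cR: "c \<in> X \<rightarrow> carrier (monoid_ring G)" using sl[OF z] by (simp add: c_def)
    have "(\<Oplus>\<^bsub>A\<^esub>v\<in>X. c v \<odot>\<^bsub>A\<^esub> v) = (\<Oplus>\<^bsub>A\<^esub>j\<in>{..<k}. c (b j) \<odot>\<^bsub>A\<^esub> b j)"
    proof -
      have "(\<Oplus>\<^bsub>A\<^esub>v\<in>b ` {..<k}. c v \<odot>\<^bsub>A\<^esub> v) = (\<Oplus>\<^bsub>A\<^esub>j\<in>{..<k}. c (b j) \<odot>\<^bsub>A\<^esub> b j)"
        by (rule A.M.finsum_reindex) (use b cR X(2) A.lsmult_closed in \<open>auto simp: bij_betw_def\<close>)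
      then show ?thesis using b by (simp add: bij_betw_def)
    qed
    also have "\<dots> = \<psi> ?z"
      unfolding \<psi>_def by (rule A.M.finsum_cong') (use c combf sl[OF z] in auto)
    finally have "(\<Oplus>\<^bsub>A\<^esub>v\<in>X. c v \<odot>\<^bsub>A\<^esub> v) = \<zero>\<^bsub>A\<^esub>" using z0 by simp
    then have "\<forall>v\<in>X. c v = \<zero>\<^bsub>monoid_ring G\<^esub>"
      using X(1,3) cR unfolding independent_def by blast
    then have "slice j ?z = 0" if "j < k" for j
      using c[OF that] b that by (auto simp: bij_betw_def)
    then have "?z = 0" by (rule slices_zero[OF z])
    then show "x = y" by simp
  qed
  have "\<psi> (Fr_act G s x) = frag_of s \<odot>\<^bsub>A\<^esub> \<psi> x" if s: "s \<in> carrier G" and x: "x \<in> Fr G k" for s x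
    unfolding act_comb[OF frag_of_in_frags[THEN iffD2, OF s] x] unfolding \<psi>_def slice_Fr_act[OF x s] ..
  then have "lin_iso G (Fr_act G) (Fr G k) A \<psi>"
    unfolding lin_iso_def bij_betw_def using inj onto psi_add by blast
  then show ?thesis by blast
qed

lemma lift_image:
  assumes P: "lin_iso S actP P A \<psi>" and Q: "lin_iso S actQ Q B \<chi>"
    and D: "\<And>x. x \<in> P \<Longrightarrow> D x \<in> Q" "\<And>x. x \<in> P \<Longrightarrow> \<chi> (D x) = f (\<psi> x)"
  shows "D ` P = {q \<in> Q. \<chi> q \<in> f ` carrier A}" and "f ` carrier A = \<chi> ` D ` P"
proof -
  show "f ` carrier A = \<chi> ` D ` P"
    unfolding lin_isoD(3)[OF P, symmetric] image_image using D(2) by (rule image_cong[OF refl, symmetric])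
  then have f: "f ` carrier A = (\<lambda>x. \<chi> (D x)) ` P" by (simp add: image_image)
  show "D ` P = {q \<in> Q. \<chi> q \<in> f ` carrier A}"
  proof (intro equalityI subsetI)
    fix q assume "q \<in> {q \<in> Q. \<chi> q \<in> f ` carrier A}"
    then obtain x where x: "q \<in> Q" "x \<in> P" "\<chi> q = \<chi> (D x)" unfolding f by blast
    then have "q = D x" using inj_onD[OF lin_isoD(2)[OF Q]] D(1) by blast
    then show "q \<in> D ` P" using x(2) by blast
  qed (use D(1) f in auto)
qed

lemma lift_kernel:
  assumes P: "lin_iso S actP P A \<psi>" and Q: "lin_iso S actQ Q B \<chi>"
    and D: "\<And>x. x \<in> P \<Longrightarrow> D x \<in> Q" "\<And>x. x \<in> P \<Longrightarrow> \<chi> (D x) = f (\<psi> x)"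
    and B: "diff_closed Q" "abelian_group B"
  shows "ker P D = {x \<in> P. \<psi> x \<in> a_kernel A B f}" and "a_kernel A B f = \<psi> ` ker P D"
proof -
  have "0 \<in> Q" using B(1) by (simp add: diff_closed_def)
  then have "D x = 0 \<longleftrightarrow> f (\<psi> x) = \<zero>\<^bsub>B\<^esub>" if "x \<in> P" for x
    using D(1)[OF that] D(2)[OF that] lin_iso_zero[OF Q B] inj_onD[OF lin_isoD(2)[OF Q], of "D x" 0] by auto
  then have *: "x \<in> ker P D \<longleftrightarrow> x \<in> P \<and> \<psi> x \<in> a_kernel A B f" for x
    using lin_isoD(4)[OF P, of x] by (auto simp: ker_def a_kernel_def')
  then show "ker P D = {x \<in> P. \<psi> x \<in> a_kernel A B f}" by blast
  have "y \<in> \<psi> ` P" if "y \<in> a_kernel A B f" for y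
    using that lin_isoD(3)[OF P] by (simp add: a_kernel_def')
  then show "a_kernel A B f = \<psi> ` ker P D" using * by blast
qed

text \<open>
  The free module of rank \<open>k\<close> as a record, with elements the coordinate vectors, extended by
  zero.
\<close>
definition coord_module :: "('a, 'x) monoid_scheme \<Rightarrow> nat \<Rightarrow> ('a frag, nat \<Rightarrow> 'a frag) module" where
  "coord_module S k =
     \<lparr>carrier = {x. (\<forall>j<k. x j \<in> frags (carrier S)) \<and> (\<forall>j\<ge>k. x j = 0)},
      mult = (\<lambda>x y. x), one = (\<lambda>_. 0), zero = (\<lambda>_. 0), add = (\<lambda>x y j. x j + y j),
      smult = (\<lambda>a x j. a \<otimes>\<^bsub>monoid_ring S\<^esub> x j)\<rparr>"

lemma coord_module_simps [simp]:
  "x \<in> carrier (coord_module S k) \<longleftrightarrow> (\<forall>j<k. x j \<in> frags (carrier S)) \<and> (\<forall>j\<ge>k. x j = 0)"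
  "\<zero>\<^bsub>coord_module S k\<^esub> = (\<lambda>_. 0)"
  "x \<oplus>\<^bsub>coord_module S k\<^esub> y = (\<lambda>j. x j + y j)"
  "a \<odot>\<^bsub>coord_module S k\<^esub> x = (\<lambda>j. a \<otimes>\<^bsub>monoid_ring S\<^esub> x j)"
  by (simp_all add: coord_module_def)

lemma coord_mem: "x \<in> carrier (coord_module S k) \<Longrightarrow> x j \<in> frags (carrier S)"
  by (cases "j < k") auto

context monoid
begin

lemma left_module_coord: "left_module (monoid_ring G) (coord_module G k)"
proof -
  interpret R: ring "monoid_ring G" by (rule ring_monoid_ring)
  have "abelian_group (coord_module G k)"
  proof (rule abelian_groupI)
    fix x assume "x \<in> carrier (coord_module G k)"
    then show "\<exists>y\<in>carrier (coord_module G k). y \<oplus>\<^bsub>coord_module G k\<^esub> x = \<zero>\<^bsub>coord_module G k\<^esub>"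
      by (intro bexI[of _ "\<lambda>j. - x j"]) (auto simp: frags_def)
  qed (auto simp: diff_closed_add[OF diff_closed_frags] algebra_simps)
  moreover have "a \<otimes>\<^bsub>monoid_ring G\<^esub> 0 = 0" for a
    by (rule additive.zero[OF additive_monoid_ring_mult(2)])
  moreover have "frag_of \<one> \<otimes>\<^bsub>monoid_ring G\<^esub> x j = x j" if "x \<in> carrier (coord_module G k)" for x j
    using R.l_one[of "x j"] coord_mem[OF that, of j] by simp
  ultimately show ?thesis
    by (intro left_module.intro left_module_axioms.intro R.ring_axioms)
      (auto simp del: coord_module_simps(1) simp: monoid_ring_assoc coord_mem
        additive.add[OF additive_monoid_ring_mult(1)] additive.add[OF additive_monoid_ring_mult(2)],
       auto simp: monoid_ring_mult_closed)
qed

lemma finsum_coord: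
  assumes "f \<in> I \<rightarrow> carrier (coord_module G k)" "finite I"
  shows "(\<Oplus>\<^bsub>coord_module G k\<^esub>i\<in>I. f i) j = (\<Sum>i\<in>I. f i j)"
proof -
  interpret A: left_module "monoid_ring G" "coord_module G k" by (rule left_module_coord)
  show ?thesis
    using assms(2,1)
  proof (induction I)
    case (insert i I)
    then have "f \<in> I \<rightarrow> carrier (coord_module G k)" "f i \<in> carrier (coord_module G k)" by auto
    then show ?case using insert by (simp del: coord_module_simps(1))
  qed simp
qed

definition unit_vector :: "nat \<Rightarrow> nat \<Rightarrow> 'a frag" where
  "unit_vector i = (\<lambda>j. if j = i then frag_of \<one> else 0)"

lemma coord_combination:
  assumes I: "I \<subseteq> {..<k}" and c: "\<And>i. i \<in> I \<Longrightarrow> c (unit_vector i) \<in> frags (carrier G)"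
  shows "(\<Oplus>\<^bsub>coord_module G k\<^esub>x\<in>unit_vector ` I. c x \<odot>\<^bsub>coord_module G k\<^esub> x) j =
    (if j \<in> I then c (unit_vector j) else 0)"
proof -
  interpret R: ring "monoid_ring G" by (rule ring_monoid_ring)
  have fin: "finite I" using I finite_subset by blast
  have inj: "inj_on unit_vector I"
    by (rule inj_onI) (metis frag_of_nonzero unit_vector_def)
  have m0: "a \<otimes>\<^bsub>monoid_ring G\<^esub> 0 = 0" for a by (rule additive.zero[OF additive_monoid_ring_mult(2)])
  have "(\<lambda>x. c x \<odot>\<^bsub>coord_module G k\<^esub> x) \<in> unit_vector ` I \<rightarrow> carrier (coord_module G k)"
    using I c by (auto simp: unit_vector_def m0 monoid_ring_mult_closed)
  then have "(\<Oplus>\<^bsub>coord_module G k\<^esub>x\<in>unit_vector ` I. c x \<odot>\<^bsub>coord_module G k\<^esub> x) j =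
      (\<Sum>x\<in>unit_vector ` I. c x \<otimes>\<^bsub>monoid_ring G\<^esub> x j)"
    using finsum_coord[of _ "unit_vector ` I" k j] fin by simp
  also have "\<dots> = (\<Sum>i\<in>I. c (unit_vector i) \<otimes>\<^bsub>monoid_ring G\<^esub> unit_vector i j)"
    using inj by (simp add: sum.reindex)
  also have "\<dots> = (\<Sum>i\<in>I. if j = i then c (unit_vector i) else 0)"
  proof (rule sum.cong)
    fix i assume "i \<in> I"
    then show "c (unit_vector i) \<otimes>\<^bsub>monoid_ring G\<^esub> unit_vector i j = (if j = i then c (unit_vector i) else 0)"
      using R.r_one[of "c (unit_vector i)"] c[of i] by (simp add: unit_vector_def m0)
  qed simp
  also have "\<dots> = (if j \<in> I then c (unit_vector j) else 0)" using fin by simp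
  finally show ?thesis .
qed

lemma unit_vector_in: "i < k \<Longrightarrow> unit_vector i \<in> carrier (coord_module G k)"
  by (auto simp: unit_vector_def)

lemma generates_coord: "generates (monoid_ring G) (coord_module G k) (unit_vector ` {..<k})"
  unfolding generates_def
proof (intro conjI ballI)
  show "unit_vector ` {..<k} \<subseteq> carrier (coord_module G k)" using unit_vector_in by blast
  fix m assume m: "m \<in> carrier (coord_module G k)"
  have inj: "inj_on unit_vector {..<k}"
    by (rule inj_onI) (metis frag_of_nonzero unit_vector_def)
  define c where "c x = m (inv_into {..<k} unit_vector x)" for x
  have c: "c (unit_vector i) = m i" if "i < k" for i
    using inj that by (simp add: c_def)
  have "m = (\<Oplus>\<^bsub>coord_module G k\<^esub>x\<in>unit_vector ` {..<k}. c x \<odot>\<^bsub>coord_module G k\<^esub> x)"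
  proof
    show "m j = (\<Oplus>\<^bsub>coord_module G k\<^esub>x\<in>unit_vector ` {..<k}. c x \<odot>\<^bsub>coord_module G k\<^esub> x) j" for j
      using coord_combination[of "{..<k}" k c j] c m by auto
  qed
  moreover have "c \<in> unit_vector ` {..<k} \<rightarrow> carrier (monoid_ring G)"
    using coord_mem[OF m] by (simp add: c_def)
  ultimately show "\<exists>F c. finite F \<and> F \<subseteq> unit_vector ` {..<k} \<and> c \<in> F \<rightarrow> carrier (monoid_ring G) \<and>
      m = (\<Oplus>\<^bsub>coord_module G k\<^esub>x\<in>F. c x \<odot>\<^bsub>coord_module G k\<^esub> x)"
    by (intro exI[of _ "unit_vector ` {..<k}"] exI[of _ c]) simp
qed

lemma independent_coord: "independent (monoid_ring G) (coord_module G k) (unit_vector ` {..<k})"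
  unfolding independent_def
proof (intro conjI allI impI)
  show "unit_vector ` {..<k} \<subseteq> carrier (coord_module G k)" using unit_vector_in by blast
  fix F c
  assume *: "finite F \<and> F \<subseteq> unit_vector ` {..<k} \<and> c \<in> F \<rightarrow> carrier (monoid_ring G) \<and>
    (\<Oplus>\<^bsub>coord_module G k\<^esub>x\<in>F. c x \<odot>\<^bsub>coord_module G k\<^esub> x) = \<zero>\<^bsub>coord_module G k\<^esub>"
  then have "F \<subseteq> unit_vector ` {..<k}" by blast
  then obtain I where I: "I \<subseteq> {..<k}" "F = unit_vector ` I" by (rule subset_imageE)
  have c: "c (unit_vector i) \<in> frags (carrier G)" if "i \<in> I" for i using * that I(2) by auto
  have "c (unit_vector j) = 0" if "j \<in> I" for j
  proof -
    have "(\<Oplus>\<^bsub>coord_module G k\<^esub>x\<in>F. c x \<odot>\<^bsub>coord_module G k\<^esub> x) j = 0" using * by simp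
    then show ?thesis
      using coord_combination[where c = c and j = j, OF I(1) c] that unfolding I(2) by simp
  qed
  then show "\<forall>x\<in>F. c x = \<zero>\<^bsub>monoid_ring G\<^esub>" unfolding I(2) by simp
qed

lemma lin_iso_coord: "lin_iso G (Fr_act G) (Fr G k) (coord_module G k) (\<lambda>x j. slice j x)"
  unfolding lin_iso_def bij_betw_def
proof (intro conjI ballI)
  have big: "slice j x = 0" if "x \<in> Fr G k" "j \<ge> k" for x j
    by (rule additive_eq_on_frags[OF additive_slice additive_0 that(1)]) (use that(2) in auto)
  show "inj_on (\<lambda>x j. slice j x) (Fr G k)"
  proof (rule inj_onI)
    fix x y assume x: "x \<in> Fr G k" and y: "y \<in> Fr G k" and eq: "(\<lambda>j. slice j x) = (\<lambda>j. slice j y)"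
    have "slice j (x - y) = 0" for j using fun_cong[OF eq, of j] by (simp add: additive.diff[OF additive_slice])
    then have "x - y = 0" using slices_zero[OF diff_frags[OF x y]] by blast
    then show "x = y" by simp
  qed
  show "(\<lambda>x j. slice j x) ` Fr G k = carrier (coord_module G k)"
  proof (intro equalityI subsetI)
    fix c assume c: "c \<in> carrier (coord_module G k)"
    obtain x where x: "x \<in> Fr G k" "\<forall>j<k. slice j x = c j"
      using ex_slices[of k c "carrier G"] c by auto
    have "slice j x = c j" for j using x big[OF x(1), of j] c by (cases "j < k") auto
    then show "c \<in> (\<lambda>x j. slice j x) ` Fr G k" using x(1) by (intro rev_image_eqI[OF x(1)]) auto
  qed (auto simp: big slice_in)
qed (auto simp: additive.add[OF additive_slice] slice_Fr_act)

lemma lin_iso_trivial: "lin_iso G (\<lambda>_ x. x) UNIV trivial_module (\<lambda>x. Poly_Mapping.lookup x ())"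
proof -
  have "bij (\<lambda>x :: unit frag. Poly_Mapping.lookup x ())"
  proof (rule bijI)
    show "inj (\<lambda>x :: unit frag. Poly_Mapping.lookup x ())"
      by (rule injI, rule poly_mapping_eqI) simp
    show "surj (\<lambda>x :: unit frag. Poly_Mapping.lookup x ())"
      by (rule surjI[where f = "\<lambda>z. frag_cmul z (frag_of ())"]) simp
  qed
  then show ?thesis by (simp add: lin_iso_def trivial_module_def lookup_add)
qed

text \<open>
  Resolutions are carried over degree by degree through isomorphisms of the free modules.
\<close>
theorem left_FP_iff_FPZ: "left_FP n G \<longleftrightarrow> FPZ n G"
proof
  let ?R = "monoid_ring G" and ?T = "trivial_module :: ('a frag, int) module"
    and ?\<tau> = "\<lambda>x :: unit frag. Poly_Mapping.lookup x ()"
  have T: "abelian_group ?T" using left_module_trivial by (simp add: left_module_def)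
  have dc: "diff_closed (UNIV :: unit frag set)" by (simp add: diff_closed_def)
  {
    assume "left_FP n G"
    then obtain A :: "nat \<Rightarrow> ('a frag, nat \<Rightarrow> 'a frag) module" and \<epsilon> d
      where res: "partial_free_resolution ?R ?T n A \<epsilon> d"
      by (auto simp: left_FP_def module_FP_def)
    have A: "\<And>i. i \<le> n \<Longrightarrow> left_module ?R (A i)"
      and fgfr: "\<And>i. i \<le> n \<Longrightarrow> finitely_generated ?R (A i)" "\<And>i. i \<le> n \<Longrightarrow> free ?R (A i)"
      and eps: "\<epsilon> \<in> linear_maps ?R (A 0) ?T" "\<epsilon> ` carrier (A 0) = carrier ?T"
      and d: "\<And>i. i < n \<Longrightarrow> d i \<in> linear_maps ?R (A (Suc i)) (A i)"
      and ex0: "0 < n \<Longrightarrow> d 0 ` carrier (A 1) = a_kernel (A 0) ?T \<epsilon>"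
      and ex: "\<And>i. Suc i < n \<Longrightarrow> d (Suc i) ` carrier (A (Suc (Suc i))) = a_kernel (A (Suc i)) (A i) (d i)"
      using res unfolding partial_free_resolution_def by auto
    have ab: "abelian_group (A i)" if "i \<le> n" for i
      using A[OF that] by (simp add: left_module_def)
    have "\<forall>i\<in>{..n}. \<exists>p. lin_iso G (Fr_act G) (Fr G (fst p)) (A i) (snd p)"
    proof
      fix i assume "i \<in> {..n}"
      then have "i \<le> n" by simp
      then obtain k \<psi> where "lin_iso G (Fr_act G) (Fr G k) (A i) \<psi>"
        using free_module_lin_iso[OF A[of i] fgfr(1)[of i] fgfr(2)[of i]] by blast
      then show "\<exists>p. lin_iso G (Fr_act G) (Fr G (fst p)) (A i) (snd p)" by (intro exI[of _ "(k, \<psi>)"]) simp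
    qed
    from bchoice[OF this] obtain p where
      p: "\<forall>i\<in>{..n}. lin_iso G (Fr_act G) (Fr G (fst (p i))) (A i) (snd (p i))" ..
    define k where "k i = fst (p i)" for i
    define \<psi> where "\<psi> i = snd (p i)" for i
    have iso: "lin_iso G (Fr_act G) (Fr G (k i)) (A i) (\<psi> i)" if "i \<le> n" for i
      using p that by (simp add: k_def \<psi>_def)
    obtain \<phi> where phi: "free_map G (k 0) (\<lambda>_ x. x) UNIV \<phi>"
      "\<And>x. x \<in> Fr G (k 0) \<Longrightarrow> ?\<tau> (\<phi> x) = \<epsilon> (\<psi> 0 x)"
      using lift_to_frags[OF iso[of 0] lin_iso_trivial smodule_Fr smodule_trivial ab[of 0] T eps(1)] by auto
    have "\<forall>i\<in>{..<n}. \<exists>D. free_map G (k (Suc i)) (Fr_act G) (Fr G (k i)) D \<and>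
        (\<forall>x\<in>Fr G (k (Suc i)). \<psi> i (D x) = d i (\<psi> (Suc i) x))"
    proof
      fix i assume "i \<in> {..<n}"
      then have i: "Suc i \<le> n" "i \<le> n" "i < n" by auto
      show "\<exists>D. free_map G (k (Suc i)) (Fr_act G) (Fr G (k i)) D \<and>
        (\<forall>x\<in>Fr G (k (Suc i)). \<psi> i (D x) = d i (\<psi> (Suc i) x))"
        by (rule lift_to_frags[OF iso[OF i(1)] iso[OF i(2)] smodule_Fr smodule_Fr ab[OF i(1)] ab[OF i(2)] d[OF i(3)]])
    qed
    from bchoice[OF this] obtain D where
      D: "\<forall>i\<in>{..<n}. free_map G (k (Suc i)) (Fr_act G) (Fr G (k i)) (D i) \<and>
        (\<forall>x\<in>Fr G (k (Suc i)). \<psi> i (D i x) = d i (\<psi> (Suc i) x))" ..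
    have De: "free_map G (k (Suc i)) (Fr_act G) (Fr G (k i)) (D i)"
      and Din: "\<And>x. x \<in> Fr G (k (Suc i)) \<Longrightarrow> D i x \<in> Fr G (k i)"
      and Dpsi: "\<And>x. x \<in> Fr G (k (Suc i)) \<Longrightarrow> \<psi> i (D i x) = d i (\<psi> (Suc i) x)" if "i < n" for i
      using D that by (auto simp: equivariant_def)
    have "free_res n G (\<lambda>_ x. x) UNIV k \<phi> D"
      unfolding free_res_def
    proof (intro conjI allI impI)
      show "free_map G (k 0) (\<lambda>_ x. x) UNIV \<phi>" by (rule phi)
      show "free_map G (k (Suc i)) (Fr_act G) (Fr G (k i)) (D i)" if "i < n" for i
        by (rule De[OF that])
      show "\<phi> ` Fr G (k 0) = UNIV"
        using lift_image(1)[where D = \<phi> and f = \<epsilon>, OF iso[of 0] lin_iso_trivial _ phi(2)] eps(2) by (simp add: trivial_module_def)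
      show "D 0 ` Fr G (k 1) = ker (Fr G (k 0)) \<phi>" if n: "0 < n"
        using lift_image(1)[where D = "D 0" and f = "d 0", OF iso[of "Suc 0"] iso[of 0] Din[OF n] Dpsi[OF n]]
          lift_kernel(1)[where D = \<phi> and f = \<epsilon>, OF iso[of 0] lin_iso_trivial _ phi(2) dc T] ex0[OF n] n by simp
      show "D (Suc i) ` Fr G (k (Suc (Suc i))) = ker (Fr G (k (Suc i))) (D i)" if i: "Suc i < n" for i
      proof -
        have i': "i < n" using i by simp
        show ?thesis
          using lift_image(1)[where D = "D (Suc i)" and f = "d (Suc i)", OF iso[of "Suc (Suc i)"] iso[of "Suc i"] Din[OF i] Dpsi[OF i]]
            lift_kernel(1)[where D = "D i" and f = "d i", OF iso[of "Suc i"] iso[of i] Din[OF i'] Dpsi[OF i'] diff_closed_frags ab[of i]] ex[OF i] i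
          by simp
      qed
    qed
    then show "FPZ n G" by (rule FP_intro)
  next
    assume "FPZ n G"
    then obtain k \<phi> D where r: "free_res n G (\<lambda>_ x. x) (UNIV :: unit frag set) k \<phi> D" by (rule FP_elim)
    let ?A = "\<lambda>i. coord_module G (k i)" and ?\<psi> = "\<lambda>x j. slice j x"
    note phi = free_resD(1,3)[OF r] and D = free_resD(2)[OF r]
    have ab: "abelian_group (?A i)" for i using left_module_coord[of "k i"] by (simp add: left_module_def)
    obtain \<epsilon> where eps: "\<epsilon> \<in> linear_maps ?R (?A 0) ?T" "\<And>x. x \<in> Fr G (k 0) \<Longrightarrow> \<epsilon> (?\<psi> x) = ?\<tau> (\<phi> x)"
      using lower_from_frags[OF lin_iso_coord lin_iso_trivial smodule_Fr left_module_coord left_module_trivial phi(1)]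
      by auto
    have "\<forall>i\<in>{..<n}. \<exists>f. f \<in> linear_maps ?R (?A (Suc i)) (?A i) \<and> (\<forall>x\<in>Fr G (k (Suc i)). f (?\<psi> x) = ?\<psi> (D i x))"
      using lower_from_frags[OF lin_iso_coord lin_iso_coord smodule_Fr left_module_coord left_module_coord D] by auto
    from bchoice[OF this] obtain d where
      d0: "\<forall>i\<in>{..<n}. d i \<in> linear_maps ?R (?A (Suc i)) (?A i) \<and> (\<forall>x\<in>Fr G (k (Suc i)). d i (?\<psi> x) = ?\<psi> (D i x))" ..
    have d: "d i \<in> linear_maps ?R (?A (Suc i)) (?A i)"
      and dD: "\<And>x. x \<in> Fr G (k (Suc i)) \<Longrightarrow> ?\<psi> (D i x) = d i (?\<psi> x)"
      and Din: "\<And>x. x \<in> Fr G (k (Suc i)) \<Longrightarrow> D i x \<in> Fr G (k i)" if "i < n" for i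
      using d0 D[OF that] that by (auto simp: equivariant_def)
    have "partial_free_resolution ?R ?T n ?A \<epsilon> d"
      unfolding partial_free_resolution_def
    proof (intro conjI allI impI)
      show "left_module ?R (?A i)" for i by (rule left_module_coord)
      show "finitely_generated ?R (?A i)" for i
        unfolding finitely_generated_def using generates_coord by blast
      show "free ?R (?A i)" for i
        unfolding free_def using generates_coord independent_coord by blast
      show "\<epsilon> \<in> linear_maps ?R (?A 0) ?T" by (rule eps)
      show "d i \<in> linear_maps ?R (?A (Suc i)) (?A i)" if "i < n" for i by (rule d[OF that])
      show "\<epsilon> ` carrier (?A 0) = carrier ?T"
        using lift_image(2)[where D = \<phi> and f = \<epsilon>, OF lin_iso_coord lin_iso_trivial _ eps(2)[symmetric]] phi(2)
          lin_isoD(3)[OF lin_iso_trivial] by simp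
      show "d 0 ` carrier (?A 1) = a_kernel (?A 0) ?T \<epsilon>" if n: "0 < n"
        using lift_image(2)[where D = "D 0" and f = "d 0", OF lin_iso_coord lin_iso_coord Din[OF n] dD[OF n]]
          lift_kernel(2)[where D = \<phi> and f = \<epsilon>, OF lin_iso_coord lin_iso_trivial _ eps(2)[symmetric] dc T] free_resD(4)[OF r n] by simp
      show "d (Suc i) ` carrier (?A (Suc (Suc i))) = a_kernel (?A (Suc i)) (?A i) (d i)" if i: "Suc i < n" for i
      proof -
        have i': "i < n" using i by simp
        show ?thesis
          using lift_image(2)[where D = "D (Suc i)" and f = "d (Suc i)", OF lin_iso_coord lin_iso_coord Din[OF i] dD[OF i]]
            lift_kernel(2)[where D = "D i" and f = "d i", OF lin_iso_coord lin_iso_coord Din[OF i'] dD[OF i'] diff_closed_frags ab] free_resD(5)[OF r i]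
          by simp
      qed
    qed
    then show "left_FP n G" unfolding left_FP_def module_FP_def by blast
  }
qed

end


section \<open>Completely simple semigroups of type FP\<close>

lemma semigroup_right_FP_op: "semigroup_right_FP n U \<longleftrightarrow> semigroup_left_FP n (op_sgrp U)"
  by (simp add: semigroup_right_FP_def semigroup_left_FP_def right_FP_op as_monoid_op adjoin_one_op)

context pointed_rees
begin

text \<open>
  As \<open>g i = i (g i) i = i\<close>, the identity lies in \<open>eUe\<close>.
\<close>
lemma identity_eq:
  assumes "is_identity U i"
  shows "i = e"
proof -
  have i: "i \<in> carrier U" "\<And>x. x \<in> carrier U \<Longrightarrow> i \<cdot> x = x \<and> x \<cdot> i = x"
    using assms by (auto simp: is_identity_def)
  have "g i = i" using x_g_x[OF i(1)] i by simp
  then have "e \<cdot> i = i" using e_g[OF i(1)] by simp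
  then show ?thesis using i(2)[of e] by simp
qed

lemma as_monoid_eq_grp:
  assumes "is_identity U i"
  shows "as_monoid U = grp"
proof -
  have e: "is_identity U e" using assms identity_eq by blast
  then have "(THE i. is_identity U i) = e" using identity_eq by blast
  moreover have "carrier U = {x \<in> carrier U. e \<cdot> x = x \<and> x \<cdot> e = x}"
    using e by (auto simp: is_identity_def)
  ultimately show ?thesis by (simp add: as_monoid_def grp_def)
qed

lemma left_FP_grp_iff: "left_FP n grp \<longleftrightarrow> FPZ n grp"
proof -
  interpret G: group grp by (rule group_grp)
  show ?thesis by (rule G.left_FP_iff_FPZ)
qed

lemma semigroup_left_FP_iff:
  "semigroup_left_FP n U \<longleftrightarrow> (if \<exists>i. is_identity U i then FPZ n grp else FPZ n (adjoin_one U))"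
proof -
  interpret S: monoid "adjoin_one U" by (rule monoid_S)
  show ?thesis
    by (auto simp: semigroup_left_FP_def as_monoid_eq_grp left_FP_grp_iff S.left_FP_iff_FPZ)
qed

lemma finite_left_band_of_FP:
  assumes "1 \<le> n" "semigroup_left_FP n U"
  shows "finite left_band"
proof (cases "\<exists>i. is_identity U i")
  case True
  then have "is_identity U e" using identity_eq by blast
  then have "left_band \<subseteq> {e}"
    using e_left_band left_bandD(1) by (auto simp: is_identity_def)
  then show ?thesis by (rule finite_subset) simp
next
  case False
  then have "FPZ n (adjoin_one U)" using assms(2) by (simp add: semigroup_left_FP_iff)
  with assms(1) have "FPZ 1 (adjoin_one U)"
    by (induction n rule: dec_induct) (auto intro: FP_Suc_imp_FP)
  then show ?thesis by (rule finite_left_band)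
qed

lemma FPZ_grp_of_FP:
  assumes "finite right_band" "semigroup_left_FP n U"
  shows "FPZ n grp"
  using assms FPZ_grp_of_adjoin_one by (auto simp: semigroup_left_FP_iff split: if_splits)

lemma FP_of_FPZ_grp:
  assumes "finite left_band" "finite right_band" "FPZ n grp"
  shows "semigroup_left_FP n U"
  using assms FPZ_adjoin_one_of_grp by (auto simp: semigroup_left_FP_iff)

lemma grp_op: "pointed_rees.grp (op_sgrp U) e = op_monoid grp"
  unfolding pointed_rees.grp_def[OF pointed_rees_op[OF pointed_rees_axioms]] grp_def op_monoid_def
  by (auto simp: op_sgrp_def)

end

theorem theorem5:
  fixes U :: "'a sgrp" and H :: "'a monoid" and n :: nat
  assumes "n \<ge> 1"
    and "completely_simple U"
    and "maximal_subgroup U H"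
  shows "semigroup_left_FP n U \<and> semigroup_right_FP n U \<longleftrightarrow>
    finite {L. left_ideal U L} \<and> finite {K. right_ideal U K} \<and> group_FP n H"
proof -
  obtain e where e: "e \<in> carrier U" "e \<cdot>\<^bsub>U\<^esub> e = e" "H = units_of (local_monoid U e)"
    using assms(3) by (auto simp: maximal_subgroup_def)
  obtain g where "pointed_rees U e g"
    using completely_simple_pointed_rees[OF assms(2) e(1,2)] .
  then interpret U: pointed_rees U e g .
  interpret V: pointed_rees "op_sgrp U" e g by (rule pointed_rees_op[OF U.pointed_rees_axioms])
  have H: "H = U.grp" using e(3) U.maximal_subgroup_eq_grp by simp
  have bands: "V.left_band = U.right_band" "V.right_band = U.left_band"
    using U.right_band_conv V.right_band_conv by simp_all
  have Hop: "V.grp = op_monoid U.grp" by (rule U.grp_op)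
  show ?thesis
    unfolding U.finite_left_ideals U.finite_right_ideals group_FP_def H U.left_FP_grp_iff semigroup_right_FP_op
  proof
    assume FP: "semigroup_left_FP n U \<and> semigroup_left_FP n (op_sgrp U)"
    then have "finite U.left_band" "finite U.right_band"
      using U.finite_left_band_of_FP V.finite_left_band_of_FP assms(1) bands by auto
    then show "finite U.right_band \<and> finite U.left_band \<and> FPZ n U.grp"
      using U.FPZ_grp_of_FP FP by blast
  next
    assume fin: "finite U.right_band \<and> finite U.left_band \<and> FPZ n U.grp"
    then have "FPZ n V.grp" unfolding Hop by (intro FPZ_op U.group_grp) blast
    then show "semigroup_left_FP n U \<and> semigroup_left_FP n (op_sgrp U)"
      using fin U.FP_of_FPZ_grp V.FP_of_FPZ_grp bands by simp
  qed
qed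

end
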